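(* Let $p$ and $q$ be monic polynomials of degree $2$ in $\mathbb{F}[t]$ such that $p(0)q(0)\neq 0$. Let $u$ be an endomorphism of a finite-dimensional vector space $V$ over $\mathbb{F}$. Assume that $u$ is q-regular with respect to $(p,q)$ and set $\delta:=p(0)q(0)^{-1}$. The following conditions are equivalent: (i) The endomorphism $u$ is a $(p,q)$-quotient. (ii) The invariant factors of $u$ read $R_\delta(p_1),\dots,R_\delta(p_{2n-1}),R_\delta(p_{2n}),\dots$ (for monic polynomials $p_1,p_2,\dots$ of $\mathbb{F}[t]$) where, for every irreducible monic polynomial $r\in\mathbb{F}[t]$ that has Type $2$ with respect to $(p,q)$ and every positive integer $n$, the polynomials $p_{2n-1}$ and $p_{2n}$ have the same valuation with respect to $r$. (iii) There is a basis of $V$ in which $u$ is represented by a block-diagonal matrix where every diagonal block equals either $C\bigl(R_\delta(r^n)\bigr)$ for some irreducible monic polynomial $r\in\mathbb{F}[t]$ of Type $1$ with respect to $(p,q)$ and some positive integer $n$, or $C\bigl(R_\delta(r^n)\bigr)\oplus C\bigl(R_\delta(r^n)\bigr)$ for some irreducible monic polynomial $r\in\mathbb{F}[t]$ and some positive integer $n$.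
   Context: $\mathbb{F}$ is an arbitrary field (any characteristic) with algebraic closure $\overline{\mathbb{F}}$. $\operatorname{Root}(p)$ is the set of roots of $p$ in $\overline{\mathbb{F}}$, and $\operatorname{Root}(p)\operatorname{Root}(q)^{-1}=\{xy^{-1}: x\in\operatorname{Root}(p),\,y\in\operatorname{Root}(q)\}$. An endomorphism $u$ of $V$ is a $(p,q)$-quotient if $u=ab^{-1}$ for some automorphisms $a,b$ of $V$ with $p(a)=0$ and $q(b)=0$. It is q-regular with respect to $(p,q)$ if no eigenvalue of $u$ in $\overline{\mathbb{F}}$ belongs to $\operatorname{Root}(p)\operatorname{Root}(q)^{-1}$. For a monic polynomial $r$ of degree $d$ and a nonzero scalar $\delta$, $R_\delta(r):=t^d\,r(t+\delta t^{-1})$, a monic polynomial of degree $2d$. $C(r)$ is the companion matrix of the monic polynomial $r$ ($C(1)$ is the $0\times0$ matrix); $\oplus$ is block-diagonal sum. The invariant factors of $u$ are the monic polynomials $r_1,r_2,\dots$ with $r_{i+1}\mid r_i$ such that $u$ is represented in some basis by $C(r_1)\oplus C(r_2)\oplus\cdots$; the finite list of nonconstant ones is extended to an infinite sequence by $r_i=1$. The norm form. Write $p(t)=t^2-\lambda t+\alpha$ and $q(t)=t^2-\mu t+\beta$. For a field extension $\mathbb{L}$ of $\mathbb{F}$ and $x\in\mathbb{L}$, let $\mathcal{W}(p,q,x)_{\mathbb{L}}$ be the $4$-dimensional subalgebra of $\mathrm{M}_4(\mathbb{L})$ with $\mathbb{L}$-basis $(I_4,A,B,AB)$, where $$A=\begin{bmatrix}0&-\alpha&0&0\\1&\lambda&0&0\\0&0&0&-\alpha\\0&0&1&\lambda\end{bmatrix},\qquad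 B=\begin{bmatrix}0&-x&-\beta&-\lambda\beta\\0&\mu&0&\beta\\1&\lambda&\mu&\lambda\mu-x\\0&-1&0&0\end{bmatrix}.$$ Its norm is the quadratic form over $\mathbb{L}$ $$aI_4+bA+cB+dAB\mapsto a\bigl(a+\lambda b+\mu c+(\lambda\mu-x)d\bigr)+b\bigl(\alpha b+xc+\alpha\mu d\bigr)+\beta c^2+\bigl(\lambda\beta c+\alpha\beta d\bigr)d .$$ A quadratic form is isotropic if it vanishes at some nonzero vector. Types. Let $r\in\mathbb{F}[t]$ be irreducible and monic, $\mathbb{L}:=\mathbb{F}[t]/(r)$, and $x$ the class of $t$ in $\mathbb{L}$. Then $r$ has Type $1$ (respectively, Type $2$) with respect to $(p,q)$ if $R_\delta(r)$ has no root in $\operatorname{Root}(p)\operatorname{Root}(q)^{-1}$ and the norm of $\mathcal{W}\bigl(p,q,q(0)x\bigr)_{\mathbb{L}}$ is isotropic (respectively, non-isotropic). *)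

theory Defs
  imports
    "HOL-Computational_Algebra.Computational_Algebra"
    "HOL-Algebra.QuotRing"
    "HOL-Algebra.Algebraic_Closure_Type"
    "Jordan_Normal_Form.Char_Poly"
begin

section \<open>Endomorphisms and matrices\<close>

text \<open>Here \<open>V\<close> is the whole type \<open>'v\<close>. A basis is an ordered list of vectors. The coordinates of the image of the \<open>j\<close>-th basis
  vector form the \<open>j\<close>-th column of the matrix.\<close>

definition is_basis :: "('a::field \<Rightarrow> 'v::ab_group_add \<Rightarrow> 'v) \<Rightarrow> 'v list \<Rightarrow> bool" where
  "is_basis scale bs \<longleftrightarrow>
     distinct bs \<and> \<not> module.dependent scale (set bs) \<and> module.span scale (set bs) = UNIV"

definition represented_in ::
  "('a::field \<Rightarrow> 'v::ab_group_add \<Rightarrow> 'v) \<Rightarrow> ('v \<Rightarrow> 'v) \<Rightarrow> 'v list \<Rightarrow> 'a mat \<Rightarrow> bool" where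
  "represented_in scale u bs M \<longleftrightarrow>
     is_basis scale bs \<and> M \<in> carrier_mat (length bs) (length bs) \<and>
     (\<forall>j < length bs. u (bs ! j) = (\<Sum>i < length bs. scale (M $$ (i, j)) (bs ! i)))"

definition poly_endo ::
  "('a::field \<Rightarrow> 'v::ab_group_add \<Rightarrow> 'v) \<Rightarrow> 'a poly \<Rightarrow> ('v \<Rightarrow> 'v) \<Rightarrow> 'v \<Rightarrow> 'v" where
  "poly_endo scale p f = (\<lambda>v. \<Sum>i\<le>degree p. scale (poly.coeff p i) ((f ^^ i) v))"

definition is_automorphism ::
  "('a::field \<Rightarrow> 'v::ab_group_add \<Rightarrow> 'v) \<Rightarrow> ('v \<Rightarrow> 'v) \<Rightarrow> bool" where
  "is_automorphism scale f \<longleftrightarrow> Vector_Spaces.linear scale scale f \<and> bij f"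

definition is_quotient ::
  "('a::field \<Rightarrow> 'v::ab_group_add \<Rightarrow> 'v) \<Rightarrow> 'a poly \<Rightarrow> 'a poly \<Rightarrow> ('v \<Rightarrow> 'v) \<Rightarrow> bool" where
  "is_quotient scale p q u \<longleftrightarrow>
     (\<exists>a b. is_automorphism scale a \<and> is_automorphism scale b \<and>
            poly_endo scale p a = (\<lambda>_. 0) \<and> poly_endo scale q b = (\<lambda>_. 0) \<and>
            u = a \<circ> inv_into UNIV b)"

text \<open>The library's \<open>multiplicity\<close> requires a stronger type class than \<open>field\<close> for the
  coefficients.\<close>

definition poly_valuation :: "'a::field poly \<Rightarrow> 'a poly \<Rightarrow> nat" where
  "poly_valuation r f = (GREATEST n. r ^ n dvd f)"

definition companion_mat :: "'a::field poly \<Rightarrow> 'a mat" where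
  "companion_mat r = mat (degree r) (degree r)
     (\<lambda>(i, j). if j = degree r - 1 then - poly.coeff r i else if i = Suc j then 1 else 0)"

text \<open>The sequence of invariant factors is indexed from \<open>1\<close>; the value at \<open>0\<close> is irrelevant.
  The blocks beyond \<open>N\<close> are \<open>0 \<times> 0\<close>, so the choice of \<open>N\<close> does not matter.\<close>

definition invariant_factors ::
  "('a::field \<Rightarrow> 'v::ab_group_add \<Rightarrow> 'v) \<Rightarrow> ('v \<Rightarrow> 'v) \<Rightarrow> (nat \<Rightarrow> 'a poly) \<Rightarrow> bool" where
  "invariant_factors scale u f \<longleftrightarrow>
     (\<forall>i\<ge>1. monic (f i)) \<and> (\<forall>i\<ge>1. f (Suc i) dvd f i) \<and>
     (\<exists>N. (\<forall>i>N. f i = 1) \<and>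
          (\<exists>bs. represented_in scale u bs
                  (diag_block_mat (map (\<lambda>i. companion_mat (f i)) [1..<Suc N]))))"


section \<open>Roots in the algebraic closure and q-regularity\<close>

definition Root :: "'a::field poly \<Rightarrow> 'a alg_closure set" where
  "Root p = {x. poly (map_poly to_ac p) x = 0}"

definition Root_quotients :: "'a::field poly \<Rightarrow> 'a poly \<Rightarrow> 'a alg_closure set" where
  "Root_quotients p q = {x * inverse y | x y. x \<in> Root p \<and> y \<in> Root q}"

text \<open>Eigenvalues in the algebraic closure are those of the scalar extension of \<open>u\<close>, that is, of
  a matrix of \<open>u\<close> (in any basis) viewed as a matrix over the algebraic closure.\<close>

definition eigenvalue_ac ::
  "('a::field \<Rightarrow> 'v::ab_group_add \<Rightarrow> 'v) \<Rightarrow> ('v \<Rightarrow> 'v) \<Rightarrow> 'a alg_closure \<Rightarrow> bool" where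
  "eigenvalue_ac scale u z \<longleftrightarrow>
     (\<exists>bs M. represented_in scale u bs M \<and> eigenvalue (map_mat to_ac M) z)"

definition q_regular ::
  "('a::field \<Rightarrow> 'v::ab_group_add \<Rightarrow> 'v) \<Rightarrow> 'a poly \<Rightarrow> 'a poly \<Rightarrow> ('v \<Rightarrow> 'v) \<Rightarrow> bool" where
  "q_regular scale p q u \<longleftrightarrow> (\<forall>z. eigenvalue_ac scale u z \<longrightarrow> z \<notin> Root_quotients p q)"


section \<open>The transformation \<open>R\<^sub>\<delta>\<close>\<close>

text \<open>With \<open>d = degree r\<close>, the term \<open>c t\<^sup>i\<close> of \<open>r\<close> contributes
  \<open>t\<^sup>d c (t + \<delta>/t)\<^sup>i = c t\<^sup>d\<^sup>-\<^sup>i (t\<^sup>2 + \<delta>)\<^sup>i\<close> to \<open>t\<^sup>d r(t + \<delta>/t)\<close>.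
  The lemma below is the defining identity in the field of fractions.\<close>

definition R_poly :: "'a::field \<Rightarrow> 'a poly \<Rightarrow> 'a poly" where
  "R_poly \<delta> r =
     (\<Sum>i\<le>degree r. smult (poly.coeff r i) ([:0, 1:] ^ (degree r - i) * [:\<delta>, 0, 1:] ^ i))"

lemma to_fract_R_poly:
  fixes r :: "'a::field poly" and \<delta> :: 'a
  defines "t \<equiv> to_fract [:0, 1:]"
  shows "to_fract (R_poly \<delta> r) =
    t ^ degree r * poly (map_poly (\<lambda>c. to_fract [:c:]) r) (t + to_fract [:\<delta>:] * inverse t)"
proof -
  have t: "t \<noteq> 0" by (simp add: t_def)
  have c: "to_fract (smult c g) = to_fract [:c:] * to_fract g" for c :: 'a and g
    by (metis smult_1_left smult_smult mult_smult_left mult_1 smult_one to_fract_mult)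
  have pw: "to_fract (g ^ n) = to_fract g ^ n" for g :: "'a poly" and n
    by (induction n) auto
  have sm: "to_fract (\<Sum>i\<in>A. h i) = (\<Sum>i\<in>A. to_fract (h i))" for h :: "nat \<Rightarrow> 'a poly" and A
    by (induction A rule: infinite_finite_induct) auto
  have q: "to_fract [:\<delta>, 0, 1:] = t * (t + to_fract [:\<delta>:] * inverse t)"
  proof -
    have "[:\<delta>, 0, 1:] = [:0, 1:] * [:0, 1:] + [:\<delta>:]" by simp
    then have "to_fract [:\<delta>, 0, 1:] = t * t + to_fract [:\<delta>:]"
      unfolding t_def by (metis to_fract_add to_fract_mult)
    then show ?thesis using t by (simp add: field_simps)
  qed
  have deg: "degree (map_poly (\<lambda>c. to_fract [:c:]) r) = degree r"
    by (rule degree_map_poly) auto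
  have e: "t ^ (degree r - i) * (t * z) ^ i = t ^ degree r * z ^ i" if "i \<le> degree r" for i z
    using that by (simp add: power_mult_distrib flip: mult.assoc power_add)
  then show ?thesis
    unfolding R_poly_def sm c to_fract_mult pw q poly_altdef deg sum_distrib_left
      t_def[symmetric]
    by (intro sum.cong refl) (simp only: e atMost_iff coeff_map_poly to_fract_0 pCons_0_0 mult.left_commute)
qed


section \<open>The norm form\<close>

text \<open>In this section, the field of scalars is a ring structure \<open>L\<close>, and \<open>l\<close>, \<open>al\<close>, \<open>m\<close>, \<open>be\<close>
  stand for \<open>\<lambda>\<close>, \<open>\<alpha>\<close>, \<open>\<mu>\<close>, \<open>\<beta>\<close> in \<open>p = t\<^sup>2 - \<lambda>t + \<alpha>\<close> and \<open>q = t\<^sup>2 - \<mu>t + \<beta>\<close>.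
  The matrix operations of \<open>Jordan_Normal_Form\<close> refer to type classes, hence those over \<open>L\<close>
  are spelled out.\<close>

context
  fixes L :: "'b ring" (structure)
begin

definition W_A :: "'b \<Rightarrow> 'b \<Rightarrow> 'b mat" where
  "W_A l al = mat_of_rows_list 4
     [[\<zero>, \<ominus> al, \<zero>, \<zero>],
      [\<one>, l, \<zero>, \<zero>],
      [\<zero>, \<zero>, \<zero>, \<ominus> al],
      [\<zero>, \<zero>, \<one>, l]]"

definition W_B :: "'b \<Rightarrow> 'b \<Rightarrow> 'b \<Rightarrow> 'b \<Rightarrow> 'b mat" where
  "W_B l m be x = mat_of_rows_list 4
     [[\<zero>, \<ominus> x, \<ominus> be, \<ominus> (l \<otimes> be)],
      [\<zero>, m, \<zero>, be],
      [\<one>, l, m, (l \<otimes> m) \<ominus> x],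
      [\<zero>, \<ominus> \<one>, \<zero>, \<zero>]]"

definition mult4 :: "'b mat \<Rightarrow> 'b mat \<Rightarrow> 'b mat" where
  "mult4 M N = mat 4 4 (\<lambda>(i, j). \<Oplus>k\<in>{..<4}. M $$ (i, k) \<otimes> N $$ (k, j))"

definition one4 :: "'b mat" where
  "one4 = mat 4 4 (\<lambda>(i, j). if i = j then \<one> else \<zero>)"

definition zero4 :: "'b mat" where
  "zero4 = mat 4 4 (\<lambda>_. \<zero>)"

definition W_elem ::
  "'b \<Rightarrow> 'b \<Rightarrow> 'b \<Rightarrow> 'b \<Rightarrow> 'b \<Rightarrow> 'b \<Rightarrow> 'b \<Rightarrow> 'b \<Rightarrow> 'b \<Rightarrow> 'b mat" where
  "W_elem l al m be x a b c d =
     (let A = W_A l al; B = W_B l m be x in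
      mat 4 4 (\<lambda>ij. a \<otimes> one4 $$ ij \<oplus> b \<otimes> A $$ ij \<oplus> c \<otimes> B $$ ij \<oplus> d \<otimes> mult4 A B $$ ij))"

definition W_alg :: "'b \<Rightarrow> 'b \<Rightarrow> 'b \<Rightarrow> 'b \<Rightarrow> 'b \<Rightarrow> 'b mat set" where
  "W_alg l al m be x =
     {W_elem l al m be x a b c d | a b c d.
        a \<in> carrier L \<and> b \<in> carrier L \<and> c \<in> carrier L \<and> d \<in> carrier L}"

definition norm_coords ::
  "'b \<Rightarrow> 'b \<Rightarrow> 'b \<Rightarrow> 'b \<Rightarrow> 'b \<Rightarrow> 'b \<Rightarrow> 'b \<Rightarrow> 'b \<Rightarrow> 'b \<Rightarrow> 'b" where
  "norm_coords l al m be x a b c d =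
     a \<otimes> (a \<oplus> l \<otimes> b \<oplus> m \<otimes> c \<oplus> (l \<otimes> m \<ominus> x) \<otimes> d)
     \<oplus> b \<otimes> (al \<otimes> b \<oplus> x \<otimes> c \<oplus> al \<otimes> m \<otimes> d)
     \<oplus> be \<otimes> (c \<otimes> c)
     \<oplus> (l \<otimes> be \<otimes> c \<oplus> al \<otimes> be \<otimes> d) \<otimes> d"

definition W_norm :: "'b \<Rightarrow> 'b \<Rightarrow> 'b \<Rightarrow> 'b \<Rightarrow> 'b \<Rightarrow> 'b mat \<Rightarrow> 'b" where
  "W_norm l al m be x M =
     (THE n. \<exists>a\<in>carrier L. \<exists>b\<in>carrier L. \<exists>c\<in>carrier L. \<exists>d\<in>carrier L.
        M = W_elem l al m be x a b c d \<and> n = norm_coords l al m be x a b c d)"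

definition W_isotropic :: "'b \<Rightarrow> 'b \<Rightarrow> 'b \<Rightarrow> 'b \<Rightarrow> 'b \<Rightarrow> bool" where
  "W_isotropic l al m be x \<longleftrightarrow>
     (\<exists>M \<in> W_alg l al m be x. M \<noteq> zero4 \<and> W_norm l al m be x M = \<zero>)"

end

text \<open>The first column of \<open>a I + b A + c B + d A B\<close> is \<open>(a, b, c, d)\<close>: the coordinates of an
  element of the algebra are unique, so that the norm is well defined.\<close>

lemma W_elem_first_column:
  fixes L :: "'b ring" (structure)
  assumes "cring L" "l \<in> carrier L" "al \<in> carrier L" "m \<in> carrier L" "be \<in> carrier L"
    "x \<in> carrier L" "a \<in> carrier L" "b \<in> carrier L" "c \<in> carrier L" "d \<in> carrier L"
  shows "W_elem L l al m be x a b c d $$ (0, 0) = a"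
    and "W_elem L l al m be x a b c d $$ (1, 0) = b"
    and "W_elem L l al m be x a b c d $$ (2, 0) = c"
    and "W_elem L l al m be x a b c d $$ (3, 0) = d"
proof -
  interpret cring L by fact
  have s: "{..<4} = {0, 1, 2, 3::nat}" by auto
  note defs = W_elem_def Let_def mult4_def one4_def W_A_def W_B_def mat_of_rows_list_def s
    numeral_2_eq_2 numeral_3_eq_3
  show "W_elem L l al m be x a b c d $$ (0, 0) = a"
    and "W_elem L l al m be x a b c d $$ (1, 0) = b"
    and "W_elem L l al m be x a b c d $$ (2, 0) = c"
    and "W_elem L l al m be x a b c d $$ (3, 0) = d"
    using assms by (simp_all add: defs)
qed

lemma W_norm_W_elem:
  fixes L :: "'b ring" (structure)
  assumes "cring L" "l \<in> carrier L" "al \<in> carrier L" "m \<in> carrier L" "be \<in> carrier L"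
    "x \<in> carrier L" "a \<in> carrier L" "b \<in> carrier L" "c \<in> carrier L" "d \<in> carrier L"
  shows "W_norm L l al m be x (W_elem L l al m be x a b c d) = norm_coords L l al m be x a b c d"
  unfolding W_norm_def
proof (rule the_equality)
  show "\<exists>a'\<in>carrier L. \<exists>b'\<in>carrier L. \<exists>c'\<in>carrier L. \<exists>d'\<in>carrier L.
      W_elem L l al m be x a b c d = W_elem L l al m be x a' b' c' d' \<and>
      norm_coords L l al m be x a b c d = norm_coords L l al m be x a' b' c' d'"
    using assms by blast
next
  fix n
  assume "\<exists>a'\<in>carrier L. \<exists>b'\<in>carrier L. \<exists>c'\<in>carrier L. \<exists>d'\<in>carrier L.
      W_elem L l al m be x a b c d = W_elem L l al m be x a' b' c' d' \<and>
      n = norm_coords L l al m be x a' b' c' d'"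
  then show "n = norm_coords L l al m be x a b c d"
    using W_elem_first_column[OF assms] W_elem_first_column[OF assms(1-6)] by metis
qed


section \<open>Types of irreducible polynomials\<close>

definition residue_ring_poly :: "'a::field poly \<Rightarrow> 'a poly set ring" where
  "residue_ring_poly r = ring_of_type_algebra Quot (PIdl\<^bsub>ring_of_type_algebra\<^esub> r)"

definition poly_class :: "'a::field poly \<Rightarrow> 'a poly \<Rightarrow> 'a poly set" where
  "poly_class r f = PIdl\<^bsub>ring_of_type_algebra\<^esub> r +>\<^bsub>ring_of_type_algebra\<^esub> f"

text \<open>The norm of \<open>\<W>(p, q, q(0) x)\<close> over \<open>\<bbbF>[t]/(r)\<close>, where \<open>x\<close> is the class of \<open>t\<close>.\<close>

definition norm_isotropic :: "'a::field poly \<Rightarrow> 'a poly \<Rightarrow> 'a poly \<Rightarrow> bool" where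
  "norm_isotropic p q r \<longleftrightarrow>
     W_isotropic (residue_ring_poly r)
       (poly_class r [:- poly.coeff p 1:]) (poly_class r [:poly.coeff p 0:])
       (poly_class r [:- poly.coeff q 1:]) (poly_class r [:poly.coeff q 0:])
       (poly_class r [:poly q 0:] \<otimes>\<^bsub>residue_ring_poly r\<^esub> poly_class r [:0, 1:])"

definition has_type1 :: "'a::field poly \<Rightarrow> 'a poly \<Rightarrow> 'a poly \<Rightarrow> bool" where
  "has_type1 p q r \<longleftrightarrow>
     irreducible r \<and> monic r \<and>
     Root (R_poly (poly p 0 * inverse (poly q 0)) r) \<inter> Root_quotients p q = {} \<and>
     norm_isotropic p q r"

definition has_type2 :: "'a::field poly \<Rightarrow> 'a poly \<Rightarrow> 'a poly \<Rightarrow> bool" where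
  "has_type2 p q r \<longleftrightarrow>
     irreducible r \<and> monic r \<and>
     Root (R_poly (poly p 0 * inverse (poly q 0)) r) \<inter> Root_quotients p q = {} \<and>
     \<not> norm_isotropic p q r"

end

theory Submission
  imports Defs
begin

text \<open>
Put \<open>v = u + \<delta>u\<^sup>-\<^sup>1\<close>. If \<open>u = ab\<^sup>-\<^sup>1\<close> with \<open>p(a) = q(b) = 0\<close>, then \<open>v\<close> commutes with \<open>a\<close> and \<open>b\<close>, so that the
space becomes a module over the quaternion algebra \<open>\<W>(p, q, \<beta>t)\<close> over \<open>F[t]\<close>, with \<open>t\<close> acting as \<open>v\<close>;
conversely such a module structure extending the action of \<open>u\<close> exhibits \<open>u\<close> as a quotient. A block
\<open>C(R\<^sub>\<delta>(f))\<close> of \<open>u\<close> is a free \<open>F[t]/(f)\<close>-module on two generators \<open>x, ux\<close>, and \<open>b\<close> acts on it when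
\<open>b x = x\<^sub>0x + z\<^sub>0ux\<close> for a point \<open>(x\<^sub>0, z\<^sub>0)\<close> modulo \<open>f\<close> of an affine conic. Regularity means that the discriminant
of this conic is invertible. Hence, by Hensel lifting, a point modulo \<open>r\<^sup>n\<close> exists as soon as one modulo \<open>r\<close>
does, which happens exactly when the norm over \<open>F[t]/(r)\<close> is isotropic. Two equal blocks together
always form a free module of rank one over the quaternion algebra.

For the converse, let \<open>r\<^sup>N\<close> be the exact power of an irreducible \<open>r\<close> in the minimal polynomial of \<open>v\<close>. If the
conic has a point, the element \<open>B - x\<^sub>0 - z\<^sub>0u\<close> of norm zero produces a submodule that is a single block
\<open>C(R\<^sub>\<delta>(r\<^sup>N))\<close>. Otherwise the algebra over the residue field is a division algebra, and any vector of
maximal order generates a double block. In both cases a dual construction yields a complementary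
submodule, and one concludes by induction on the dimension.
\<close>

section \<open>Polynomials over a field\<close>

text \<open>The map \<open>v\<close> has its origin in \<open>be u = a (m - b)\<close> and
  \<open>be \<delta> u^-1 = b (l - a)\<close>: hence \<open>be v = m a + l b - (a b + b a)\<close>,
  and the quadratic relations make this commute with \<open>a\<close> and \<open>b\<close>. Three
  obstacles shape the proof. The characteristic is arbitrary, so no square is ever completed: the
  conic stays inhomogeneous, and its smoothness is read off an identity without denominators between
  discriminant and gradient. A complement has to be stable under \<open>b\<close> as well as
  \<open>u\<close>: it is cut out by requiring one functional to vanish on the images of a vector
  under the whole algebra, or under a right ideal of it, which forces stability. What remains is
  nondegeneracy modulo \<open>r\<close>, supplied by the discriminant in the conic case and by the
  norm in the anisotropic case. Finally, uniqueness of invariant factors or elementary divisors is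
  avoided: every condition is compared with the existence of a suitable list of cyclic generators,
  and directness of sums is replaced by generation plus a count of dimensions.\<close>

lemma poly_bezout:
  fixes f g :: "'a::field poly"
  shows "\<exists>d s t. d dvd f \<and> d dvd g \<and> s * f + t * g = d"
\<comment> \<open>The measure separates \<open>g = 0\<close> from the nonzero constants, all of
  degree 0, since a division by a constant still has to be performed.\<close>
proof (induction "if g = 0 then 0 else Suc (degree g)" arbitrary: f g rule: less_induct)
  case less
  show ?case
  proof (cases "g = 0")
    case True
    then have "f dvd f \<and> f dvd g \<and> 1 * f + 0 * g = f" by simp
    then show ?thesis by blast
  next
    case False
    have "(if f mod g = 0 then 0 else Suc (degree (f mod g))) < (if g = 0 then 0 else Suc (degree g))"
      using False degree_mod_less[of g f] by auto
    from less[OF this, of g] obtain d s t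
      where d: "d dvd g" "d dvd f mod g" "s * g + t * (f mod g) = d" by blast
    have "d dvd f" using d(1,2) by (simp add: dvd_mod_iff)
    moreover have "t * f + (s - t * (f div g)) * g = d"
    proof -
      have "t * h + (s - t * k) * g = s * g + t * m" if "h = k * g + m" for h k m
        by (simp add: that algebra_simps)
      then show ?thesis using d(3) by (metis div_mult_mod_eq)
    qed
    ultimately show ?thesis using d(1) by blast
  qed
qed

text \<open>Coprimality in Bezout form: such an identity can be evaluated at an endomorphism, which
  is how it acts on modules below.\<close>

definition comaximal :: "'a::comm_ring_1 \<Rightarrow> 'a \<Rightarrow> bool" where
  "comaximal f g \<longleftrightarrow> (\<exists>s t. s * f + t * g = 1)"

lemma comaximal_sym: "comaximal f g \<Longrightarrow> comaximal g f"
  unfolding comaximal_def by (metis add.commute)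

lemma comaximal_1 [simp]: "comaximal 1 g" "comaximal g 1"
  unfolding comaximal_def by (rule exI[of _ 1], rule exI[of _ 0], simp)
    (rule exI[of _ 0], rule exI[of _ 1], simp)

lemma comaximal_mult:
  assumes "comaximal f h" "comaximal g h"
  shows "comaximal (f * g) h"
proof -
  from assms obtain s t s' t' where "s * f + t * h = 1" "s' * g + t' * h = 1"
    unfolding comaximal_def by blast
  then have "(s * f + t * h) * (s' * g + t' * h) = 1" by simp
  then have "(s * s') * (f * g) + (s * f * t' + t * s' * g + t * h * t') * h = 1"
    by (simp add: algebra_simps)
  then show ?thesis unfolding comaximal_def by blast
qed

lemma comaximal_power_left: "comaximal f h \<Longrightarrow> comaximal (f ^ n) h"
  by (induction n) (auto intro: comaximal_mult)

lemma comaximal_power: "comaximal f h \<Longrightarrow> comaximal (f ^ n) (h ^ m)"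
  by (metis comaximal_power_left comaximal_sym)

lemma comaximal_prod: "(\<And>i. i \<in> A \<Longrightarrow> comaximal (f i) h) \<Longrightarrow> comaximal (\<Prod>i\<in>A. f i) h"
  by (induction A rule: infinite_finite_induct) (auto intro: comaximal_mult)

lemma comaximal_dvd_mult:
  assumes "comaximal f g" "f dvd g * h"
  shows "f dvd h"
proof -
  obtain s t where "s * f + t * g = 1" using assms(1) unfolding comaximal_def by blast
  then have "h = (s * f + t * g) * h" by simp
  also have "\<dots> = s * h * f + t * (g * h)" by (simp add: algebra_simps)
  finally have "h = s * h * f + t * (g * h)" .
  then show ?thesis using assms(2) by (metis dvd_add dvd_mult dvd_triv_right)
qed

lemma irreducible_comaximal:
  fixes r f :: "'a::field poly"
  assumes "irreducible r" "\<not> r dvd f"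
  shows "comaximal r f"
proof -
  obtain d s t where d: "d dvd r" "d dvd f" "s * r + t * f = d" using poly_bezout by blast
  have "\<not> r dvd d" using d(2) assms(2) dvd_trans by blast
  then have "d dvd 1" using d(1) assms(1) by (meson irreducibleD')
  then obtain e where e: "1 = d * e" by (elim dvdE)
  have "(e * s) * r + (e * t) * f = e * (s * r + t * f)" by (simp add: algebra_simps)
  then have "(e * s) * r + (e * t) * f = 1" using d(3) e by (simp add: mult.commute)
  then show ?thesis unfolding comaximal_def by blast
qed

lemma irreducible_prime_elem_poly:
  fixes r :: "'a::field poly"
  assumes "irreducible r"
  shows "prime_elem r"
  using assms irreducible_comaximal[OF assms] comaximal_dvd_mult
  by (intro prime_elemI) (auto simp: irreducible_def)

lemma monic_irreducible_dvd_eq: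
  fixes r s :: "'a::field poly"
  assumes "irreducible r" "irreducible s" "monic r" "monic s" "r dvd s"
  shows "r = s"
proof -
  have "s dvd r" using assms by (meson irreducibleD' irreducible_not_unit)
  then show ?thesis using assms poly_dvd_antisym by metis
qed

lemma exists_monic_irreducible_dvd:
  fixes f :: "'a::field poly"
  assumes "degree f > 0"
  shows "\<exists>r. irreducible r \<and> monic r \<and> r dvd f"
  using assms
proof (induction "degree f" arbitrary: f rule: less_induct)
  case less
  have f0: "f \<noteq> 0" using less.prems by auto
  show ?case
  proof (cases "irreducible f")
    case True
    let ?r = "smult (inverse (lead_coeff f)) f"
    have "irreducible ?r"
      using irreducible_mult_unit_left[of "[:inverse (lead_coeff f):]" f] True f0
      by (simp add: is_unit_pCons_iff)
    moreover have "monic ?r" using f0 by simp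
    moreover have "?r dvd f" using f0 by (simp add: smult_dvd_iff)
    ultimately show ?thesis by blast
  next
    case False
    have "\<not> f dvd 1" using less.prems poly_dvd_1[of f] by auto
    then obtain g h where gh: "f = g * h" "\<not> g dvd 1" "\<not> h dvd 1"
      using False f0 unfolding irreducible_def by blast
    have nz: "g \<noteq> 0" "h \<noteq> 0" using gh(1) f0 by auto
    have "degree g > 0" "degree h > 0" using gh nz by (simp_all add: is_unit_iff_degree)
    then have "degree g < degree f" "0 < degree g" using gh(1) nz by (simp_all add: degree_mult_eq)
    from less.hyps[OF this] show ?thesis using gh(1) by (meson dvd_mult2)
  qed
qed

lemma irreducible_decomp:
  fixes f :: "'a::field poly"
  assumes "f \<noteq> 0" "irreducible r"
  shows "\<exists>n g. f = r ^ n * g \<and> \<not> r dvd g"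
  using assms
proof (induction "degree f" arbitrary: f rule: less_induct)
  case less
  show ?case
  proof (cases "r dvd f")
    case True
    then obtain h where h: "f = r * h" by (elim dvdE)
    have "r \<noteq> 0" "h \<noteq> 0" using h less.prems by auto
    moreover have "degree r > 0"
      using less.prems(2) \<open>r \<noteq> 0\<close> is_unit_iff_degree[of r] irreducible_not_unit by blast
    ultimately have "degree h < degree f" using h by (simp add: degree_mult_eq)
    from less.hyps[OF this \<open>h \<noteq> 0\<close> less.prems(2)] obtain n g where "h = r ^ n * g" "\<not> r dvd g"
      by blast
    then have "f = r ^ Suc n * g" using h by (simp add: mult.assoc)
    then show ?thesis using \<open>\<not> r dvd g\<close> by blast
  next
    case False
    then show ?thesis by (intro exI[of _ 0] exI[of _ f]) simp
  qed
qed

lemma poly_valuation_eq: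
  fixes r g :: "'a::field poly"
  assumes "irreducible r" "\<not> r dvd g"
  shows "poly_valuation r (r ^ n * g) = n"
  unfolding poly_valuation_def
proof (rule Greatest_equality)
  fix m assume m: "r ^ m dvd r ^ n * g"
  show "m \<le> n"
  proof (rule ccontr)
    assume "\<not> m \<le> n"
    then obtain k where k: "m = n + Suc k" by (metis less_imp_Suc_add not_le add_Suc_right)
    have "r ^ n * (r * r ^ k) dvd r ^ n * g" using m k by (simp add: power_add)
    moreover have "r ^ n \<noteq> 0" using assms(1) by auto
    ultimately have "r * r ^ k dvd g" by (subst (asm) dvd_mult_cancel_left) auto
    then show False using assms(2) dvd_mult_left by blast
  qed
qed simp

lemma monic_irreducible_prod_not_dvd:
  fixes A :: "'a::field poly set"
  assumes "\<forall>s\<in>A. irreducible s \<and> monic s" "irreducible r" "monic r" "r \<notin> A"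
  shows "\<not> r dvd (\<Prod>s\<in>A. s ^ e s)"
proof
  assume d: "r dvd (\<Prod>s\<in>A. s ^ e s)"
  have "comaximal (s ^ e s) r" if "s \<in> A" for s
    using that assms monic_irreducible_dvd_eq irreducible_comaximal comaximal_power_left
    by (metis comaximal_sym)
  then have "comaximal r (\<Prod>s\<in>A. s ^ e s)" using comaximal_prod comaximal_sym by metis
  then have "r dvd 1" using comaximal_dvd_mult[of r _ 1] d by simp
  then show False using assms(2) irreducible_not_unit by blast
qed

lemma poly_valuation_prod:
  fixes A :: "'a::field poly set"
  assumes A: "finite A" "\<forall>s\<in>A. irreducible s \<and> monic s" and r: "irreducible r" "monic r"
  shows "poly_valuation r (\<Prod>s\<in>A. s ^ e s) = (if r \<in> A then e r else 0)"
proof (cases "r \<in> A")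
  case True
  then have "(\<Prod>s\<in>A. s ^ e s) = r ^ e r * (\<Prod>s\<in>A - {r}. s ^ e s)"
    using A(1) by (simp add: prod.remove)
  moreover have "\<not> r dvd (\<Prod>s\<in>A - {r}. s ^ e s)"
    using monic_irreducible_prod_not_dvd[of "A - {r}" r e] A r by auto
  ultimately show ?thesis using True poly_valuation_eq[OF r(1)] by metis
next
  case False
  then have "\<not> r dvd (\<Prod>s\<in>A. s ^ e s)"
    using monic_irreducible_prod_not_dvd A r by blast
  from poly_valuation_eq[OF r(1) this, of 0] show ?thesis using False by simp
qed

lemma monic_factorization:
  fixes f :: "'a::field poly"
  assumes "monic f"
  shows "\<exists>A e. finite A \<and> (\<forall>s\<in>A. irreducible s \<and> monic s) \<and> f = (\<Prod>s\<in>A. s ^ e s)"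
  using assms
proof (induction "degree f" arbitrary: f rule: less_induct)
  case less
  show ?case
  proof (cases "degree f = 0")
    case True
    then have "f = (\<Prod>s\<in>{}. s ^ 0)" using less.prems by (metis monic_degree_0 prod.empty)
    then show ?thesis by (intro exI[of _ "{}"] exI[of _ "\<lambda>_. 0"]) simp
  next
    case False
    then obtain r where r: "irreducible r" "monic r" "r dvd f"
      using exists_monic_irreducible_dvd[of f] by auto
    obtain h where h: "f = r * h" using r(3) by (elim dvdE)
    have nz: "r \<noteq> 0" "h \<noteq> 0" using h less.prems by auto
    have "degree r > 0" using r(1) nz is_unit_iff_degree[of r] irreducible_not_unit by blast
    then have dh: "degree h < degree f" using h nz by (simp add: degree_mult_eq)
    have mh: "monic h" using less.prems r(2) h by (simp add: lead_coeff_mult)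
    from less.hyps[OF dh mh] obtain A e where
      A: "finite A" "\<forall>s\<in>A. irreducible s \<and> monic s" "h = (\<Prod>s\<in>A. s ^ e s)" by blast
    \<comment> \<open>Outside \<open>A\<close> the values of \<open>e\<close> are arbitrary, so a
      new factor starts with exponent 1 and not with \<open>Suc (e r)\<close>.\<close>
    define e' where "e' = (\<lambda>s. if s = r then (if r \<in> A then Suc (e r) else 1) else e s)"
    have "f = (\<Prod>s\<in>insert r A. s ^ e' s)"
    proof -
      have "(\<Prod>s\<in>insert r A. s ^ e' s) = r ^ e' r * (\<Prod>s\<in>A - {r}. s ^ e' s)"
        using A(1) by (simp add: prod.insert_remove)
      also have "(\<Prod>s\<in>A - {r}. s ^ e' s) = (\<Prod>s\<in>A - {r}. s ^ e s)"
        by (rule prod.cong) (auto simp: e'_def)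
      also have "r ^ e' r * \<dots> = r * (\<Prod>s\<in>A. s ^ e s)"
        using A(1) by (cases "r \<in> A") (auto simp: e'_def prod.remove mult.assoc)
      finally show ?thesis using h A(3) by simp
    qed
    then show ?thesis using A r by (intro exI[of _ "insert r A"] exI[of _ e']) auto
  qed
qed

text \<open>The set \<open>A\<close> may be larger than the set of irreducible factors of
  \<open>f\<close>; this allows several polynomials to be factored over one common set.\<close>

lemma monic_factorization_valuation:
  fixes f :: "'a::field poly"
  assumes "monic f" "finite A" "\<forall>s\<in>A. irreducible s \<and> monic s"
    and dv: "\<And>s. irreducible s \<Longrightarrow> monic s \<Longrightarrow> s dvd f \<Longrightarrow> s \<in> A"
  shows "f = (\<Prod>s\<in>A. s ^ poly_valuation s f)"
proof -
  obtain B e where B: "finite B" "\<forall>s\<in>B. irreducible s \<and> monic s" "f = (\<Prod>s\<in>B. s ^ e s)"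
    using monic_factorization[OF assms(1)] by blast
  have val: "poly_valuation s f = (if s \<in> B then e s else 0)" if "irreducible s" "monic s" for s
    using poly_valuation_prod[OF B(1,2) that] B(3) by simp
  have z: "e s = 0" if "s \<in> B" "s \<notin> A" for s
  proof (rule ccontr)
    assume "e s \<noteq> 0"
    then have "s dvd s ^ e s" by simp
    then have "s dvd f" using B(1,3) that(1) by (meson dvd_prod dvd_trans)
    then show False using dv that B(2) by blast
  qed
  have "f = (\<Prod>s\<in>A \<union> B. s ^ poly_valuation s f)"
    using B assms(2,3) val by (subst B(3), intro prod.mono_neutral_cong_left) auto
  also have "\<dots> = (\<Prod>s\<in>A. s ^ poly_valuation s f)"
    using B assms(2,3) val z by (intro prod.mono_neutral_right) auto
  finally show ?thesis .
qed

lemma monic_irreducible_comaximal: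
  fixes r s :: "'a::field poly"
  assumes "irreducible r" "irreducible s" "monic r" "monic s" "r \<noteq> s"
  shows "comaximal (r ^ m) (s ^ n)"
  using assms monic_irreducible_dvd_eq irreducible_comaximal comaximal_power by metis

section \<open>Polynomials acting through an endomorphism\<close>

context vector_space
begin

lemma poly_endo_cutoff:
  assumes "degree g \<le> n"
  shows "poly_endo scale g f x = (\<Sum>i\<le>n. scale (poly.coeff g i) ((f ^^ i) x))"
  unfolding poly_endo_def using assms
  by (intro sum.mono_neutral_left) (auto simp: coeff_eq_0 not_le)

lemma poly_endo_0 [simp]: "poly_endo scale 0 f x = 0"
  by (simp add: poly_endo_def)

lemma poly_endo_const [simp]: "poly_endo scale [:c:] f x = scale c x"
  by (simp add: poly_endo_def)

lemma poly_endo_1 [simp]: "poly_endo scale 1 f x = x"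
  by (simp add: poly_endo_def)

lemma poly_endo_add: "poly_endo scale (g + h) f x = poly_endo scale g f x + poly_endo scale h f x"
proof -
  let ?n = "max (degree g) (degree h)"
  have "degree (g + h) \<le> ?n" by (rule degree_add_le_max)
  then show ?thesis
    by (simp add: poly_endo_cutoff[of _ ?n] scale_left_distrib sum.distrib)
qed

lemma poly_endo_smult: "poly_endo scale (smult c g) f x = scale c (poly_endo scale g f x)"
  by (simp add: poly_endo_cutoff[of "smult c g" "degree g"] poly_endo_cutoff[of g "degree g"]
      scale_sum_right)

lemma poly_endo_pCons:
  assumes "Vector_Spaces.linear scale scale f"
  shows "poly_endo scale (pCons c g) f x = scale c x + f (poly_endo scale g f x)"
proof -
  interpret f: Vector_Spaces.linear scale scale f by fact
  have "degree (pCons c g) \<le> Suc (degree g)" by (simp add: degree_pCons_eq_if)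
  then have "poly_endo scale (pCons c g) f x =
      (\<Sum>i\<le>Suc (degree g). scale (poly.coeff (pCons c g) i) ((f ^^ i) x))"
    by (rule poly_endo_cutoff)
  also have "\<dots> = scale c x + (\<Sum>i\<le>degree g. scale (poly.coeff g i) (f ((f ^^ i) x)))"
    by (subst sum.atMost_Suc_shift) simp
  also have "(\<Sum>i\<le>degree g. scale (poly.coeff g i) (f ((f ^^ i) x))) = f (poly_endo scale g f x)"
    by (simp add: poly_endo_def f.sum f.scale)
  finally show ?thesis .
qed

lemma poly_endo_mult:
  assumes "Vector_Spaces.linear scale scale f"
  shows "poly_endo scale (g * h) f x = poly_endo scale g f (poly_endo scale h f x)"
  by (induction g) (simp_all add: poly_endo_pCons[OF assms] poly_endo_add poly_endo_smult)

lemma poly_endo_right_add: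
  assumes "Vector_Spaces.linear scale scale f"
  shows "poly_endo scale g f (x + y) = poly_endo scale g f x + poly_endo scale g f y"
proof -
  interpret f: Vector_Spaces.linear scale scale f by fact
  show ?thesis
    by (induction g) (simp_all add: poly_endo_pCons[OF assms] f.add scale_right_distrib)
qed

lemma poly_endo_right_scale:
  assumes "Vector_Spaces.linear scale scale f"
  shows "poly_endo scale g f (scale c x) = scale c (poly_endo scale g f x)"
proof -
  interpret f: Vector_Spaces.linear scale scale f by fact
  show ?thesis
    by (induction g) (simp_all add: poly_endo_pCons[OF assms] f.scale scale_right_distrib mult.commute)
qed

lemma poly_endo_commute:
  assumes f: "Vector_Spaces.linear scale scale f" and h: "Vector_Spaces.linear scale scale h"
    and c: "\<And>x. h (f x) = f (h x)"
  shows "h (poly_endo scale g f x) = poly_endo scale g f (h x)"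
proof -
  interpret h: Vector_Spaces.linear scale scale h by fact
  show ?thesis by (induction g) (simp_all add: poly_endo_pCons[OF f] h.add h.scale h.zero c)
qed

lemma poly_endo_subspace:
  assumes f: "Vector_Spaces.linear scale scale f" and "subspace S" "\<And>x. x \<in> S \<Longrightarrow> f x \<in> S" "x \<in> S"
  shows "poly_endo scale g f x \<in> S"
  by (induction g) (use assms in \<open>simp_all add: poly_endo_pCons[OF f] subspace_0 subspace_add subspace_scale\<close>)

lemma poly_endo_monom_X: "poly_endo scale [:0, 1:] f x = f x"
  by (simp add: poly_endo_def)

lemma poly_endo_X_power:
  assumes "Vector_Spaces.linear scale scale f"
  shows "poly_endo scale ([:0, 1:] ^ n) f x = (f ^^ n) x"
  by (induction n arbitrary: x) (simp_all add: poly_endo_pCons[OF assms])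

end

context finite_dimensional_vector_space
begin

text \<open>Equality of dimensions. A subspace stable under an injective \<open>u\<close> is thus
  stable under the inverse of \<open>u\<close> as well, hence under \<open>v\<close>.\<close>

lemma linear_inj_on_subspace_image:
  assumes "Vector_Spaces.linear scale scale f" "inj f" "subspace S" "f ` S \<subseteq> S"
  shows "f ` S = S"
proof -
  interpret pr: finite_dimensional_vector_space_pair scale Basis scale Basis ..
  have "dim (f ` S) = dim S"
    by (rule pr.dim_image_eq) (use assms in \<open>auto intro: inj_on_subset\<close>)
  moreover have "subspace (f ` S)" using pr.linear_subspace_image assms(1,3) by blast
  ultimately show ?thesis using subspace_dim_equal[of "f ` S" S] assms(3,4) by simp
qed

text \<open>Among the vectors \<open>x, f x, \<dots>, f\<^sup>n x\<close> with \<open>n\<close> the dimension there is a linear relation.\<close>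

lemma poly_endo_annihilates_vector:
  assumes f: "Vector_Spaces.linear scale scale f"
  shows "\<exists>g. g \<noteq> 0 \<and> poly_endo scale g f x = 0"
proof (cases "inj_on (\<lambda>i. (f ^^ i) x) {..dimension}")
  case True
  let ?B = "(\<lambda>i. (f ^^ i) x) ` {..dimension}"
  have "card ?B = Suc dimension" using True by (simp add: card_image)
  then have "dim ?B < card ?B" using dim_subset_UNIV[of ?B] by simp
  then have "dependent ?B" by (intro dependent_biggerset_general) auto
  then obtain c where c: "(\<Sum>y\<in>?B. scale (c y) y) = 0" "\<exists>y\<in>?B. c y \<noteq> 0"
    by (auto simp: dependent_finite)
  define g where "g = (\<Sum>i\<le>dimension. monom (c ((f ^^ i) x)) i)"
  have co: "poly.coeff g i = (if i \<le> dimension then c ((f ^^ i) x) else 0)" for i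
    unfolding g_def by (simp add: coeff_sum)
  have "degree g \<le> dimension" by (rule degree_le) (simp add: co)
  then have "poly_endo scale g f x = (\<Sum>i\<le>dimension. scale (c ((f ^^ i) x)) ((f ^^ i) x))"
    by (simp add: poly_endo_cutoff[of _ dimension] co)
  also have "\<dots> = 0" using c(1) by (subst (asm) sum.reindex[OF True]) simp
  finally show ?thesis using c(2) co by (intro exI[of _ g]) (auto simp: poly_eq_iff)
next
  case False
  then obtain i j where ij: "i \<noteq> j" "(f ^^ i) x = (f ^^ j) x" by (auto simp: inj_on_def)
  let ?g = "[:0, 1:] ^ i + smult (- 1) ([:0, 1:] ^ j) :: 'a poly"
  have "poly_endo scale ?g f x = 0"
    using ij(2) by (simp only: poly_endo_add poly_endo_smult poly_endo_X_power[OF f]) simp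
  moreover have "?g \<noteq> 0"
  proof
    assume "?g = 0"
    then have "([:0, 1:] :: 'a poly) ^ i = [:0, 1:] ^ j" by simp
    then have "degree (([:0, 1:] :: 'a poly) ^ i) = degree (([:0, 1:] :: 'a poly) ^ j)" by simp
    then show False using ij(1) by (simp add: degree_power_eq)
  qed
  ultimately show ?thesis by blast
qed

lemma poly_endo_annihilates:
  assumes f: "Vector_Spaces.linear scale scale f"
  shows "\<exists>g. g \<noteq> 0 \<and> (\<forall>x. poly_endo scale g f x = 0)"
proof -
  obtain h where h: "\<And>x. h x \<noteq> 0" "\<And>x. poly_endo scale (h x) f x = 0"
    using poly_endo_annihilates_vector[OF f] by metis
  let ?g = "\<Prod>e\<in>Basis. h e"
  have "poly_endo scale ?g f x = 0" for x
  proof -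
    have "x \<in> span Basis" by (simp add: span_Basis)
    then show ?thesis
    proof (induction rule: span_induct_alt)
      case base
      then show ?case using poly_endo_right_scale[OF f, of ?g 0 0] by simp
    next
      case (step c e y)
      have "?g = (\<Prod>e'\<in>Basis - {e}. h e') * h e"
        using step(1) finite_Basis by (simp add: prod.remove mult.commute)
      then have "poly_endo scale ?g f e = poly_endo scale (\<Prod>e'\<in>Basis - {e}. h e') f 0"
        by (simp only: poly_endo_mult[OF f] h(2))
      also have "\<dots> = 0" using poly_endo_right_scale[OF f, of _ 0 0] by simp
      finally show ?case
        using step(2) by (simp add: poly_endo_right_add[OF f] poly_endo_right_scale[OF f])
    qed
  qed
  moreover have "?g \<noteq> 0" using h(1) finite_Basis by simp
  ultimately show ?thesis by blast
qed

end

section \<open>Cyclic decompositions\<close>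

text \<open>Allows cyclic generators to be listed in any prescribed order of their
  annihilators.\<close>

lemma mset_map_eq_mset:
  assumes "mset (map f l) = mset ys"
  shows "\<exists>l'. mset l' = mset l \<and> map f l' = ys"
  using assms
proof (induction ys arbitrary: l)
  case (Cons y ys)
  have "y \<in> set (map f l)" using mset_eq_setD[OF Cons.prems] by simp
  then obtain a where a: "a \<in> set l" "f a = y" by auto
  then obtain l1 l2 where l: "l = l1 @ a # l2" by (meson split_list)
  have "mset (map f (l1 @ l2)) = mset ys" using Cons.prems l a(2) by simp
  from Cons.IH[OF this] obtain l' where "mset l' = mset (l1 @ l2)" "map f l' = ys" by blast
  then show ?case using l a(2) by (intro exI[of _ "a # l'"]) simp
qed simp

text \<open>Here \<open>v = u + \<delta>u\<^sup>-\<^sup>1\<close>, so that \<open>u\<close> is a root of \<open>t\<^sup>2 - vt + \<delta>\<close>.\<close>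

locale quadratic_over = finite_dimensional_vector_space scale Basis
  for scale :: "'a::field \<Rightarrow> 'v::ab_group_add \<Rightarrow> 'v" and Basis :: "'v set" +
  fixes u v :: "'v \<Rightarrow> 'v" and \<delta> :: 'a
  assumes linear_u: "Vector_Spaces.linear scale scale u"
    and linear_v: "Vector_Spaces.linear scale scale v"
    and inj_u: "inj u"
    and delta_nz: "\<delta> \<noteq> 0"
    and u_v: "u (v x) = u (u x) + scale \<delta> x"
begin

sublocale u: Vector_Spaces.linear scale scale u by (rule linear_u)
sublocale v: Vector_Spaces.linear scale scale v by (rule linear_v)

definition act :: "'a poly \<Rightarrow> 'v \<Rightarrow> 'v"  (infixr "\<star>" 75) where
  "g \<star> x = poly_endo scale g v x"

sublocale act: Modules.module act
  by unfold_locales (simp_all add: act_def poly_endo_add poly_endo_mult[OF linear_v]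
      poly_endo_right_add[OF linear_v])

lemma v_u: "v (u x) = u (v x)"
proof -
  have "u (v (u x)) = u (u (v x))" by (simp add: u_v u.add u.scale)
  then show ?thesis using inj_u by (simp add: inj_eq)
qed

lemma act_const: "[:c:] \<star> x = scale c x"
  by (simp add: act_def)

lemma act_X: "[:0, 1:] \<star> x = v x"
  by (simp add: act_def poly_endo_monom_X)

lemma act_scale: "g \<star> scale c x = scale c (g \<star> x)"
  by (simp add: act_def poly_endo_right_scale[OF linear_v])

lemma act_smult: "smult c g \<star> x = scale c (g \<star> x)"
  by (simp add: act_def poly_endo_smult)

lemma act_commute:
  assumes "Vector_Spaces.linear scale scale h" "\<And>x. h (v x) = v (h x)"
  shows "h (g \<star> x) = g \<star> h x"
  unfolding act_def by (rule poly_endo_commute[OF linear_v assms])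

lemma u_act: "u (g \<star> x) = g \<star> u x"
  by (rule act_commute[OF linear_u]) (simp add: v_u)

lemma u_u: "u (u x) = [:0, 1:] \<star> u x - [:\<delta>:] \<star> x"
  by (simp add: act_X act_const v_u u_v)

lemma linear_act: "Vector_Spaces.linear scale scale ((\<star>) g)"
  by unfold_locales (simp_all add: act.scale_right_distrib act_scale)

definition u_stable :: "'v set \<Rightarrow> bool" where
  "u_stable S \<longleftrightarrow> subspace S \<and> u ` S \<subseteq> S"

lemma u_stable_act:
  assumes "u_stable S" "x \<in> S"
  shows "g \<star> x \<in> S"
proof -
  have S: "subspace S" "u ` S = S"
    using assms linear_inj_on_subspace_image[OF linear_u inj_u] by (auto simp: u_stable_def)
  have "v y \<in> S" if "y \<in> S" for y
  proof -
    have "u (v y) \<in> S" using that S by (auto simp: u_v intro!: subspace_add subspace_scale)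
    then obtain z where "z \<in> S" "u (v y) = u z" using S(2) by (metis imageE)
    then show ?thesis using inj_u by (simp add: inj_eq)
  qed
  then show ?thesis unfolding act_def using poly_endo_subspace[OF linear_v] S assms by blast
qed

lemma u_stable_UNIV [simp]: "u_stable UNIV"
  by (simp add: u_stable_def)

text \<open>The dimension condition expresses that the cyclic submodules generated by the \<open>x\<close> form a
  direct sum and that \<open>f\<close> is the exact annihilator of \<open>x\<close>; \<open>2 degree f\<close> is the degree of \<open>R\<^sub>\<delta> f\<close>.\<close>

definition cyclic_gens :: "('a poly \<times> 'v) list \<Rightarrow> 'v set \<Rightarrow> bool" where
  "cyclic_gens l T \<longleftrightarrow>
     (\<forall>(f, x) \<in> set l. monic f \<and> f \<star> x = 0 \<and> x \<in> T) \<and>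
     (\<Sum>(f, x)\<leftarrow>l. 2 * degree f) = dim T \<and>
     (\<forall>S. u_stable S \<longrightarrow> snd ` set l \<subseteq> S \<longrightarrow> T \<subseteq> S)"

definition cyclic_decomp :: "'a poly multiset \<Rightarrow> 'v set \<Rightarrow> bool" where
  "cyclic_decomp F T \<longleftrightarrow> (\<exists>l. mset (map fst l) = F \<and> cyclic_gens l T)"

lemma cyclic_gens_mset:
  assumes "mset l = mset l'"
  shows "cyclic_gens l T \<longleftrightarrow> cyclic_gens l' T"
proof -
  have "set l = set l'" using assms mset_eq_setD by blast
  moreover have "(\<Sum>(f, x)\<leftarrow>l. 2 * degree f) = (\<Sum>(f, x)\<leftarrow>l'. 2 * degree f)"
    using assms by (simp flip: sum_mset_sum_list)
  ultimately show ?thesis by (simp add: cyclic_gens_def)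
qed

lemma cyclic_gens_sorted:
  assumes "cyclic_decomp (mset fs) T"
  obtains xs where "length xs = length fs" "cyclic_gens (zip fs xs) T"
proof -
  obtain l where l: "mset (map fst l) = mset fs" "cyclic_gens l T"
    using assms unfolding cyclic_decomp_def by blast
  from mset_map_eq_mset[OF l(1)] obtain l' where l': "mset l' = mset l" "map fst l' = fs"
    by blast
  have "cyclic_gens l' T" using l(2) cyclic_gens_mset[OF l'(1)] by simp
  moreover have "l' = zip fs (map snd l')" using l'(2) zip_map_fst_snd by metis
  moreover have "length (map snd l') = length fs" using l'(2) by auto
  ultimately show ?thesis using that by metis
qed

text \<open>Chinese remainder theorem: Bezout recovers \<open>x\<close> from
  \<open>g \<star> x\<close> and \<open>f \<star> x\<close>. The degrees of \<open>f\<close> and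
  \<open>g\<close> add up, so the dimension condition is inherited.\<close>

lemma cyclic_decomp_split:
  assumes "comaximal f g" "monic f" "monic g"
    and "cyclic_decomp (add_mset (f * g) F) T" "u_stable T"
  shows "cyclic_decomp (add_mset f (add_mset g F)) T"
proof -
  obtain fs where fs: "F = mset fs" by (metis ex_mset)
  have "cyclic_decomp (mset (f * g # fs)) T" using assms fs by simp
  then obtain xs where xs: "length xs = length (f * g # fs)" "cyclic_gens (zip (f * g # fs) xs) T"
    by (rule cyclic_gens_sorted)
  then obtain x ys where x: "xs = x # ys" by (cases xs) auto
  obtain s t where st: "s * f + t * g = 1" using assms(1) unfolding comaximal_def by blast
  let ?l = "(f, g \<star> x) # (g, f \<star> x) # zip fs ys"
  have old: "cyclic_gens ((f * g, x) # zip fs ys) T" using xs x by simp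
  have "cyclic_gens ?l T"
    unfolding cyclic_gens_def
  proof (intro conjI allI impI)
    show "\<forall>(f, x)\<in>set ?l. monic f \<and> f \<star> x = 0 \<and> x \<in> T"
      using old assms(2,3) u_stable_act[OF assms(5)]
      by (auto simp: cyclic_gens_def mult.commute)
    have "f \<noteq> 0" "g \<noteq> 0" using assms by auto
    then show "(\<Sum>(f, x)\<leftarrow>?l. 2 * degree f) = dim T"
      using old by (auto simp: cyclic_gens_def degree_mult_eq)
  next
    fix S assume S: "u_stable S" "snd ` set ?l \<subseteq> S"
    have "x = (s * f + t * g) \<star> x" by (simp add: st)
    also have "\<dots> = s \<star> (f \<star> x) + t \<star> (g \<star> x)" by (simp add: act.scale_left_distrib)
    also have "\<dots> \<in> S"
    proof (rule subspace_add)
      show "subspace S" using S(1) by (simp add: u_stable_def)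
      have "f \<star> x \<in> S" "g \<star> x \<in> S" using S(2) by simp_all
      then show "s \<star> (f \<star> x) \<in> S" "t \<star> (g \<star> x) \<in> S" using u_stable_act[OF S(1)] by blast+
    qed
    finally show "T \<subseteq> S" using old S by (auto simp: cyclic_gens_def)
  qed
  then show ?thesis using xs x fs unfolding cyclic_decomp_def by (intro exI[of _ ?l]) simp
qed

text \<open>The Bezout idempotents \<open>t * g\<close> and \<open>s * f\<close> project
  \<open>x + y\<close> back to \<open>x\<close> and \<open>y\<close>.\<close>

lemma cyclic_decomp_merge:
  assumes "comaximal f g"
    and "cyclic_decomp (add_mset f (add_mset g F)) T" "u_stable T"
  shows "cyclic_decomp (add_mset (f * g) F) T"
proof -
  obtain fs where fs: "F = mset fs" by (metis ex_mset)
  have "cyclic_decomp (mset (f # g # fs)) T" using assms fs by simp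
  then obtain xs where xs: "length xs = length (f # g # fs)" "cyclic_gens (zip (f # g # fs) xs) T"
    by (rule cyclic_gens_sorted)
  then obtain x y ys where x: "xs = x # y # ys" by (cases xs; cases "tl xs") auto
  obtain s t where st: "s * f + t * g = 1" using assms(1) unfolding comaximal_def by blast
  let ?l = "(f * g, x + y) # zip fs ys"
  have old: "cyclic_gens ((f, x) # (g, y) # zip fs ys) T" using xs x by simp
  then have z: "f \<star> x = 0" "g \<star> y = 0" "monic f" "monic g" "x \<in> T" "y \<in> T"
    by (auto simp: cyclic_gens_def)
  have "cyclic_gens ?l T"
    unfolding cyclic_gens_def
  proof (intro conjI allI impI)
    have "(f * g) \<star> (x + y) = g \<star> (f \<star> x) + f \<star> (g \<star> y)"
      by (simp add: act.scale_right_distrib mult.commute)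
    then show "\<forall>(f, x)\<in>set ?l. monic f \<and> f \<star> x = 0 \<and> x \<in> T"
      using old z assms(3) by (auto simp: cyclic_gens_def lead_coeff_mult u_stable_def intro: subspace_add)
    have "f \<noteq> 0" "g \<noteq> 0" using z by auto
    then show "(\<Sum>(f, x)\<leftarrow>?l. 2 * degree f) = dim T"
      using old by (auto simp: cyclic_gens_def degree_mult_eq)
  next
    fix S assume S: "u_stable S" "snd ` set ?l \<subseteq> S"
    then have xy: "x + y \<in> S" by auto
    have sx: "(s * f) \<star> x = 0" and ty: "(t * g) \<star> y = 0"
      using z by (simp_all flip: act.scale_scale)
    have "(t * g) \<star> x + (s * f) \<star> x = x" "(t * g) \<star> y + (s * f) \<star> y = y"
      by (simp_all add: st add.commute flip: act.scale_left_distrib)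
    then have "(t * g) \<star> (x + y) = x" "(s * f) \<star> (x + y) = y"
      unfolding act.scale_right_distrib sx ty by simp_all
    then have "x \<in> S" "y \<in> S" using u_stable_act[OF S(1) xy] by metis+
    then show "T \<subseteq> S" using old S by (auto simp: cyclic_gens_def)
  qed
  then show ?thesis using xs x fs unfolding cyclic_decomp_def by (intro exI[of _ ?l]) simp
qed

lemma cyclic_decomp_one:
  assumes "u_stable T"
  shows "cyclic_decomp (add_mset 1 F) T \<longleftrightarrow> cyclic_decomp F T"
proof
  assume "cyclic_decomp (add_mset 1 F) T"
  moreover obtain fs where fs: "F = mset fs" by (metis ex_mset)
  ultimately have "cyclic_decomp (mset (1 # fs)) T" by simp
  then obtain xs where xs: "length xs = length (1 # fs)" "cyclic_gens (zip (1 # fs) xs) T"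
    by (rule cyclic_gens_sorted)
  then obtain x ys where x: "xs = x # ys" by (cases xs) auto
  have old: "cyclic_gens ((1, x) # zip fs ys) T" using xs x by simp
  then have "x = 0" by (auto simp: cyclic_gens_def)
  then have "cyclic_gens (zip fs ys) T"
    using old by (auto simp: cyclic_gens_def u_stable_def subspace_0)
  then show "cyclic_decomp F T" using xs x fs
    unfolding cyclic_decomp_def by (intro exI[of _ "zip fs ys"]) simp
next
  assume "cyclic_decomp F T"
  then obtain l where "mset (map fst l) = F" "cyclic_gens l T" unfolding cyclic_decomp_def by blast
  then have "mset (map fst ((1, 0) # l)) = add_mset 1 F" "cyclic_gens ((1, 0) # l) T"
    using assms by (auto simp: cyclic_gens_def u_stable_def subspace_0)
  then show "cyclic_decomp (add_mset 1 F) T" unfolding cyclic_decomp_def by blast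
qed

lemma cyclic_decomp_prod:
  assumes "finite A" "u_stable T" "\<And>a. a \<in> A \<Longrightarrow> monic (h a)"
    and "\<And>a b. a \<in> A \<Longrightarrow> b \<in> A \<Longrightarrow> a \<noteq> b \<Longrightarrow> comaximal (h a) (h b)"
  shows "cyclic_decomp (add_mset (\<Prod>a\<in>A. h a) F) T \<longleftrightarrow>
         cyclic_decomp (image_mset h (mset_set A) + F) T"
  using assms(1,3,4)
proof (induction A arbitrary: F rule: finite_induct)
  case empty
  then show ?case by (simp add: cyclic_decomp_one[OF assms(2)])
next
  case (insert a A)
  have c: "comaximal (h a) (\<Prod>a\<in>A. h a)"
    using insert.hyps insert.prems(2) by (intro comaximal_sym[OF comaximal_prod]) auto
  have m: "monic (\<Prod>a\<in>A. h a)" using insert.prems(1) by (intro monic_prod) auto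
  have "cyclic_decomp (add_mset (\<Prod>a\<in>insert a A. h a) F) T \<longleftrightarrow>
      cyclic_decomp (add_mset (h a * (\<Prod>a\<in>A. h a)) F) T"
    using insert.hyps by simp
  also have "\<dots> \<longleftrightarrow> cyclic_decomp (add_mset (h a) (add_mset (\<Prod>a\<in>A. h a) F)) T"
    using cyclic_decomp_split[OF c _ m] cyclic_decomp_merge[OF c] assms(2) insert.prems(1) by blast
  also have "\<dots> \<longleftrightarrow> cyclic_decomp (add_mset (\<Prod>a\<in>A. h a) (add_mset (h a) F)) T"
    by (simp add: add_mset_commute)
  also have "\<dots> \<longleftrightarrow> cyclic_decomp (image_mset h (mset_set A) + add_mset (h a) F) T"
    by (rule insert.IH) (use insert.prems in auto)
  also have "\<dots> \<longleftrightarrow> cyclic_decomp (image_mset h (mset_set (insert a A)) + F) T"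
    using insert.hyps by simp
  finally show ?case .
qed

end

section \<open>The transformation \<open>R\<^sub>\<delta>\<close>\<close>

text \<open>With \<open>d = degree r\<close>, the term of index \<open>i\<close> has degree at most
  \<open>(d - i) + 2 * i = d + i\<close>, so the leading term comes from
  \<open>(t^2 + \<delta>)^d\<close> alone.\<close>

lemma R_poly_monic:
  fixes r :: "'a::field poly"
  assumes "monic r"
  shows "degree (R_poly \<delta> r) = 2 * degree r" "monic (R_poly \<delta> r)"
proof -
  let ?d = "degree r" and ?t = "[:\<delta>, 0, 1:] :: 'a poly"
  define H where "H = (\<Sum>i<?d. smult (poly.coeff r i) ([:0, 1:] ^ (?d - i) * ?t ^ i))"
  have R: "R_poly \<delta> r = ?t ^ ?d + H"
    using assms by (simp add: R_poly_def H_def lessThan_Suc_atMost[symmetric])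
  have dt: "degree (?t ^ ?d) = 2 * ?d" by (simp add: degree_power_eq)
  have lt: "monic (?t ^ ?d)" by (simp add: lead_coeff_power)
  have "H = 0 \<or> degree H < 2 * ?d"
  proof (cases "?d = 0")
    case False
    have "degree (smult (poly.coeff r i) ([:0, 1:] ^ (?d - i) * ?t ^ i)) < 2 * ?d" if "i < ?d" for i
    proof -
      have "degree (smult (poly.coeff r i) ([:0, 1:] ^ (?d - i) * ?t ^ i)) \<le>
          degree ([:0, 1::'a:] ^ (?d - i) * ?t ^ i)" by (rule degree_smult_le)
      also have "\<dots> = (?d - i) + 2 * i" by (simp add: degree_mult_eq degree_power_eq)
      also have "\<dots> < 2 * ?d" using that by simp
      finally show ?thesis .
    qed
    then have "degree H < 2 * ?d" unfolding H_def using False by (intro degree_sum_less) auto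
    then show ?thesis ..
  qed (simp add: H_def)
  then have "degree (R_poly \<delta> r) = 2 * ?d \<and> monic (R_poly \<delta> r)"
  proof
    assume "degree H < 2 * ?d"
    then show ?thesis using dt lt unfolding R
      by (metis degree_add_eq_left lead_coeff_add_le add.right_neutral coeff_add coeff_eq_0)
  qed (use R dt lt in simp)
  then show "degree (R_poly \<delta> r) = 2 * degree r" "monic (R_poly \<delta> r)" by auto
qed

lemma R_poly_coeff_0: "poly.coeff (R_poly \<delta> r) 0 = lead_coeff r * \<delta> ^ degree r"
proof -
  have "poly (R_poly \<delta> r) 0 = (\<Sum>i\<le>degree r. poly.coeff r i * (0 ^ (degree r - i) * \<delta> ^ i))"
    by (simp add: R_poly_def poly_sum)
  also have "\<dots> = (\<Sum>i\<in>{degree r}. poly.coeff r i * (0 ^ (degree r - i) * \<delta> ^ i))"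
    by (rule sum.mono_neutral_right) auto
  finally show ?thesis by (simp add: poly_0_coeff_0)
qed

section \<open>Block-diagonal representations\<close>

text \<open>\<open>represented_in\<close> without the basis condition, so that it makes sense for
  the sublist of vectors belonging to a single block.\<close>

definition matrix_action ::
  "('a::field \<Rightarrow> 'v::ab_group_add \<Rightarrow> 'v) \<Rightarrow> ('v \<Rightarrow> 'v) \<Rightarrow> 'v list \<Rightarrow> 'a mat \<Rightarrow> bool" where
  "matrix_action scale f bs M \<longleftrightarrow> M \<in> carrier_mat (length bs) (length bs) \<and>
     (\<forall>j < length bs. f (bs ! j) = (\<Sum>i < length bs. scale (M $$ (i, j)) (bs ! i)))"

context vector_space
begin

lemma represented_in_iff:
  "represented_in scale f bs M \<longleftrightarrow> is_basis scale bs \<and> matrix_action scale f bs M"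
  by (auto simp: represented_in_def matrix_action_def)

lemma matrix_action_span:
  assumes "matrix_action scale f bs M" "x \<in> set bs"
  shows "f x \<in> span (set bs)"
proof -
  obtain j where "j < length bs" "x = bs ! j" using assms(2) by (metis in_set_conv_nth)
  then have "f x = (\<Sum>i < length bs. scale (M $$ (i, j)) (bs ! i))"
    using assms(1) by (simp add: matrix_action_def)
  moreover have "\<dots> \<in> span (set bs)"
    by (intro span_sum span_scale span_base nth_mem) simp
  ultimately show ?thesis by simp
qed

lemma matrix_action_four_block:
  assumes A: "A \<in> carrier_mat (length bs) (length bs)" and B: "B \<in> carrier_mat m m"
  shows "matrix_action scale f (bs @ cs) (four_block_mat A (0\<^sub>m (length bs) m) (0\<^sub>m m (length bs)) B) \<longleftrightarrow>
     matrix_action scale f bs A \<and> matrix_action scale f cs B"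
proof (cases "length cs = m")
  case False
  then show ?thesis using A B by (auto simp: matrix_action_def)
next
  case True
  let ?n = "length bs"
  let ?M = "four_block_mat A (0\<^sub>m ?n m) (0\<^sub>m m ?n) B"
  have split: "(\<Sum>i<?n + m. h i) = (\<Sum>i<?n. h i) + (\<Sum>i<m. h (?n + i))" for h :: "nat \<Rightarrow> 'b"
    by (induction m) (simp_all add: add.assoc)
  have *: "(\<Sum>i < length (bs @ cs). scale (?M $$ (i, j)) ((bs @ cs) ! i)) =
      (\<Sum>i<?n. scale (?M $$ (i, j)) (bs ! i)) + (\<Sum>i<m. scale (?M $$ (?n + i, j)) (cs ! i))" for j
    using True by (simp add: split nth_append)
  have l: "(\<Sum>i < length (bs @ cs). scale (?M $$ (i, j)) ((bs @ cs) ! i)) =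
      (\<Sum>i<?n. scale (A $$ (i, j)) (bs ! i))" if "j < ?n" for j
    unfolding * using that A B by simp
  have r: "(\<Sum>i < length (bs @ cs). scale (?M $$ (i, ?n + j)) ((bs @ cs) ! i)) =
      (\<Sum>i<m. scale (B $$ (i, j)) (cs ! i))" if "j < m" for j
    unfolding * using that A B by simp
  have "matrix_action scale f (bs @ cs) ?M \<longleftrightarrow> (\<forall>j < ?n + m. f ((bs @ cs) ! j) =
      (\<Sum>i < length (bs @ cs). scale (?M $$ (i, j)) ((bs @ cs) ! i)))"
    using A B True by (simp add: matrix_action_def)
  also have "\<dots> \<longleftrightarrow> (\<forall>j < ?n. f ((bs @ cs) ! j) =
      (\<Sum>i < length (bs @ cs). scale (?M $$ (i, j)) ((bs @ cs) ! i))) \<and>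
      (\<forall>j < m. f ((bs @ cs) ! (?n + j)) =
      (\<Sum>i < length (bs @ cs). scale (?M $$ (i, ?n + j)) ((bs @ cs) ! i)))"
    (is "(\<forall>j < ?n + m. ?P j) \<longleftrightarrow> _")
  proof -
    have "Q j" if "\<forall>j<?n. Q j" "\<forall>j<m. Q (?n + j)" "j < ?n + m" for Q j
      using that by (cases "j < ?n") (auto dest!: le_Suc_ex simp: not_less)
    then have all_split: "(\<forall>j < ?n + m. Q j) \<longleftrightarrow> (\<forall>j<?n. Q j) \<and> (\<forall>j<m. Q (?n + j))" for Q
      by auto
    show ?thesis by (rule all_split)
  qed
  also have "\<dots> \<longleftrightarrow> matrix_action scale f bs A \<and> matrix_action scale f cs B"
    using l r A B True by (simp add: matrix_action_def nth_append)
  finally show ?thesis .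
qed

lemma matrix_action_diag_block:
  assumes "\<forall>M \<in> set Ms. square_mat M"
  shows "matrix_action scale f bs (diag_block_mat Ms) \<longleftrightarrow>
     (\<exists>bss. concat bss = bs \<and> list_all2 (matrix_action scale f) bss Ms)"
  using assms
proof (induction Ms arbitrary: bs)
  case Nil
  then show ?case by (auto simp: matrix_action_def)
next
  case (Cons A Ms)
  let ?B = "diag_block_mat Ms"
  define n m where "n = dim_row A" and "m = dim_row ?B"
  have A: "A \<in> carrier_mat n n" using Cons.prems by (auto simp: n_def)
  have B: "?B \<in> carrier_mat m m" using Cons.prems diag_block_mat_square[of Ms] by (auto simp: m_def)
  have D: "diag_block_mat (A # Ms) = four_block_mat A (0\<^sub>m n m) (0\<^sub>m m n) ?B"
    using A B by (simp add: Let_def)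
  have IH: "matrix_action scale f cs ?B \<longleftrightarrow> (\<exists>bss. concat bss = cs \<and> list_all2 (matrix_action scale f) bss Ms)" for cs
    using Cons by simp
  show ?case
  proof
    assume L: "matrix_action scale f bs (diag_block_mat (A # Ms))"
    then have len: "length bs = n + m" using A B unfolding D by (auto simp: matrix_action_def)
    have "matrix_action scale f (take n bs @ drop n bs) (four_block_mat A (0\<^sub>m n m) (0\<^sub>m m n) ?B)"
      using L D by simp
    then have "matrix_action scale f (take n bs) A" "matrix_action scale f (drop n bs) ?B"
      using matrix_action_four_block[of A "take n bs" ?B m f "drop n bs"] A B len by simp_all
    then obtain bss where "concat bss = drop n bs" "list_all2 (matrix_action scale f) bss Ms"
      "matrix_action scale f (take n bs) A" using IH by blast
    then show "\<exists>bss. concat bss = bs \<and> list_all2 (matrix_action scale f) bss (A # Ms)"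
      by (intro exI[of _ "take n bs # bss"]) simp
  next
    assume "\<exists>bss. concat bss = bs \<and> list_all2 (matrix_action scale f) bss (A # Ms)"
    then obtain b bss where b: "bs = b @ concat bss" "matrix_action scale f b A"
      "list_all2 (matrix_action scale f) bss Ms" by (auto simp: list_all2_Cons2)
    then have "matrix_action scale f (concat bss) ?B" using IH by blast
    moreover have "length b = n" using b(2) A by (auto simp: matrix_action_def)
    ultimately show "matrix_action scale f bs (diag_block_mat (A # Ms))"
      unfolding D b(1) using matrix_action_four_block[of A b ?B m f "concat bss"] A B b(2) by simp
  qed
qed

text \<open>All columns but the last say that \<open>bs\<close> is the orbit of its first vector
  under \<open>f\<close>; the last one is the relation \<open>g(f) x = 0\<close>. For
  \<open>g = 1\<close> the list is empty and the relation forces \<open>x = 0\<close>.\<close>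

lemma matrix_action_companion:
  assumes "monic g"
  shows "matrix_action scale f bs (companion_mat g) \<longleftrightarrow>
    (\<exists>x. bs = map (\<lambda>j. (f ^^ j) x) [0..<degree g] \<and> poly_endo scale g f x = 0)"
proof (cases "degree g = 0")
  case True
  then have "g = 1" using assms monic_degree_0 by blast
  then show ?thesis by (auto simp: matrix_action_def companion_mat_def)
next
  case False
  let ?d = "degree g"
  have dim: "companion_mat g \<in> carrier_mat ?d ?d" by (simp add: companion_mat_def)
  have endo: "poly_endo scale g f x = (\<Sum>i<?d. scale (poly.coeff g i) ((f ^^ i) x)) + (f ^^ ?d) x" for x
    using assms by (simp add: poly_endo_def lessThan_Suc_atMost[symmetric])
  have col: "(\<Sum>i<?d. scale (companion_mat g $$ (i, j)) (b i)) =
      (if j = ?d - 1 then - (\<Sum>i<?d. scale (poly.coeff g i) (b i)) else b (Suc j))"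
    if "j < ?d" for j and b :: "nat \<Rightarrow> 'b"
  proof (cases "j = ?d - 1")
    case True
    then show ?thesis using that by (simp add: companion_mat_def flip: sum_negf)
  next
    case ne: False
    then have "(\<Sum>i<?d. scale (companion_mat g $$ (i, j)) (b i)) =
        (\<Sum>i<?d. if i = Suc j then b i else 0)"
      using that by (intro sum.cong) (auto simp: companion_mat_def)
    also have "\<dots> = b (Suc j)" using that ne by (subst sum.delta) auto
    finally show ?thesis using ne by simp
  qed
  show ?thesis
  proof
    assume L: "matrix_action scale f bs (companion_mat g)"
    then have len: "length bs = ?d" using dim by (auto simp: matrix_action_def)
    have step: "f (bs ! j) = (if j = ?d - 1 then - (\<Sum>i<?d. scale (poly.coeff g i) (bs ! i))
        else bs ! Suc j)" if "j < ?d" for j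
      using L len that col[OF that] by (simp add: matrix_action_def)
    have nth: "bs ! j = (f ^^ j) (hd bs)" if "j < ?d" for j
      using that
    proof (induction j)
      case 0
      then show ?case using len by (metis funpow_0 hd_conv_nth length_greater_0_conv)
    next
      case (Suc j)
      then have "j \<noteq> ?d - 1" "j < ?d" by auto
      then show ?case using step[of j] Suc by simp
    qed
    have "(f ^^ ?d) (hd bs) = f (bs ! (?d - 1))"
      using nth[of "?d - 1"] False by (metis One_nat_def Suc_pred diff_less funpow.simps(2) neq0_conv
          o_apply zero_less_Suc)
    also have "\<dots> = - (\<Sum>i<?d. scale (poly.coeff g i) ((f ^^ i) (hd bs)))"
      using step[of "?d - 1"] False nth by simp
    finally have "poly_endo scale g f (hd bs) = 0" unfolding endo by simp
    moreover have "bs = map (\<lambda>j. (f ^^ j) (hd bs)) [0..<?d]"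
      using len nth by (intro nth_equalityI) auto
    ultimately show "\<exists>x. bs = map (\<lambda>j. (f ^^ j) x) [0..<?d] \<and> poly_endo scale g f x = 0" by blast
  next
    assume "\<exists>x. bs = map (\<lambda>j. (f ^^ j) x) [0..<?d] \<and> poly_endo scale g f x = 0"
    then obtain x where x: "bs = map (\<lambda>j. (f ^^ j) x) [0..<?d]" "poly_endo scale g f x = 0" by blast
    have top: "(f ^^ ?d) x = - (\<Sum>i<?d. scale (poly.coeff g i) ((f ^^ i) x))"
      using x(2) unfolding endo by (simp add: eq_neg_iff_add_eq_0 add.commute)
    have "f (bs ! j) = (\<Sum>i < ?d. scale (companion_mat g $$ (i, j)) (bs ! i))" if j: "j < ?d" for j
    proof (cases "j = ?d - 1")
      case True
      have d: "Suc j = ?d" using True j by simp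
      have "f (bs ! j) = (f ^^ Suc j) x" using x(1) j by simp
      also have "\<dots> = - (\<Sum>i<?d. scale (poly.coeff g i) ((f ^^ i) x))" unfolding d by (rule top)
      also have "\<dots> = - (\<Sum>i<?d. scale (poly.coeff g i) (bs ! i))" using x(1) by simp
      finally show ?thesis using True col[OF j, of "\<lambda>i. bs ! i"] by simp
    next
      case False
      then show ?thesis using x(1) j col[OF j, of "\<lambda>i. bs ! i"] by simp
    qed
    then show "matrix_action scale f bs (companion_mat g)"
      using dim x(1) by (simp add: matrix_action_def)
  qed
qed

lemma matrix_action_companions:
  assumes "\<forall>g\<in>set gs. monic g"
  shows "matrix_action scale f bs (diag_block_mat (map companion_mat gs)) \<longleftrightarrow>
    (\<exists>xs. length xs = length gs \<and>
       bs = concat (map (\<lambda>(g, x). map (\<lambda>j. (f ^^ j) x) [0..<degree g]) (zip gs xs)) \<and>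
       (\<forall>(g, x) \<in> set (zip gs xs). poly_endo scale g f x = 0))"
proof -
  have "matrix_action scale f bs (diag_block_mat (map companion_mat gs)) \<longleftrightarrow>
      (\<exists>bss. concat bss = bs \<and> list_all2 (matrix_action scale f) bss (map companion_mat gs))"
    by (rule matrix_action_diag_block) (simp add: companion_mat_def)
  also have "\<dots> \<longleftrightarrow> (\<exists>bss. concat bss = bs \<and> (\<exists>xs. length xs = length gs \<and>
       bss = map (\<lambda>(g, x). map (\<lambda>j. (f ^^ j) x) [0..<degree g]) (zip gs xs) \<and>
       (\<forall>(g, x) \<in> set (zip gs xs). poly_endo scale g f x = 0)))"
  proof -
    have "list_all2 (matrix_action scale f) bss (map companion_mat gs) \<longleftrightarrow>
      (\<exists>xs. length xs = length gs \<and>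
       bss = map (\<lambda>(g, x). map (\<lambda>j. (f ^^ j) x) [0..<degree g]) (zip gs xs) \<and>
       (\<forall>(g, x) \<in> set (zip gs xs). poly_endo scale g f x = 0))" for bss
      using assms
    proof (induction gs arbitrary: bss)
      case (Cons g gs)
      have ex_Cons: "(\<exists>xs :: 'b list. length xs = length (g # gs) \<and> P xs) \<longleftrightarrow>
          (\<exists>x xs. length xs = length gs \<and> P (x # xs))" for P
        by (auto simp: length_Suc_conv)
      have "list_all2 (matrix_action scale f) bss (map companion_mat (g # gs)) \<longleftrightarrow>
          (\<exists>b bss'. bss = b # bss' \<and> matrix_action scale f b (companion_mat g) \<and>
             list_all2 (matrix_action scale f) bss' (map companion_mat gs))"
        by (auto simp: list_all2_Cons2)
      also have "\<dots> \<longleftrightarrow> (\<exists>b bss'. bss = b # bss' \<and>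
          (\<exists>x. b = map (\<lambda>j. (f ^^ j) x) [0..<degree g] \<and> poly_endo scale g f x = 0) \<and>
          (\<exists>xs. length xs = length gs \<and>
            bss' = map (\<lambda>(g, x). map (\<lambda>j. (f ^^ j) x) [0..<degree g]) (zip gs xs) \<and>
            (\<forall>(g, x) \<in> set (zip gs xs). poly_endo scale g f x = 0)))"
        using matrix_action_companion[of g] Cons by simp
      also have "\<dots> \<longleftrightarrow> (\<exists>x xs. length xs = length gs \<and>
          bss = map (\<lambda>(g, x). map (\<lambda>j. (f ^^ j) x) [0..<degree g]) (zip (g # gs) (x # xs)) \<and>
          (\<forall>(g, x) \<in> set (zip (g # gs) (x # xs)). poly_endo scale g f x = 0))"
        by auto
      also have "\<dots> \<longleftrightarrow> (\<exists>xs. length xs = length (g # gs) \<and>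
          bss = map (\<lambda>(g, x). map (\<lambda>j. (f ^^ j) x) [0..<degree g]) (zip (g # gs) xs) \<and>
          (\<forall>(g, x) \<in> set (zip (g # gs) xs). poly_endo scale g f x = 0))"
        by (rule ex_Cons[symmetric])
      finally show ?case .
    qed simp
    then show ?thesis by presburger
  qed
  also have "\<dots> \<longleftrightarrow> (\<exists>xs. length xs = length gs \<and>
       bs = concat (map (\<lambda>(g, x). map (\<lambda>j. (f ^^ j) x) [0..<degree g]) (zip gs xs)) \<and>
       (\<forall>(g, x) \<in> set (zip gs xs). poly_endo scale g f x = 0))"
    by blast
  finally show ?thesis .
qed

end

section \<open>Blocks \<open>C(R_\<delta>(f))\<close> of \<open>u\<close> as cyclic pieces for
  \<open>v\<close>\<close>

context quadratic_over
begin

lemma linear_funpow_u: "Vector_Spaces.linear scale scale (u ^^ n)"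
  by unfold_locales (induction n, simp_all add: u.add u.scale)+

lemma poly_endo_sum: "poly_endo scale (\<Sum>i\<in>A. g i) f x = (\<Sum>i\<in>A. poly_endo scale (g i) f x)"
  by (induction A rule: infinite_finite_induct) (simp_all add: poly_endo_add)

text \<open>The factor \<open>t^2 + \<delta>\<close> evaluates to \<open>u v\<close>, so every term
  of \<open>R_\<delta>(f)\<close> at \<open>u\<close> carries the same power of \<open>u\<close>. As
  \<open>u\<close> is injective, killing \<open>x\<close> by \<open>R_\<delta>(f)\<close> in
  \<open>u\<close> means killing it by \<open>f\<close> in \<open>v\<close>.\<close>

lemma poly_endo_R_poly: "poly_endo scale (R_poly \<delta> f) u x = (u ^^ degree f) (f \<star> x)"
proof -
  interpret ud: Vector_Spaces.linear scale scale "u ^^ degree f" by (rule linear_funpow_u)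
  have quad: "poly_endo scale [:\<delta>, 0, 1:] u y = u (v y)" for y
    by (simp add: poly_endo_pCons[OF linear_u] u_v u.add u.scale)
  have v_funpow: "v ((u ^^ n) y) = (u ^^ n) (v y)" for n y
    by (induction n) (simp_all add: v_u)
  have quad_power: "poly_endo scale ([:\<delta>, 0, 1:] ^ i) u y = (u ^^ i) ((v ^^ i) y)" for i y
    by (induction i) (simp_all only: power_0 poly_endo_1 power_Suc poly_endo_mult[OF linear_u]
        quad v_funpow funpow.simps id_apply o_apply)
  have "poly_endo scale (R_poly \<delta> f) u x =
      (\<Sum>i\<le>degree f. scale (poly.coeff f i) ((u ^^ (degree f - i)) ((u ^^ i) ((v ^^ i) x))))"
    by (simp only: R_poly_def poly_endo_sum poly_endo_smult poly_endo_mult[OF linear_u]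
        poly_endo_X_power[OF linear_u] quad_power)
  also have "\<dots> = (\<Sum>i\<le>degree f. scale (poly.coeff f i) ((u ^^ degree f) ((v ^^ i) x)))"
    by (intro sum.cong refl) (simp flip: funpow_add o_apply[of "u ^^ _" "u ^^ _"])
  also have "\<dots> = (u ^^ degree f) (f \<star> x)"
    by (simp add: act_def poly_endo_def ud.sum ud.scale)
  finally show ?thesis .
qed

lemma poly_endo_R_poly_eq_0: "poly_endo scale (R_poly \<delta> f) u x = 0 \<longleftrightarrow> f \<star> x = 0"
proof -
  have "inj (u ^^ degree f)" using inj_u by (simp add: inj_fn)
  moreover have "(u ^^ degree f) 0 = 0"
    using linear_funpow_u Vector_Spaces.linear_iff by (metis scale_zero_left)
  ultimately show ?thesis unfolding poly_endo_R_poly by (metis injD)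
qed

text \<open>From generators to a basis: the span of the vectors \<open>u^j x\<close> is stable under
  \<open>u\<close> by the companion relations, hence is everything; their number being the
  dimension, they are distinct and independent.\<close>

lemma represented_in_iff_cyclic_decomp:
  assumes monic: "\<forall>f\<in>set fs. monic f"
  shows "(\<exists>bs. represented_in scale u bs (diag_block_mat (map (\<lambda>f. companion_mat (R_poly \<delta> f)) fs)))
    \<longleftrightarrow> cyclic_decomp (mset fs) UNIV"
proof -
  define B where "B xs = concat (map (\<lambda>(f, x). map (\<lambda>j. (u ^^ j) x) [0..<2 * degree f]) (zip fs xs))" for xs
  let ?M = "diag_block_mat (map (\<lambda>f. companion_mat (R_poly \<delta> f)) fs)"
  have len: "length (B xs) = (\<Sum>(f, x)\<leftarrow>zip fs xs. 2 * degree f)" for xs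
    unfolding B_def by (simp add: length_concat case_prod_unfold comp_def)
  have act: "matrix_action scale u bs ?M \<longleftrightarrow> (\<exists>xs. length xs = length fs \<and> bs = B xs \<and>
      (\<forall>(f, x) \<in> set (zip fs xs). f \<star> x = 0))" for bs
  proof -
    have z: "zip (map (R_poly \<delta>) fs) xs = map (\<lambda>(f, x). (R_poly \<delta> f, x)) (zip fs xs)" for xs :: "'b list"
      by (simp add: zip_map1)
    have B: "concat (map (\<lambda>(g, x). map (\<lambda>j. (u ^^ j) x) [0..<degree g]) (zip (map (R_poly \<delta>) fs) xs)) = B xs"
      for xs
      unfolding B_def z map_map
      by (intro arg_cong[of _ _ concat] map_cong refl)
        (use monic in \<open>auto dest!: set_zip_leftD simp: R_poly_monic(1)\<close>)
    have K: "(\<forall>(g, x)\<in>set (zip (map (R_poly \<delta>) fs) xs). poly_endo scale g u x = 0) \<longleftrightarrow>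
        (\<forall>(f, x) \<in> set (zip fs xs). f \<star> x = 0)" for xs
      unfolding z by (auto simp: poly_endo_R_poly_eq_0)
    have "\<forall>g\<in>set (map (R_poly \<delta>) fs). monic g" using monic R_poly_monic(2) by auto
    note matrix_action_companions[OF this, of u bs, unfolded B K]
    then show ?thesis by (simp add: comp_def)
  qed
  show ?thesis
  proof
    assume "\<exists>bs. represented_in scale u bs ?M"
    then obtain bs xs where bs: "is_basis scale bs" "length xs = length fs" "bs = B xs"
      "\<forall>(f, x) \<in> set (zip fs xs). f \<star> x = 0"
      unfolding represented_in_iff act by blast
    then have basis: "distinct bs" "independent (set bs)" "span (set bs) = UNIV"
      by (simp_all add: is_basis_def)
    have "dim UNIV = length bs"
      using dim_unique[of "set bs" UNIV "length bs"] basis distinct_card by auto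
    then have dim: "(\<Sum>(f, x)\<leftarrow>zip fs xs. 2 * degree f) = dim UNIV" using len[of xs] bs(3) by simp
    have "cyclic_gens (zip fs xs) UNIV"
      unfolding cyclic_gens_def
    proof (intro conjI allI impI)
      show "\<forall>(f, x)\<in>set (zip fs xs). monic f \<and> f \<star> x = 0 \<and> x \<in> UNIV"
        using bs(4) monic by (auto dest: set_zip_leftD)
      fix S assume S: "u_stable S" "snd ` set (zip fs xs) \<subseteq> S"
      have pow: "(u ^^ j) x \<in> S" if "x \<in> S" for j x
        using that S(1) by (induction j) (auto simp: u_stable_def)
      have "set bs \<subseteq> S"
      proof
        fix y assume "y \<in> set bs"
        then obtain f x j where "(f, x) \<in> set (zip fs xs)" "y = (u ^^ j) x"
          unfolding bs(3) B_def by auto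
        then show "y \<in> S" using S(2) pow by force
      qed
      then show "UNIV \<subseteq> S" using basis(3) S(1) span_minimal[of "set bs" S] by (simp add: u_stable_def)
    qed (rule dim)
    then show "cyclic_decomp (mset fs) UNIV"
      using bs(2) unfolding cyclic_decomp_def by (intro exI[of _ "zip fs xs"]) simp
  next
    assume "cyclic_decomp (mset fs) UNIV"
    then obtain xs where xs: "length xs = length fs" "cyclic_gens (zip fs xs) UNIV"
      by (rule cyclic_gens_sorted)
    let ?bs = "B xs"
    have ann: "\<forall>(f, x) \<in> set (zip fs xs). f \<star> x = 0" using xs(2) by (auto simp: cyclic_gens_def)
    then have M: "matrix_action scale u ?bs ?M" using act xs(1) by blast
    have "u y \<in> span (set ?bs)" if "y \<in> span (set ?bs)" for y
      using that
    proof (induction rule: span_induct_alt)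
      case (step c b y)
      then show ?case using matrix_action_span[OF M, of b] by (simp add: u.add u.scale span_add span_scale)
    qed (simp add: u.zero span_zero)
    then have "u_stable (span (set ?bs))" by (auto simp: u_stable_def)
    moreover have "x \<in> span (set ?bs)" if x: "(f, x) \<in> set (zip fs xs)" for f x
    proof (cases "degree f = 0")
      \<comment> \<open>A block of size 0 contributes nothing to the list, so its generator does not
        occur there; but it is 0.\<close>
      case True
      then have "f = 1" using x monic monic_degree_0 by (auto dest: set_zip_leftD)
      then have "x = 0" using ann x by auto
      then show ?thesis by (simp add: span_zero)
    next
      case False
      then have "x \<in> set (map (\<lambda>j. (u ^^ j) x) [0..<2 * degree f])"
        by (simp add: image_iff) (intro bexI[of _ 0], simp_all)
      then have "x \<in> set ?bs"
        unfolding B_def set_concat set_map by (intro UnionI[OF imageI[OF imageI[OF x]]]) simp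
      then show ?thesis by (rule span_base)
    qed
    moreover from this have "snd ` set (zip fs xs) \<subseteq> span (set ?bs)" by auto
    ultimately have span: "UNIV \<subseteq> span (set ?bs)"
      using xs(2) unfolding cyclic_gens_def by blast
    have card: "card (set ?bs) \<le> dim UNIV"
      using xs(2) len[of xs] card_length[of ?bs] by (simp add: cyclic_gens_def)
    then have ind: "independent (set ?bs)" using card_le_dim_spanning[of "set ?bs" UNIV] span by simp
    then have "card (set ?bs) = dim UNIV" using dim_unique[of "set ?bs" UNIV] span by auto
    then have "distinct ?bs"
      using xs(2) len[of xs] by (intro card_distinct) (simp add: cyclic_gens_def)
    then have "is_basis scale ?bs" using ind span by (auto simp: is_basis_def)
    then show "\<exists>bs. represented_in scale u bs ?M" using M represented_in_iff by blast
  qed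
qed

end

context finite_dimensional_vector_space
begin

text \<open>All \<open>R\<^sub>\<delta>(f)\<close> have a nonzero constant term, which puts the generators into the range of \<open>u\<close>.\<close>

lemma represented_in_R_poly_surj:
  assumes u: "Vector_Spaces.linear scale scale u" and "\<delta> \<noteq> 0" and monic: "\<forall>f\<in>set fs. monic f"
    and rep: "represented_in scale u bs (diag_block_mat (map (\<lambda>f. companion_mat (R_poly \<delta> f)) fs))"
  shows "surj u"
proof -
  interpret u: Vector_Spaces.linear scale scale u by fact
  let ?gs = "map (R_poly \<delta>) fs"
  have "matrix_action scale u bs (diag_block_mat (map companion_mat ?gs))"
    using rep by (simp add: represented_in_iff comp_def)
  then obtain xs where xs: "length xs = length ?gs"
      "bs = concat (map (\<lambda>(g, x). map (\<lambda>j. (u ^^ j) x) [0..<degree g]) (zip ?gs xs))"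
      "\<forall>(g, x) \<in> set (zip ?gs xs). poly_endo scale g u x = 0"
    using monic R_poly_monic(2) by (subst (asm) matrix_action_companions) auto
  have sub: "subspace (range u)" using u.subspace_image[of UNIV] by simp
  have gen: "x \<in> range u" if x: "(g, x) \<in> set (zip ?gs xs)" for g x
  proof -
    obtain f where f: "f \<in> set fs" "g = R_poly \<delta> f" using set_zip_leftD[OF x] by auto
    obtain c h where g: "g = pCons c h" by (cases g)
    have "poly.coeff g 0 = \<delta> ^ degree f" using R_poly_coeff_0[of \<delta> f] f monic by simp
    then have c: "c \<noteq> 0" using \<open>\<delta> \<noteq> 0\<close> unfolding g coeff_pCons_0 by simp
    have "scale c x = - u (poly_endo scale h u x)"
      using xs(3) x g by (auto simp: poly_endo_pCons[OF u] eq_neg_iff_add_eq_0)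
    also have "\<dots> = u (- poly_endo scale h u x)" by (simp add: u.neg)
    finally have "scale (inverse c) (scale c x) \<in> range u" using subspace_scale[OF sub] by simp
    then show ?thesis using c by simp
  qed
  have pow: "(u ^^ j) x \<in> range u" if "x \<in> range u" for j x
    using that by (cases j) auto
  have "set bs \<subseteq> range u"
  proof
    fix y assume "y \<in> set bs"
    then obtain g x j where "(g, x) \<in> set (zip ?gs xs)" "y = (u ^^ j) x" unfolding xs(2) by auto
    then show "y \<in> range u" using gen pow by blast
  qed
  moreover have "span (set bs) = UNIV" using rep by (simp add: represented_in_iff is_basis_def)
  ultimately show ?thesis using span_minimal[OF _ sub] by blast
qed

end

section \<open>The conic attached to the norm form\<close>

text \<open>In the algebra \<open>\<W>(p, q, \<beta>t)\<close> put \<open>u = \<beta>\<^sup>-\<^sup>1A(\<mu> - B)\<close>, so that \<open>u\<^sup>2 = tu - \<delta>\<close>, \<open>A = uB\<close> and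
  \<open>1, u, B, uB\<close> is a basis. Then \<open>quad_norm\<close> is the norm of \<open>a + bu\<close>, \<open>quat_norm\<close> that of
  \<open>a + bu + cB + duB\<close>, and \<open>conic x z\<close> is the norm of \<open>B - x - zu\<close>. Up to sign, \<open>conic_disc\<close> is
  the half-discriminant of the homogenized conic.\<close>

definition quad_norm :: "'a::comm_ring_1 \<Rightarrow> 'a \<Rightarrow> 'a \<Rightarrow> 'a \<Rightarrow> 'a" where
  "quad_norm t d a b = a ^ 2 + t * a * b + d * b ^ 2"

definition quat_norm ::
  "'a::comm_ring_1 \<Rightarrow> 'a \<Rightarrow> 'a \<Rightarrow> 'a \<Rightarrow> 'a \<Rightarrow> 'a \<Rightarrow> 'a \<Rightarrow> 'a \<Rightarrow> 'a \<Rightarrow> 'a" where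
  "quat_norm t d l m be a b c e =
     quad_norm t d a b + m * (a * c + t * a * e + d * b * e) + (t * m - l) * (b * c - a * e)
     + be * quad_norm t d c e"

definition conic ::
  "'a::comm_ring_1 \<Rightarrow> 'a \<Rightarrow> 'a \<Rightarrow> 'a \<Rightarrow> 'a \<Rightarrow> 'a \<Rightarrow> 'a \<Rightarrow> 'a" where
  "conic t d l m be x z = quad_norm t d x z - m * x + (l - t * m) * z + be"

definition conic_disc :: "'a::comm_ring_1 \<Rightarrow> 'a \<Rightarrow> 'a \<Rightarrow> 'a \<Rightarrow> 'a \<Rightarrow> 'a" where
  "conic_disc t d l m be = be * t ^ 2 - l * m * t + l ^ 2 + d * m ^ 2 - 4 * be * d"

text \<open>The arguments of \<open>quad_norm\<close> are the partial derivatives of the conic in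
  \<open>z\<close> and \<open>x\<close>. A point of the conic modulo \<open>r\<close> where both
  vanish would therefore make the discriminant vanish modulo \<open>r\<close>, in every
  characteristic.\<close>

lemma conic_disc_gradient:
  fixes t d l m be x z :: "'a::idom"
  shows "conic_disc t d l m be =
     quad_norm (- t) d (t * x + 2 * d * z + l - t * m) (2 * x + t * z - m)
     + (t ^ 2 - 4 * d) * conic t d l m be x z"
  unfolding conic_disc_def quad_norm_def conic_def by (simp add: algebra_simps power2_eq_square)

text \<open>Change of basis from \<open>1, A, B, AB\<close> to \<open>1, u, B, uB\<close>: since
  \<open>A = uB\<close> and \<open>B^2 = m B - be\<close>, one has \<open>AB = m uB - be u\<close>.
  The constant term of \<open>p\<close> appears as \<open>be * d\<close>.\<close>

lemma norm_coords_quat_norm: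
  fixes t d l m be :: "'a::idom"
  shows "a * (a + l * b + m * c + (l * m - be * t) * e)
     + b * (be * d * b + be * t * c + be * d * m * e) + be * (c * c)
     + (l * be * c + be * d * be * e) * e = quat_norm t d l m be a (- (be * e)) c (b + m * e)"
  unfolding quat_norm_def quad_norm_def by (simp add: algebra_simps power2_eq_square)

section \<open>Points of the conic modulo powers of an irreducible polynomial\<close>

context
  fixes t d l m be r :: "'a::field poly"
  assumes r: "irreducible r" and disc: "\<not> r dvd conic_disc t d l m be"
begin

text \<open>A Newton step along a coordinate whose partial derivative is invertible modulo
  \<open>r\<close>, \<open>s\<close> being its inverse. The conic is quadratic, so the expansion
  stops at the second-order term, a multiple of \<open>r^(2n)\<close>, and
  \<open>2n \<ge> n + 1\<close>.\<close>

lemma conic_lift_step: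
  assumes "n \<ge> 1" "r ^ n dvd conic t d l m be x z"
  shows "\<exists>x' z'. r ^ Suc n dvd conic t d l m be x' z'"
proof -
  let ?Q = "conic t d l m be" and ?gx = "2 * x + t * z - m" and ?gz = "t * x + 2 * d * z + l - t * m"
  obtain c where c: "?Q x z = r ^ n * c" using assms(2) by (elim dvdE)
  obtain k where k: "n = Suc k" using assms(1) by (cases n) auto
  have r2: "r ^ n * r ^ n = r ^ Suc n * r ^ k" by (simp add: k power_add[symmetric])
  have rQ: "r dvd ?Q x z" using c k by simp
  have "\<not> (r dvd ?gx \<and> r dvd ?gz)"
  proof
    assume g: "r dvd ?gx \<and> r dvd ?gz"
    have "r dvd a ^ 2 + - t * a * b + d * b ^ 2" if "r dvd a" "r dvd b" for a b
      using that by (intro dvd_add dvd_mult) (simp_all add: power2_eq_square)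
    from this[of ?gz ?gx] g have "r dvd quad_norm (- t) d ?gz ?gx" unfolding quad_norm_def by blast
    from dvd_add[OF this dvd_mult[OF rQ]] show False
      using disc unfolding conic_disc_gradient[of t d l m be x z] by blast
  qed
  then consider "\<not> r dvd ?gx" | "\<not> r dvd ?gz" by blast
  then show ?thesis
  proof cases
    case 1
    then obtain w s where ws: "w * r + s * ?gx = 1"
      using irreducible_comaximal[OF r] unfolding comaximal_def by blast
    have "?Q (x - r ^ n * c * s) z = ?Q x z - r ^ n * c * s * ?gx + r ^ n * r ^ n * (c * s) ^ 2"
      unfolding conic_def quad_norm_def by (simp add: algebra_simps power2_eq_square)
    also have "\<dots> = r ^ n * c * (1 - s * ?gx) + r ^ n * r ^ n * (c * s) ^ 2"
      unfolding c by (simp add: algebra_simps power2_eq_square)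
    also have "1 - s * ?gx = w * r" using ws by (metis add_diff_cancel_right')
    also have "r ^ n * c * (w * r) + r ^ n * r ^ n * (c * s) ^ 2 = r ^ Suc n * (c * w + r ^ k * (c * s) ^ 2)"
      unfolding r2 by (simp add: algebra_simps)
    finally show ?thesis by (metis dvd_triv_left)
  next
    case 2
    then obtain w s where ws: "w * r + s * ?gz = 1"
      using irreducible_comaximal[OF r] unfolding comaximal_def by blast
    have "?Q x (z - r ^ n * c * s) = ?Q x z - r ^ n * c * s * ?gz + r ^ n * r ^ n * d * (c * s) ^ 2"
      unfolding conic_def quad_norm_def by (simp add: algebra_simps power2_eq_square)
    also have "\<dots> = r ^ n * c * (1 - s * ?gz) + r ^ n * r ^ n * d * (c * s) ^ 2"
      unfolding c by (simp add: algebra_simps power2_eq_square)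
    also have "1 - s * ?gz = w * r" using ws by (metis add_diff_cancel_right')
    also have "r ^ n * c * (w * r) + r ^ n * r ^ n * d * (c * s) ^ 2 = r ^ Suc n * (c * w + r ^ k * d * (c * s) ^ 2)"
      unfolding r2 by (simp add: algebra_simps)
    finally show ?thesis by (metis dvd_triv_left)
  qed
qed

lemma conic_hensel:
  assumes "r dvd conic t d l m be x z"
  shows "\<exists>x z. r ^ n dvd conic t d l m be x z"
proof (induction n)
  case (Suc n)
  then show ?case using assms conic_lift_step by (cases "n = 0") auto
qed simp

text \<open>Modulo \<open>r\<close> a root \<open>k\<close> factors the quadratic part as
  \<open>(x + k z) (x + (t - k) z)\<close>. On the line \<open>x = e - k z\<close> the equation
  becomes linear in \<open>z\<close> with slope \<open>c e\<close>. The two parallel lines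
  \<open>e = 0\<close> and \<open>e = 1\<close> suffice: if both slopes vanish modulo
  \<open>r\<close>, so does the discriminant.\<close>

lemma conic_point_of_root:
  assumes k: "r dvd k ^ 2 - t * k + d"
  shows "\<exists>x z. r dvd conic t d l m be x z"
proof -
  let ?P = "k ^ 2 - t * k + d"
  define c where "c e = e * (t - 2 * k) + (l - m * (t - k))" for e
  have sol: "\<exists>x z. r dvd conic t d l m be x z" if nd: "\<not> r dvd c e" for e
  proof -
    obtain s w where sw: "s * r + w * c e = 1"
      using irreducible_comaximal[OF r nd] unfolding comaximal_def by blast
    define g where "g = e ^ 2 - m * e + be"
    have "conic t d l m be (e - k * z) z = z ^ 2 * ?P + g + z * c e" for z
      unfolding conic_def quad_norm_def c_def g_def by (simp add: algebra_simps power2_eq_square)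
    from this[of "- w * g"] have "conic t d l m be (e - k * (- w * g)) (- w * g) =
        (- w * g) ^ 2 * ?P + g * (1 - w * c e)" by (simp add: algebra_simps)
    also have "1 - w * c e = s * r" using sw by (metis add_diff_cancel_right')
    finally have "r dvd conic t d l m be (e - k * (- w * g)) (- w * g)"
      using k by (metis dvd_add dvd_mult dvd_triv_right)
    then show ?thesis by blast
  qed
  have "\<not> r dvd c 0 \<or> \<not> r dvd c 1"
  proof (rule ccontr)
    assume "\<not> ?thesis"
    then have c0: "r dvd c 0" and c1: "r dvd c 1" by auto
    then have E: "r dvd t - 2 * k"
      using dvd_diff[OF c1 c0] by (simp add: c_def)
    have "conic_disc t d l m be =
        (t - 2 * k) * (be * (t - 2 * k) + c 0 * m) + c 0 * c 0 + ?P * (m ^ 2 - 4 * be)"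
      unfolding conic_disc_def c_def by (simp add: algebra_simps power2_eq_square)
    then show False using disc c0 E k by (metis dvd_add dvd_mult2)
  qed
  then show ?thesis using sol by blast
qed

text \<open>Either the norm of the quadratic algebra generated by \<open>u\<close> is already
  isotropic modulo \<open>r\<close>, and a zero \<open>(a, b)\<close> gives the root
  \<open>- a / b\<close>; or \<open>c + e u\<close> is invertible, and dividing the isotropic
  element by it gives coefficient 1 at \<open>B\<close>, which is a point of the conic.\<close>

lemma conic_point_of_isotropic:
  assumes iso: "r dvd quat_norm t d l m be a b c e"
    and nz: "\<not> (r dvd a \<and> r dvd b \<and> r dvd c \<and> r dvd e)"
  shows "\<exists>x z. r dvd conic t d l m be x z"
proof (cases "\<exists>a b. \<not> (r dvd a \<and> r dvd b) \<and> r dvd quad_norm t d a b")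
  case True
  then obtain a b where ab: "\<not> (r dvd a \<and> r dvd b)" "r dvd quad_norm t d a b" by blast
  have "\<not> r dvd b"
  proof
    assume b: "r dvd b"
    have "a ^ 2 = quad_norm t d a b - b * (t * a + d * b)"
      unfolding quad_norm_def by (simp add: algebra_simps power2_eq_square)
    then have "r dvd a ^ 2" using b ab(2) by (metis dvd_diff dvd_mult2)
    then have "r dvd a" using irreducible_prime_elem_poly[OF r] prime_elem_dvd_power by blast
    then show False using ab(1) b by blast
  qed
  then obtain w s where ws: "w * r + s * b = 1"
    using irreducible_comaximal[OF r] unfolding comaximal_def by blast
  have "(- s * a) ^ 2 - t * (- s * a) + d =
      s ^ 2 * quad_norm t d a b + (1 - s * b) * (t * s * a + d * (1 + s * b))"
    unfolding quad_norm_def by (simp add: algebra_simps power2_eq_square)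
  also have "1 - s * b = w * r" using ws by (metis add_diff_cancel_right')
  finally have "r dvd (- s * a) ^ 2 - t * (- s * a) + d"
    using ab(2) by simp
  then show ?thesis by (rule conic_point_of_root)
next
  case False
  have "\<not> r dvd quad_norm t d c e"
  proof
    assume "r dvd quad_norm t d c e"
    then have ce: "r dvd c" "r dvd e" using False by blast+
    have "quad_norm t d a b = quat_norm t d l m be a b c e
        - c * (m * a + (t * m - l) * b + be * (c + t * e))
        - e * (m * (t * a + d * b) - (t * m - l) * a + be * d * e)"
      unfolding quat_norm_def quad_norm_def by (simp add: algebra_simps power2_eq_square)
    then have "r dvd quad_norm t d a b" using iso ce by (metis dvd_diff dvd_mult2)
    then show False using False nz ce by blast
  qed
  then obtain w n where wn: "w * r + n * quad_norm t d c e = 1"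
    using irreducible_comaximal[OF r] unfolding comaximal_def by blast
  \<comment> \<open>\<open>n * (?k0 + ?k1 u)\<close> is \<open>(c + e u)^-1 (a + b u)\<close> modulo
    \<open>r\<close>: the conjugate of \<open>c + e u\<close> is \<open>c + t e - e u\<close>, and
    \<open>n\<close> inverts its norm.\<close>
  let ?k0 = "a * c + t * a * e + d * b * e" and ?k1 = "b * c - a * e"
  have "conic t d l m be (- n * ?k0) (- n * ?k1) = n * quat_norm t d l m be a b c e
      + (1 - n * quad_norm t d c e) * (be - n * quad_norm t d a b)"
    unfolding conic_def quat_norm_def quad_norm_def by (simp add: algebra_simps power2_eq_square)
  also have "1 - n * quad_norm t d c e = w * r" using wn by (metis add_diff_cancel_right')
  finally have "r dvd conic t d l m be (- n * ?k0) (- n * ?k1)"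
    using iso by simp
  then show ?thesis by blast
qed

end

section \<open>The norm form over the residue field\<close>

lemma poly_class_ring_hom:
  fixes r :: "'a::field poly"
  shows "cring (residue_ring_poly r)"
    and "poly_class r \<in> Ring.ring_hom ring_of_type_algebra (residue_ring_poly r)"
    and "carrier (residue_ring_poly r) = range (poly_class r)"
    and "poly_class r f = \<zero>\<^bsub>residue_ring_poly r\<^esub> \<longleftrightarrow> r dvd f"
proof -
  let ?R = "ring_of_type_algebra :: 'a poly ring"
  have car: "carrier ?R = UNIV" by (simp add: ring_of_type_algebra_def)
  interpret R: cring ?R by (rule cring_from_type_algebra)
  let ?I = "PIdl\<^bsub>?R\<^esub> r"
  have I: "?I = {f. r dvd f}"
    by (auto simp: cgenideal_def ring_of_type_algebra_def dvd_def mult.commute)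
  interpret I: ideal ?I ?R by (rule R.cgenideal_ideal) (simp add: car)
  have cl: "poly_class r = (\<lambda>f. ?I +>\<^bsub>?R\<^esub> f)" by (simp add: poly_class_def fun_eq_iff)
  show "cring (residue_ring_poly r)"
    unfolding residue_ring_poly_def using I.quotient_is_cring R.is_cring by simp
  show "poly_class r \<in> Ring.ring_hom ?R (residue_ring_poly r)"
    unfolding residue_ring_poly_def cl using I.rcos_ring_hom by simp
  show "carrier (residue_ring_poly r) = range (poly_class r)"
    unfolding residue_ring_poly_def cl FactRing_def A_RCOSETS_def' by (auto simp: car)
  have "poly_class r f = \<zero>\<^bsub>residue_ring_poly r\<^esub> \<longleftrightarrow> ?I +>\<^bsub>?R\<^esub> f = ?I"
    by (simp add: residue_ring_poly_def cl FactRing_def)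
  also have "\<dots> \<longleftrightarrow> f \<in> ?I"
    using I.a_rcos_const[of f] I.a_rcos_self[of f] car by auto
  finally show "poly_class r f = \<zero>\<^bsub>residue_ring_poly r\<^esub> \<longleftrightarrow> r dvd f" by (simp add: I)
qed

lemma W_elem_zero:
  fixes L :: "'b ring" (structure)
  assumes "cring L" and c: "l \<in> carrier L" "al \<in> carrier L" "m \<in> carrier L" "be \<in> carrier L" "x \<in> carrier L"
  shows "W_elem L l al m be x \<zero> \<zero> \<zero> \<zero> = zero4 L"
proof -
  interpret cring L by fact
  have lt4: "i < 4 \<longleftrightarrow> i = 0 \<or> i = 1 \<or> i = 2 \<or> i = 3" for i :: nat by auto
  have A: "W_A L l al $$ (i, j) \<in> carrier L" if "i < 4" "j < 4" for i j
    using that c unfolding W_A_def mat_of_rows_list_def lt4 by (auto simp: numeral_2_eq_2 numeral_3_eq_3)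
  have B: "W_B L l m be x $$ (i, j) \<in> carrier L" if "i < 4" "j < 4" for i j
    using that c unfolding W_B_def mat_of_rows_list_def lt4 by (auto simp: numeral_2_eq_2 numeral_3_eq_3)
  have AB: "mult4 L (W_A L l al) (W_B L l m be x) $$ (i, j) \<in> carrier L" if "i < 4" "j < 4" for i j
    using that A B by (auto simp: mult4_def intro!: finsum_closed)
  have O: "one4 L $$ (i, j) \<in> carrier L" if "i < 4" "j < 4" for i j
    using that by (simp add: one4_def)
  show ?thesis
    unfolding W_elem_def Let_def zero4_def
    by (rule eq_matI) (use A B AB O in auto)
qed

text \<open>Residue classes lift to polynomials, which turns vanishing over the residue ring into
  divisibility by \<open>r\<close>. The first column of the matrix detects whether an element is
  zero.\<close>

lemma norm_isotropic_iff:
  fixes p q r :: "'a::field poly"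
  assumes p: "p = [:be * d, - l, 1:]" and q: "q = [:be, - m, 1:]" and be: "be \<noteq> 0"
  shows "norm_isotropic p q r \<longleftrightarrow>
    (\<exists>a b c e. \<not> (r dvd a \<and> r dvd b \<and> r dvd c \<and> r dvd e) \<and>
       r dvd quat_norm [:0, 1:] [:d:] [:l:] [:m:] [:be:] a b c e)"
proof -
  let ?L = "residue_ring_poly r" and ?k = "poly_class r"
  let ?R = "ring_of_type_algebra :: 'a poly ring"
  let ?t = "[:0, 1:] :: 'a poly"
  have hom: "?k \<in> Ring.ring_hom ?R ?L" by (rule poly_class_ring_hom)
  interpret L: cring ?L by (rule poly_class_ring_hom)
  interpret R: cring ?R by (rule cring_from_type_algebra)
  have mult: "?k f \<otimes>\<^bsub>?L\<^esub> ?k g = ?k (f * g)" for f g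
    using ring_hom_mult[OF hom, of f g] by (simp add: ring_of_type_algebra_def)
  have add: "?k f \<oplus>\<^bsub>?L\<^esub> ?k g = ?k (f + g)" for f g
    using ring_hom_add[OF hom, of f g] by (simp add: ring_of_type_algebra_def)
  have car: "?k f \<in> carrier ?L" for f by (simp add: poly_class_ring_hom(3))
  have zero: "?k 0 = \<zero>\<^bsub>?L\<^esub>" by (simp add: poly_class_ring_hom(4))
  have minus: "?k f \<ominus>\<^bsub>?L\<^esub> ?k g = ?k (f - g)" for f g
  proof -
    have "?k (f - g) \<oplus>\<^bsub>?L\<^esub> ?k g = ?k f" by (simp add: add)
    then show ?thesis using car by (metis L.add.inv_solve_right a_minus_def)
  qed
  let ?x = "?k [:be:] \<otimes>\<^bsub>?L\<^esub> ?k ?t"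
  let ?W = "\<lambda>a b c e. W_elem ?L (?k [:l:]) (?k [:be * d:]) (?k [:m:]) (?k [:be:]) ?x (?k a) (?k b) (?k c) (?k e)"
  have norm: "W_norm ?L (?k [:l:]) (?k [:be * d:]) (?k [:m:]) (?k [:be:]) ?x (?W a b c e) =
      ?k (quat_norm ?t [:d:] [:l:] [:m:] [:be:] a (- ([:be:] * e)) c (b + [:m:] * e))" for a b c e
  proof -
    have "W_norm ?L (?k [:l:]) (?k [:be * d:]) (?k [:m:]) (?k [:be:]) ?x (?W a b c e) =
      norm_coords ?L (?k [:l:]) (?k [:be * d:]) (?k [:m:]) (?k [:be:]) ?x (?k a) (?k b) (?k c) (?k e)"
      by (rule W_norm_W_elem) (simp_all add: car L.is_cring)
    also have "\<dots> = ?k (quat_norm ?t [:d:] [:l:] [:m:] [:be:] a (- ([:be:] * e)) c (b + [:m:] * e))"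
    proof -
      have "[:be * d:] = [:be:] * [:d:]" by simp
      then show ?thesis
        unfolding norm_coords_def mult add minus norm_coords_quat_norm[symmetric] by (simp only: mult.assoc)
    qed
    finally show ?thesis .
  qed
  have elem: "?W a b c e = zero4 ?L \<longleftrightarrow> r dvd a \<and> r dvd b \<and> r dvd c \<and> r dvd e" (is "?l \<longleftrightarrow> ?r")
    for a b c e
  proof
    assume ?l
    moreover have "zero4 ?L $$ (i, 0) = \<zero>\<^bsub>?L\<^esub>" if "i < 4" for i using that by (simp add: zero4_def)
    moreover note W_elem_first_column[OF L.is_cring, of "?k [:l:]" "?k [:be * d:]" "?k [:m:]" "?k [:be:]" ?x
          "?k a" "?k b" "?k c" "?k e"]
    ultimately have "?k a = \<zero>\<^bsub>?L\<^esub>" "?k b = \<zero>\<^bsub>?L\<^esub>" "?k c = \<zero>\<^bsub>?L\<^esub>" "?k e = \<zero>\<^bsub>?L\<^esub>"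
      using car by simp_all
    then show ?r by (simp only: poly_class_ring_hom(4))
  next
    assume ?r
    then show ?l using W_elem_zero[OF L.is_cring] car by (simp add: poly_class_ring_hom(4)[symmetric])
  qed
  have "norm_isotropic p q r \<longleftrightarrow>
      W_isotropic ?L (?k [:l:]) (?k [:be * d:]) (?k [:m:]) (?k [:be:]) ?x"
    by (simp add: norm_isotropic_def p q)
  also have "\<dots> \<longleftrightarrow> (\<exists>a b c e. ?W a b c e \<noteq> zero4 ?L \<and>
      W_norm ?L (?k [:l:]) (?k [:be * d:]) (?k [:m:]) (?k [:be:]) ?x (?W a b c e) = \<zero>\<^bsub>?L\<^esub>)"
    unfolding W_isotropic_def W_alg_def poly_class_ring_hom(3) by blast
  also have "\<dots> \<longleftrightarrow> (\<exists>a b c e. \<not> (r dvd a \<and> r dvd b \<and> r dvd c \<and> r dvd e) \<and>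
       r dvd quat_norm ?t [:d:] [:l:] [:m:] [:be:] a (- ([:be:] * e)) c (b + [:m:] * e))"
    unfolding elem norm poly_class_ring_hom(4) by blast
  also have "\<dots> \<longleftrightarrow> (\<exists>a b c e. \<not> (r dvd a \<and> r dvd b \<and> r dvd c \<and> r dvd e) \<and>
       r dvd quat_norm ?t [:d:] [:l:] [:m:] [:be:] a b c e)"
  proof (intro iffI; elim exE conjE)
    fix a b c e
    assume *: "\<not> (r dvd a \<and> r dvd b \<and> r dvd c \<and> r dvd e)"
      "r dvd quat_norm ?t [:d:] [:l:] [:m:] [:be:] a (- ([:be:] * e)) c (b + [:m:] * e)"
    have "r dvd b \<and> r dvd e" if "r dvd - ([:be:] * e)" "r dvd b + [:m:] * e"
    proof -
      have "r dvd e" using that(1) be by (simp add: dvd_smult_iff)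
      then show ?thesis using that(2) by (metis dvd_add_left_iff dvd_mult)
    qed
    then show "\<exists>a b c e. \<not> (r dvd a \<and> r dvd b \<and> r dvd c \<and> r dvd e) \<and>
       r dvd quat_norm ?t [:d:] [:l:] [:m:] [:be:] a b c e" using * by blast
  next
    fix a b c e
    assume *: "\<not> (r dvd a \<and> r dvd b \<and> r dvd c \<and> r dvd e)"
      "r dvd quat_norm ?t [:d:] [:l:] [:m:] [:be:] a b c e"
    \<comment> \<open>Inverse of the change of basis that sends \<open>(b', e')\<close> to
      \<open>(- be e', b' + m e')\<close>; it exists because \<open>be\<close> is a nonzero
      constant.\<close>
    define e' where "e' = smult (- inverse be) b"
    define b' where "b' = e - [:m:] * e'"
    have eq: "- ([:be:] * e') = b" "b' + [:m:] * e' = e" using be by (simp_all add: e'_def b'_def)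
    have "r dvd b \<and> r dvd e" if "r dvd b'" "r dvd e'"
      using that eq by (metis dvd_add dvd_minus_iff dvd_mult)
    then show "\<exists>a b c e. \<not> (r dvd a \<and> r dvd b \<and> r dvd c \<and> r dvd e) \<and>
       r dvd quat_norm ?t [:d:] [:l:] [:m:] [:be:] a (- ([:be:] * e)) c (b + [:m:] * e)"
      using * eq by (intro exI[of _ a] exI[of _ b'] exI[of _ c] exI[of _ e']) auto
  qed
  finally show ?thesis .
qed

section \<open>Regularity in terms of the discriminant\<close>

definition ac_eval :: "'a::field poly \<Rightarrow> 'a alg_closure \<Rightarrow> 'a alg_closure" where
  "ac_eval g z = poly (map_poly to_ac g) z"

lemma Root_iff: "z \<in> Root g \<longleftrightarrow> ac_eval g z = 0"
  by (simp add: Root_def ac_eval_def)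

lemma ac_eval_pCons [simp]: "ac_eval (pCons c g) z = to_ac c + z * ac_eval g z"
  by (simp add: ac_eval_def Polynomial.map_poly_pCons)

lemma ac_eval_0 [simp]: "ac_eval 0 z = 0"
  by (simp add: ac_eval_def)

lemma ac_eval_1 [simp]: "ac_eval 1 z = 1"
  by (simp add: ac_eval_def)

lemma ac_eval_add [simp]: "ac_eval (g + h) z = ac_eval g z + ac_eval h z"
  by (induction g h rule: poly_induct2) (simp_all add: algebra_simps)

lemma ac_eval_smult [simp]: "ac_eval (smult c g) z = to_ac c * ac_eval g z"
  by (induction g) (simp_all add: algebra_simps)

lemma ac_eval_mult [simp]: "ac_eval (g * h) z = ac_eval g z * ac_eval h z"
  by (induction g) (simp_all add: algebra_simps)

lemma ac_eval_power [simp]: "ac_eval (g ^ n) z = ac_eval g z ^ n"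
  by (induction n) simp_all

lemma ac_eval_sum: "ac_eval (\<Sum>i\<in>A. g i) z = (\<Sum>i\<in>A. ac_eval (g i) z)"
  by (induction A rule: infinite_finite_induct) simp_all

lemma ac_eval_altdef: "ac_eval g z = (\<Sum>i\<le>degree g. to_ac (poly.coeff g i) * z ^ i)"
  by (simp add: ac_eval_def poly_altdef degree_map_poly coeff_map_poly)

lemma ac_eval_root_exists:
  fixes g :: "'a::field poly"
  assumes "degree g > 0"
  shows "\<exists>z. ac_eval g z = 0"
proof -
  have "degree (map_poly to_ac g) > 0" using assms by (simp add: degree_map_poly)
  then show ?thesis unfolding ac_eval_def by (rule alg_closed_imp_poly_has_root)
qed

lemma ac_eval_R_poly:
  assumes "z \<noteq> 0"
  shows "ac_eval (R_poly \<delta> r) z = z ^ degree r * ac_eval r (z + to_ac \<delta> / z)"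
proof -
  have q: "z ^ (degree r - i) * (to_ac \<delta> + z * z) ^ i = z ^ degree r * (z + to_ac \<delta> / z) ^ i"
    if "i \<le> degree r" for i
  proof -
    have e: "to_ac \<delta> + z * z = z * (z + to_ac \<delta> / z)" using assms by (simp add: distrib_left)
    have pw: "z ^ (degree r - i) * z ^ i = z ^ degree r" using that by (simp flip: power_add)
    show ?thesis unfolding e power_mult_distrib mult.assoc[symmetric] pw ..
  qed
  have "ac_eval (R_poly \<delta> r) z =
      (\<Sum>i\<le>degree r. to_ac (poly.coeff r i) * (z ^ (degree r - i) * (to_ac \<delta> + z * z) ^ i))"
    by (simp add: R_poly_def ac_eval_sum)
  also have "\<dots> = (\<Sum>i\<le>degree r. to_ac (poly.coeff r i) * (z ^ degree r * (z + to_ac \<delta> / z) ^ i))"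
    by (intro sum.cong refl) (simp add: q)
  finally show ?thesis by (simp add: ac_eval_altdef sum_distrib_left mult.left_commute)
qed

definition disc_poly :: "'a::field \<Rightarrow> 'a \<Rightarrow> 'a \<Rightarrow> 'a \<Rightarrow> 'a poly" where
  "disc_poly d l m be = conic_disc [:0, 1:] [:d:] [:l:] [:m:] [:be:]"

lemma disc_poly_eq:
  "disc_poly d l m be = [:l ^ 2 + d * m ^ 2 - 4 * be * d, - (l * m), be:]"
  by (simp add: disc_poly_def conic_disc_def power2_eq_square numeral_poly)

text \<open>With the roots \<open>x\<^sub>1, x\<^sub>2\<close> of \<open>p\<close> and \<open>y\<^sub>1, y\<^sub>2\<close> of \<open>q\<close>, both sides of the identity below are
  \<open>\<Prod>\<^sub>i\<^sub>,\<^sub>j (x\<^sub>i - y\<^sub>j z)\<close> up to the factor \<open>z\<^sup>2\<close>.\<close>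

lemma disc_poly_product:
  fixes x1 x2 y1 y2 z d :: "'a::field"
  assumes "y1 * y2 \<noteq> 0" "x1 * x2 = y1 * y2 * d" "z \<noteq> 0"
  defines "w \<equiv> z + d / z"
  shows "z ^ 2 * (y1 * y2 * ((x1 + x2) ^ 2 + d * (y1 + y2) ^ 2 - 4 * (y1 * y2) * d
      - w * ((x1 + x2) * (y1 + y2)) + w ^ 2 * (y1 * y2))) =
    (x1 - y1 * z) * (x2 - y2 * z) * ((x1 - y2 * z) * (x2 - y1 * z))"
proof -
  define S T b where "S = x1 * y2 + x2 * y1" and "T = x1 * y1 + x2 * y2" and "b = y1 * y2"
  have bwz: "b * d + b * z ^ 2 = b * w * z"
    using assms(3) by (simp add: w_def field_simps power2_eq_square)
  have xx: "x1 * x2 = b * d" using assms(2) by (simp add: b_def)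
  have "(x1 - y1 * z) * (x2 - y2 * z) = x1 * x2 + b * z ^ 2 - S * z"
    by (simp add: S_def b_def algebra_simps power2_eq_square)
  also have "\<dots> = (b * w - S) * z" unfolding xx bwz by (simp add: algebra_simps)
  finally have 1: "(x1 - y1 * z) * (x2 - y2 * z) = (b * w - S) * z" .
  have "(x1 - y2 * z) * (x2 - y1 * z) = x1 * x2 + b * z ^ 2 - T * z"
    by (simp add: T_def b_def algebra_simps power2_eq_square)
  also have "\<dots> = (b * w - T) * z" unfolding xx bwz by (simp add: algebra_simps)
  finally have 2: "(x1 - y2 * z) * (x2 - y1 * z) = (b * w - T) * z" .
  have ST: "S + T = (x1 + x2) * (y1 + y2)" by (simp add: S_def T_def algebra_simps)
  have "S * T = (x1 * x2) * (y1 ^ 2 + y2 ^ 2) + b * (x1 ^ 2 + x2 ^ 2)"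
    by (simp add: S_def T_def b_def algebra_simps power2_eq_square)
  also have "\<dots> = b * ((x1 + x2) ^ 2 - 2 * (x1 * x2)) + (x1 * x2) * ((y1 + y2) ^ 2 - 2 * (y1 * y2))"
    by (simp add: b_def algebra_simps power2_eq_square)
  also have "\<dots> = b * ((x1 + x2) ^ 2 + d * (y1 + y2) ^ 2 - 4 * b * d)"
    unfolding xx b_def[symmetric] by (simp add: algebra_simps)
  finally have ST2: "S * T = b * ((x1 + x2) ^ 2 + d * (y1 + y2) ^ 2 - 4 * b * d)" .
  have "(x1 - y1 * z) * (x2 - y2 * z) * ((x1 - y2 * z) * (x2 - y1 * z)) =
      z ^ 2 * ((b * w) ^ 2 - b * w * (S + T) + S * T)"
    unfolding 1 2 by (simp add: algebra_simps power2_eq_square)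
  also have "\<dots> = z ^ 2 * (b * ((x1 + x2) ^ 2 + d * (y1 + y2) ^ 2 - 4 * b * d
      - w * ((x1 + x2) * (y1 + y2)) + w ^ 2 * b))"
    unfolding ST ST2 by (simp add: algebra_simps power2_eq_square)
  finally show ?thesis by (simp add: b_def)
qed

context
  fixes p q :: "'a::field poly" and l m be d :: 'a
  assumes p: "p = [:be * d, - l, 1:]" and q: "q = [:be, - m, 1:]" and be: "be \<noteq> 0" and d: "d \<noteq> 0"
begin

text \<open>The product of \<open>disc_poly_product\<close> vanishes exactly when \<open>z\<close>
  is one of the four quotients. Regularity of \<open>u\<close> thus becomes a condition on
  \<open>z + d / z\<close>, that is, on \<open>v\<close>.\<close>

lemma Root_quotients_iff:
  "z \<in> Root_quotients p q \<longleftrightarrow> z \<noteq> 0 \<and> ac_eval (disc_poly d l m be) (z + to_ac d / z) = 0"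
proof -
  obtain x1 where x1: "ac_eval p x1 = 0" using ac_eval_root_exists[of p] p by auto
  obtain y1 where y1: "ac_eval q y1 = 0" using ac_eval_root_exists[of q] q by auto
  define x2 y2 where "x2 = to_ac l - x1" and "y2 = to_ac m - y1"
  have sum: "x1 + x2 = to_ac l" "y1 + y2 = to_ac m" by (simp_all add: x2_def y2_def)
  have prod: "x1 * x2 = to_ac be * to_ac d" "y1 * y2 = to_ac be"
    using x1 y1 by (simp_all add: p q x2_def y2_def algebra_simps)
  have mult: "(x - y) * (x - z) = x * x - (y + z) * x + y * z" for x y z :: "'a alg_closure"
    by (simp add: algebra_simps)
  have pf: "ac_eval p x = (x - x1) * (x - x2)" for x
    unfolding mult sum prod by (simp add: p algebra_simps)
  have qf: "ac_eval q y = (y - y1) * (y - y2)" for y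
    unfolding mult sum prod by (simp add: q algebra_simps)
  have nz: "x1 \<noteq> 0" "x2 \<noteq> 0" "y1 \<noteq> 0" "y2 \<noteq> 0"
    using prod be d by auto
  have rp: "x \<in> Root p \<longleftrightarrow> x = x1 \<or> x = x2" and rq: "x \<in> Root q \<longleftrightarrow> x = y1 \<or> x = y2" for x
    by (simp_all add: Root_iff pf qf)
  have "z \<in> Root_quotients p q \<longleftrightarrow>
      (\<exists>x\<in>{x1, x2}. \<exists>y\<in>{y1, y2}. z = x * inverse y)"
    unfolding Root_quotients_def rp rq by blast
  also have "\<dots> \<longleftrightarrow> z \<noteq> 0 \<and>
      (x1 - y1 * z) * (x2 - y2 * z) * ((x1 - y2 * z) * (x2 - y1 * z)) = 0"
  proof -
    have "z = x * inverse y \<longleftrightarrow> x - y * z = 0" if "y \<noteq> 0" for x y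
      using that by (auto simp: field_simps)
    moreover have "z \<noteq> 0" if "x - y * z = 0" "x \<noteq> 0" for x y using that by auto
    ultimately show ?thesis using nz unfolding mult_eq_0_iff by blast
  qed
  also have "\<dots> \<longleftrightarrow> z \<noteq> 0 \<and> ac_eval (disc_poly d l m be) (z + to_ac d / z) = 0"
  proof (cases "z = 0")
    case False
    have *: "y1 * y2 \<noteq> 0" "x1 * x2 = y1 * y2 * to_ac d" using prod be by simp_all
    let ?w = "z + to_ac d / z"
    have "ac_eval (disc_poly d l m be) ?w = (x1 + x2) ^ 2 + to_ac d * (y1 + y2) ^ 2
        - 4 * (y1 * y2) * to_ac d - ?w * ((x1 + x2) * (y1 + y2)) + ?w ^ 2 * (y1 * y2)"
      unfolding sum prod by (simp add: disc_poly_eq algebra_simps power2_eq_square)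
    then show ?thesis
      using False *(1) unfolding disc_poly_product[OF * False, symmetric] mult_eq_0_iff by simp
  qed simp
  finally show ?thesis .
qed

lemma Root_R_poly_disjoint_iff:
  assumes r: "irreducible r"
  shows "Root (R_poly d r) \<inter> Root_quotients p q = {} \<longleftrightarrow> \<not> r dvd disc_poly d l m be"
proof
  assume disj: "Root (R_poly d r) \<inter> Root_quotients p q = {}"
  show "\<not> r dvd disc_poly d l m be"
  proof
    assume dv: "r dvd disc_poly d l m be"
    have "r \<noteq> 0" "\<not> r dvd 1" using r by (auto simp: irreducible_def)
    then have "degree r > 0" using is_unit_iff_degree by blast
    then obtain w where w: "ac_eval r w = 0" using ac_eval_root_exists by blast
    \<comment> \<open>Every \<open>w\<close> in the closure has the form \<open>z + d / z\<close>,
      with \<open>z\<close> a root of \<open>t^2 - w t + d\<close>, and \<open>z\<close> is nonzero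
      as \<open>d\<close> is.\<close>
    obtain z where z: "poly [:to_ac d, - w, 1:] z = 0"
      using alg_closed_imp_poly_has_root[of "[:to_ac d, - w, 1:]"] by auto
    have z0: "z \<noteq> 0" using z d by auto
    have "to_ac d = z * w - z * z" using z by (simp add: algebra_simps add_eq_0_iff)
    then have zw: "z + to_ac d / z = w" using z0 by (simp add: field_simps)
    have "ac_eval (disc_poly d l m be) w = 0" using dv w by (elim dvdE) simp
    then have "z \<in> Root_quotients p q" using z0 zw Root_quotients_iff by simp
    moreover have "z \<in> Root (R_poly d r)" using z0 zw w by (simp add: Root_iff ac_eval_R_poly)
    ultimately show False using disj by blast
  qed
next
  assume "\<not> r dvd disc_poly d l m be"
  then obtain s t where st: "s * r + t * disc_poly d l m be = 1"
    using irreducible_comaximal[OF r] unfolding comaximal_def by blast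
  have "ac_eval r w \<noteq> 0 \<or> ac_eval (disc_poly d l m be) w \<noteq> 0" for w
  proof -
    have "ac_eval (s * r + t * disc_poly d l m be) w = 1" by (simp add: st)
    then show ?thesis by auto
  qed
  then show "Root (R_poly d r) \<inter> Root_quotients p q = {}"
    by (auto simp: Root_iff Root_quotients_iff ac_eval_R_poly)
qed

end

section \<open>Cayley-Hamilton and eigenvalues in the algebraic closure\<close>

context finite_dimensional_vector_space
begin

lemma represented_in_exists:
  assumes u: "Vector_Spaces.linear scale scale u"
  shows "\<exists>bs M. represented_in scale u bs M"
proof -
  obtain bs where bs: "set bs = Basis" "distinct bs" using finite_distinct_list[OF finite_Basis] by blast
  let ?n = "length bs"
  define M where "M = mat ?n ?n (\<lambda>(i, j). representation Basis (u (bs ! j)) (bs ! i))"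
  have "u (bs ! j) = (\<Sum>i < ?n. scale (M $$ (i, j)) (bs ! i))" if "j < ?n" for j
  proof -
    have "u (bs ! j) = (\<Sum>b\<in>Basis. scale (representation Basis (u (bs ! j)) b) b)"
      by (rule sum_representation_eq[symmetric])
        (use independent_Basis span_Basis finite_Basis in auto)
    also have "\<dots> = (\<Sum>i < ?n. scale (representation Basis (u (bs ! j)) (bs ! i)) (bs ! i))"
      using bs by (intro sum.reindex_bij_betw[symmetric]) (simp add: bij_betw_nth)
    finally show ?thesis using that by (simp add: M_def)
  qed
  moreover have "is_basis scale bs" using bs independent_Basis span_Basis by (simp add: is_basis_def)
  ultimately show ?thesis
    by (intro exI[of _ bs] exI[of _ M]) (simp add: represented_in_def M_def)
qed

text \<open>The columns of \<open>t - M\<close>, evaluated at \<open>u\<close>, are linear relations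
  between the basis vectors; multiplication by the adjugate turns them into the determinant killing
  each basis vector.\<close>

lemma char_poly_annihilates:
  assumes u: "Vector_Spaces.linear scale scale u" and rep: "represented_in scale u bs M"
  shows "poly_endo scale (char_poly M) u x = 0"
proof -
  interpret pm: Modules.module "\<lambda>g. poly_endo scale g u"
    by unfold_locales (simp_all add: poly_endo_add poly_endo_mult[OF u] poly_endo_right_add[OF u])
  let ?n = "length bs" and ?C = "char_poly_matrix M"
  have M: "M \<in> carrier_mat ?n ?n" using rep by (simp add: represented_in_def)
  have C: "?C \<in> carrier_mat ?n ?n" using M by simp
  have ann: "(\<Sum>i<?n. poly_endo scale (?C $$ (i, j)) u (bs ! i)) = 0" if j: "j < ?n" for j
  proof -
    have "(\<Sum>i<?n. poly_endo scale (?C $$ (i, j)) u (bs ! i)) =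
        (\<Sum>i<?n. (if i = j then u (bs ! i) else 0) - scale (M $$ (i, j)) (bs ! i))"
    proof (rule sum.cong)
      fix i assume "i \<in> {..<?n}"
      then have "?C $$ (i, j) = (if i = j then [:0, 1:] else 0) + [:- (M $$ (i, j)):]"
        using M j by (simp add: char_poly_matrix_def)
      then show "poly_endo scale (?C $$ (i, j)) u (bs ! i) =
          (if i = j then u (bs ! i) else 0) - scale (M $$ (i, j)) (bs ! i)"
        by (simp only: poly_endo_add poly_endo_const) (simp add: poly_endo_monom_X)
    qed simp
    also have "\<dots> = u (bs ! j) - (\<Sum>i<?n. scale (M $$ (i, j)) (bs ! i))"
      using j by (simp add: sum_subtractf)
    finally show ?thesis using rep j by (simp add: represented_in_def)
  qed
  have basis: "poly_endo scale (char_poly M) u (bs ! k) = 0" if k: "k < ?n" for k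
  proof -
    let ?A = "adj_mat ?C"
    have A: "?A \<in> carrier_mat ?n ?n" using adj_mat(1)[OF C] .
    have CA: "(\<Sum>j<?n. ?C $$ (i, j) * ?A $$ (j, k)) = (if i = k then char_poly M else 0)" if i: "i < ?n" for i
    proof -
      have "(?C * ?A) $$ (i, k) = (\<Sum>j<?n. ?C $$ (i, j) * ?A $$ (j, k))"
        using C A i k by (simp add: scalar_prod_def lessThan_atLeast0)
      moreover have "(?C * ?A) $$ (i, k) = (if i = k then char_poly M else 0)"
        using adj_mat(2)[OF C] i k by (simp add: char_poly_def)
      ultimately show ?thesis by simp
    qed
    have "poly_endo scale (char_poly M) u (bs ! k) =
        (\<Sum>i<?n. poly_endo scale (if i = k then char_poly M else 0) u (bs ! i))"
      using k by (simp add: if_distrib[of "\<lambda>g. poly_endo scale g u _"] cong: if_cong)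
    also have "\<dots> = (\<Sum>i<?n. poly_endo scale (\<Sum>j<?n. ?C $$ (i, j) * ?A $$ (j, k)) u (bs ! i))"
      by (intro sum.cong refl) (simp add: CA)
    also have "\<dots> = (\<Sum>i<?n. \<Sum>j<?n. poly_endo scale (?A $$ (j, k)) u (poly_endo scale (?C $$ (i, j)) u (bs ! i)))"
      by (simp add: pm.scale_sum_left mult.commute)
    also have "\<dots> = (\<Sum>j<?n. \<Sum>i<?n. poly_endo scale (?A $$ (j, k)) u (poly_endo scale (?C $$ (i, j)) u (bs ! i)))"
      by (rule sum.swap)
    also have "\<dots> = (\<Sum>j<?n. poly_endo scale (?A $$ (j, k)) u (\<Sum>i<?n. poly_endo scale (?C $$ (i, j)) u (bs ! i)))"
      by (simp only: pm.scale_sum_right)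
    also have "\<dots> = 0" by (simp add: ann)
    finally show ?thesis .
  qed
  have "x \<in> span (set bs)" using rep by (simp add: represented_in_def is_basis_def)
  then show ?thesis
  proof (induction rule: span_induct_alt)
    case (step c b y)
    then have "poly_endo scale (char_poly M) u b = 0" using basis by (metis in_set_conv_nth)
    then show ?case
      using step by (simp add: poly_endo_right_add[OF u] poly_endo_right_scale[OF u])
  qed simp
qed

text \<open>A common divisor of \<open>g\<close> and the characteristic polynomial in Bezout form
  still kills \<open>x \<noteq> 0\<close>, so it is not constant and has a root in the
  closure.\<close>

lemma annihilator_root_eigenvalue:
  assumes u: "Vector_Spaces.linear scale scale u" and g: "poly_endo scale g u x = 0" "x \<noteq> 0"
  shows "\<exists>z. ac_eval g z = 0 \<and> eigenvalue_ac scale u z"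
proof -
  obtain bs M where rep: "represented_in scale u bs M" using represented_in_exists[OF u] by blast
  then have M: "M \<in> carrier_mat (length bs) (length bs)" by (simp add: represented_in_def)
  obtain h s t where h: "h dvd char_poly M" "h dvd g" "s * char_poly M + t * g = h"
    using poly_bezout by blast
  have c0: "char_poly M \<noteq> 0" using degree_monic_char_poly[OF M] by auto
  have hx: "poly_endo scale h u x = 0"
    using poly_endo_right_scale[OF u, of s 0 0] poly_endo_right_scale[OF u, of t 0 0]
    by (simp add: poly_endo_add poly_endo_mult[OF u] char_poly_annihilates[OF u rep] g flip: h(3))
  have "degree h > 0"
  proof (rule ccontr)
    assume "\<not> degree h > 0"
    then obtain c where c: "h = [:c:]" by (metis degree_eq_zeroE gr0I)
    then have "c = 0" using hx g(2) by simp
    then show False using h(1) c0 c by simp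
  qed
  then obtain z where z: "ac_eval h z = 0" using ac_eval_root_exists by blast
  have "ac_eval g z = 0" "ac_eval (char_poly M) z = 0" using h(1,2) z by (auto elim!: dvdE)
  moreover have "eigenvalue (map_mat to_ac M) z \<longleftrightarrow> ac_eval (char_poly M) z = 0"
  proof -
    interpret to_ac: comm_ring_hom "to_ac :: 'a \<Rightarrow> 'a alg_closure" by unfold_locales simp_all
    have "map_mat to_ac M \<in> carrier_mat (length bs) (length bs)" using M by simp
    from eigenvalue_root_char_poly[OF this] show ?thesis
      by (simp add: to_ac.char_poly_hom[OF M] ac_eval_def)
  qed
  ultimately show ?thesis using rep unfolding eigenvalue_ac_def by blast
qed

end

text \<open>Injectivity of the discriminant evaluated at \<open>v\<close> is the form in which
  regularity enters all later arguments. A nonzero vector in the kernel would be killed by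
  \<open>R_\<delta>\<close> of the discriminant in \<open>u\<close>, which gives an eigenvalue of
  \<open>u\<close> that is a root quotient.\<close>

lemma (in quadratic_over) q_regular_disc_injective:
  assumes p: "p = [:be * \<delta>, - l, 1:]" and q: "q = [:be, - m, 1:]" and be: "be \<noteq> 0"
    and reg: "q_regular scale p q u" and x: "disc_poly \<delta> l m be \<star> x = 0"
  shows "x = 0"
proof (rule ccontr)
  assume "x \<noteq> 0"
  moreover have "poly_endo scale (R_poly \<delta> (disc_poly \<delta> l m be)) u x = 0"
    using x by (simp add: poly_endo_R_poly_eq_0)
  ultimately obtain z where z: "ac_eval (R_poly \<delta> (disc_poly \<delta> l m be)) z = 0" "eigenvalue_ac scale u z"
    using annihilator_root_eigenvalue[OF linear_u] by blast
  have "z \<noteq> 0"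
  proof
    assume "z = 0"
    then have "to_ac (poly.coeff (R_poly \<delta> (disc_poly \<delta> l m be)) 0) = 0"
      using z(1) by (simp add: ac_eval_def poly_0_coeff_0 coeff_map_poly)
    then show False using R_poly_coeff_0[of \<delta> "disc_poly \<delta> l m be"] be delta_nz
      by (simp add: disc_poly_eq)
  qed
  then have "z \<in> Root_quotients p q"
    using z(1) Root_quotients_iff[OF p q be delta_nz] by (simp add: ac_eval_R_poly)
  then show False using reg z(2) by (auto simp: q_regular_def)
qed

section \<open>Splitting off submodules\<close>

context finite_dimensional_vector_space
begin

definition functional :: "('b \<Rightarrow> 'a) \<Rightarrow> bool" where
  "functional \<phi> \<longleftrightarrow> (\<forall>x y. \<phi> (x + y) = \<phi> x + \<phi> y) \<and> (\<forall>c x. \<phi> (scale c x) = c * \<phi> x)"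

lemma functional_add: "functional \<phi> \<Longrightarrow> \<phi> (x + y) = \<phi> x + \<phi> y"
  by (simp add: functional_def)

lemma functional_scale: "functional \<phi> \<Longrightarrow> \<phi> (scale c x) = c * \<phi> x"
  by (simp add: functional_def)

lemma functional_0: "functional \<phi> \<Longrightarrow> \<phi> 0 = 0"
  using functional_scale[of \<phi> 0 0] by simp

lemma functional_diff: "functional \<phi> \<Longrightarrow> \<phi> (x - y) = \<phi> x - \<phi> y"
  using functional_add[of \<phi> "x - y" y] by simp

lemma functional_comp:
  assumes "functional \<phi>" "Vector_Spaces.linear scale scale f"
  shows "functional (\<lambda>x. \<phi> (f x))"
proof -
  interpret f: Vector_Spaces.linear scale scale f by fact
  show ?thesis using assms(1) by (simp add: functional_def f.add f.scale)
qed

lemma functional_exists: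
  assumes "x \<noteq> 0"
  shows "\<exists>\<phi>. functional \<phi> \<and> \<phi> x \<noteq> 0"
proof -
  have ix: "independent {x}" using assms by simp
  let ?B = "extend_basis {x}"
  have B: "independent ?B" "span ?B = UNIV" "x \<in> ?B"
    using extend_basis_superset[OF ix] independent_extend_basis[OF ix] span_extend_basis[OF ix] by auto
  have "functional (\<lambda>y. representation ?B y x)"
    using B by (simp add: functional_def representation_add representation_scale)
  moreover have "representation ?B x x = 1" using representation_basis[OF B(1,3)] by simp
  ultimately show ?thesis by (intro exI[of _ "\<lambda>y. representation ?B y x"]) simp
qed

lemma subspace_functional_kernel:
  assumes "subspace T" "\<And>i. i \<in> I \<Longrightarrow> functional (\<phi> i)"
  shows "subspace {s \<in> T. \<forall>i\<in>I. \<phi> i s = 0}"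
  using assms by (auto simp: subspace_def functional_0 functional_add functional_scale)

lemma dim_functional_kernel:
  assumes "finite I" "subspace T" "\<And>i. i \<in> I \<Longrightarrow> functional (\<phi> i)"
  shows "dim T \<le> dim {s \<in> T. \<forall>i\<in>I. \<phi> i s = 0} + card I"
  using assms(1,3)
proof (induction I rule: finite_induct)
  case (insert i I)
  let ?T = "{s \<in> T. \<forall>i\<in>I. \<phi> i s = 0}" and ?Z = "{s \<in> T. \<forall>i\<in>insert i I. \<phi> i s = 0}"
  have T: "subspace ?T" using subspace_functional_kernel[OF assms(2)] insert.prems by blast
  have \<phi>: "functional (\<phi> i)" using insert.prems by blast
  have "dim ?T \<le> dim ?Z + 1"
  proof (cases "\<exists>t\<in>?T. \<phi> i t \<noteq> 0")
    case True
    then obtain t where t: "t \<in> ?T" "\<phi> i t \<noteq> 0" by blast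
    have "s \<in> span (insert t ?Z)" if s: "s \<in> ?T" for s
    proof -
      let ?c = "\<phi> i s / \<phi> i t"
      have "s - scale ?c t \<in> ?T" using T s t(1) by (intro subspace_diff subspace_scale)
      moreover have "\<phi> i (s - scale ?c t) = 0"
        using t(2) by (simp add: functional_diff[OF \<phi>] functional_scale[OF \<phi>])
      ultimately have "s - scale ?c t \<in> ?Z" by simp
      then have "scale ?c t + (s - scale ?c t) \<in> span (insert t ?Z)"
        by (intro span_add span_scale span_base) auto
      then show ?thesis by simp
    qed
    then have "dim ?T \<le> dim (insert t ?Z)" by (intro dim_mono) blast
    also have "\<dots> \<le> dim ?Z + 1" by (simp add: dim_insert)
    finally show ?thesis .
  next
    case False
    then have "?T = ?Z" by auto
    then show ?thesis by simp
  qed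
  then show ?case using insert by simp
qed simp

text \<open>The hypothesis \<open>ind\<close> says that the \<open>e i\<close> are independent
  modulo \<open>Y\<close>. Since \<open>Y\<close> is cut out by only \<open>card I\<close>
  functionals, the dimension count leaves no room: \<open>S\<close> is the direct sum of their span
  and \<open>Y\<close>.\<close>

lemma functional_split:
  assumes "finite I" "subspace S" "\<And>i. i \<in> I \<Longrightarrow> functional (\<phi> i)" "\<And>i. i \<in> I \<Longrightarrow> e i \<in> S"
  defines "Y \<equiv> {s \<in> S. \<forall>i\<in>I. \<phi> i s = 0}"
  assumes ind: "\<And>c. (\<Sum>i\<in>I. scale (c i) (e i)) \<in> Y \<Longrightarrow> \<forall>i\<in>I. c i = 0"
  shows "dim S = card I + dim Y"
    and "s \<in> S \<Longrightarrow> \<exists>c. s - (\<Sum>i\<in>I. scale (c i) (e i)) \<in> Y"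
proof -
  have Y: "subspace Y" unfolding Y_def using subspace_functional_kernel assms(2,3) by blast
  let ?X = "span (e ` I)"
  have inj: "inj_on e I"
  proof (rule inj_onI, rule ccontr)
    fix i j assume ij: "i \<in> I" "j \<in> I" "e i = e j" "i \<noteq> j"
    let ?c = "\<lambda>k. if k = i then 1 else if k = j then - 1 else 0 :: 'a"
    have "(\<Sum>k\<in>I. scale (?c k) (e k)) = (\<Sum>k\<in>I. (if k = i then e k else 0) + (if k = j then - e k else 0))"
      using ij(4) by (intro sum.cong) auto
    also have "\<dots> = 0" using ij assms(1) by (simp add: sum.distrib)
    finally have "(\<Sum>k\<in>I. scale (?c k) (e k)) \<in> Y" using subspace_0[OF Y] by simp
    then have "\<forall>k\<in>I. ?c k = 0" by (rule ind)
    then have "?c i = 0" using ij(1) by (rule bspec)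
    then show False by simp
  qed
  have comb: "\<exists>c. x = (\<Sum>i\<in>I. scale (c i) (e i))" if "x \<in> ?X" for x
  proof -
    have "finite (e ` I)" using assms(1) by simp
    from span_finite[OF this] that obtain a where "x = (\<Sum>v\<in>e ` I. scale (a v) v)" by auto
    then show ?thesis using inj by (intro exI[of _ "\<lambda>i. a (e i)"]) (simp add: sum.reindex)
  qed
  have "independent (e ` I)"
  proof -
    have "\<forall>v\<in>e ` I. a v = 0" if "(\<Sum>v\<in>e ` I. scale (a v) v) = 0" for a
      using ind[of "\<lambda>i. a (e i)"] that inj Y by (auto simp: sum.reindex subspace_0)
    then show ?thesis using assms(1) by (auto simp: dependent_finite)
  qed
  then have dX: "dim ?X = card I" using inj by (simp add: dim_eq_card_independent card_image)
  have XY: "?X \<inter> Y = {0}"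
  proof -
    have "x = 0" if x: "x \<in> ?X" "x \<in> Y" for x
    proof -
      obtain c where c: "x = (\<Sum>i\<in>I. scale (c i) (e i))" using comb[OF x(1)] by blast
      then have "\<forall>i\<in>I. c i = 0" using ind[of c] x(2) by simp
      then show ?thesis using c by simp
    qed
    then show ?thesis using Y by (auto simp: subspace_0 span_zero)
  qed
  let ?W = "{x + y |x y. x \<in> ?X \<and> y \<in> Y}"
  have XS: "?X \<subseteq> S" using assms(2,4) by (intro span_minimal) auto
  have WS: "?W \<subseteq> S" using XS subspace_add[OF assms(2)] by (auto simp: Y_def)
  have dW: "dim ?W = card I + dim Y"
    using dim_sums_Int[OF subspace_span[of "e ` I"] Y] XY dX by simp
  have dS: "dim S \<le> dim Y + card I"
    unfolding Y_def by (rule dim_functional_kernel) (use assms in auto)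
  have "subspace ?W" using Y by (intro subspace_sums) auto
  then have eq: "?W = S" using subspace_dim_equal[of ?W S] assms(2) WS dW dS by simp
  show "dim S = card I + dim Y" using dW eq by simp
  assume "s \<in> S"
  then obtain x y where xy: "s = x + y" "x \<in> ?X" "y \<in> Y" using eq by blast
  obtain c where "x = (\<Sum>i\<in>I. scale (c i) (e i))" using comb[OF xy(2)] by blast
  then show "\<exists>c. s - (\<Sum>i\<in>I. scale (c i) (e i)) \<in> Y" using xy by (intro exI[of _ c]) simp
qed

end

section \<open>Dual splitting over the polynomials in \<open>v\<close>\<close>

context quadratic_over
begin

lemma act_monom: "monom a j \<star> x = scale a ([:0, 1:] ^ j \<star> x)"
proof -
  have "monom a j = smult a ([:0, 1:] ^ j)" by (simp add: monom_altdef)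
  then show ?thesis by (simp add: act_smult)
qed

lemma act_expand:
  assumes "degree g < D"
  shows "g \<star> x = (\<Sum>j<D. scale (poly.coeff g j) ([:0, 1:] ^ j \<star> x))"
proof -
  have "g = (\<Sum>j<D. monom (poly.coeff g j) j)"
    using assms by (intro poly_eqI) (auto simp: coeff_sum coeff_eq_0)
  then have "g \<star> x = (\<Sum>j<D. monom (poly.coeff g j) j) \<star> x" by simp
  also have "\<dots> = (\<Sum>j<D. scale (poly.coeff g j) ([:0, 1:] ^ j \<star> x))"
    by (simp add: act.scale_sum_left act_monom)
  finally show ?thesis .
qed

text \<open>Division of \<open>c\<close> by \<open>h\<close> leaves finitely many conditions to
  test, one for each power of \<open>v\<close> below \<open>degree h\<close>.\<close>

lemma functional_act_0:
  assumes "functional \<psi>" "h \<noteq> 0"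
    and "\<And>c. \<psi> (h \<star> (c \<star> s)) = 0" "\<And>j. j < degree h \<Longrightarrow> \<psi> ([:0, 1:] ^ j \<star> s) = 0"
  shows "\<psi> (c \<star> s) = 0"
proof -
  have sum: "\<psi> (\<Sum>j\<in>J. f j) = (\<Sum>j\<in>J. \<psi> (f j))" for f and J :: "nat set"
    by (induction J rule: infinite_finite_induct)
      (simp_all add: functional_0[OF assms(1)] functional_add[OF assms(1)])
  have rem: "\<psi> ((c mod h) \<star> s) = 0"
  proof (cases "c mod h = 0")
    case False
    then have "degree (c mod h) < degree h" using degree_mod_less[OF assms(2)] by blast
    from act_expand[OF this, of s] show ?thesis
      using assms(4) by (simp add: sum functional_scale[OF assms(1)])
  qed (simp add: functional_0[OF assms(1)])
  have "c \<star> s = h \<star> ((c div h) \<star> s) + (c mod h) \<star> s"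
    by (simp flip: act.scale_left_distrib)
  then show ?thesis using assms(3) rem by (simp add: functional_add[OF assms(1)])
qed

text \<open>\<open>functional_split\<close> over \<open>F[t]/(h)\<close>: each functional and each
  generator is expanded into its translates under \<open>v^j\<close>, \<open>j < degree h\<close>.
  The hypothesis \<open>ind\<close> is nondegeneracy modulo \<open>h\<close> of the pairing between
  the \<open>\<psi> k\<close> and the \<open>x k\<close>.\<close>

lemma module_split:
  assumes K: "finite K" and S: "u_stable S" and h: "monic h"
    and \<psi>: "\<And>k. k \<in> K \<Longrightarrow> functional (\<psi> k)" and x: "\<And>k. k \<in> K \<Longrightarrow> x k \<in> S"
    and h\<psi>: "\<And>k s. k \<in> K \<Longrightarrow> s \<in> S \<Longrightarrow> \<psi> k (h \<star> s) = 0"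
    and ind: "\<And>C. (\<And>k c. k \<in> K \<Longrightarrow> \<psi> k (c \<star> (\<Sum>i\<in>K. C i \<star> x i)) = 0) \<Longrightarrow> \<forall>k\<in>K. h dvd C k"
  defines "Y \<equiv> {s \<in> S. \<forall>k\<in>K. \<forall>c. \<psi> k (c \<star> s) = 0}"
  shows "dim S = card K * degree h + dim Y" "subspace Y"
    and "s \<in> S \<Longrightarrow> \<exists>C. s - (\<Sum>i\<in>K. C i \<star> x i) \<in> Y"
proof -
  let ?I = "K \<times> {..<degree h}"
  define \<phi> where "\<phi> = (\<lambda>(k, j) s. \<psi> k ([:0, 1:] ^ j \<star> s))"
  define e where "e = (\<lambda>(k, j). [:0, 1:] ^ j \<star> x k)"
  have Ss: "subspace S" using S by (simp add: u_stable_def)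
  have h0: "h \<noteq> 0" using h by auto
  have \<phi>: "functional (\<phi> i)" if "i \<in> ?I" for i
    using that \<psi> functional_comp[OF _ linear_act] by (auto simp: \<phi>_def)
  have Y: "Y = {s \<in> S. \<forall>i\<in>?I. \<phi> i s = 0}"
  proof -
    have "\<psi> k (c \<star> s) = 0"
      if "s \<in> S" "k \<in> K" "\<And>j. j < degree h \<Longrightarrow> \<psi> k ([:0, 1:] ^ j \<star> s) = 0" for s k c
      using functional_act_0[OF \<psi>[OF that(2)] h0 _ that(3)] h\<psi>[OF that(2)] u_stable_act[OF S that(1)]
      by blast
    then show ?thesis by (auto simp: Y_def \<phi>_def)
  qed
  have comb: "(\<Sum>i\<in>?I. scale (c i) (e i)) = (\<Sum>k\<in>K. (\<Sum>j<degree h. monom (c (k, j)) j) \<star> x k)" for c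
    by (simp add: e_def act.scale_sum_left act_monom sum.cartesian_product case_prod_unfold)
  have fin: "finite ?I" using K by simp
  have eS: "e i \<in> S" if "i \<in> ?I" for i
    using that x u_stable_act[OF S] by (auto simp: e_def)
  have indI: "\<forall>i\<in>?I. c i = 0" if "(\<Sum>i\<in>?I. scale (c i) (e i)) \<in> {s \<in> S. \<forall>i\<in>?I. \<phi> i s = 0}" for c
  proof -
    define C where "C k = (\<Sum>j<degree h. monom (c (k, j)) j)" for k
    have co: "poly.coeff (C k) j = (if j < degree h then c (k, j) else 0)" for k j
      by (simp add: C_def coeff_sum)
    have "\<psi> k (d \<star> (\<Sum>i\<in>K. C i \<star> x i)) = 0" if "k \<in> K" for k d
      using \<open>_ \<in> {s \<in> S. \<forall>i\<in>?I. \<phi> i s = 0}\<close> that unfolding Y[symmetric] comb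
      by (simp add: Y_def C_def)
    then have dv: "\<forall>k\<in>K. h dvd C k" by (rule ind)
    have "c (k, j) = 0" if "k \<in> K" "j < degree h" for k j
    proof -
      have "degree (C k) < degree h"
        using that(2) by (intro degree_lessI) (auto simp: co)
      then have "C k = 0" using dv that(1) by (meson dvd_imp_degree_le not_le)
      then show ?thesis using co[of k j] that(2) by simp
    qed
    then show ?thesis by auto
  qed
  note split = functional_split[where I = ?I and S = S and \<phi> = \<phi> and e = e, OF fin Ss \<phi> eS indI, folded Y]
  show "dim S = card K * degree h + dim Y" using split(1) by (simp add: card_cartesian_product)
  show "subspace Y" unfolding Y using subspace_functional_kernel[OF Ss] \<phi> by blast
  assume "s \<in> S"
  from split(2)[OF _ _ _ this] obtain c where "s - (\<Sum>i\<in>?I. scale (c i) (e i)) \<in> Y" by blast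
  then show "\<exists>C. s - (\<Sum>i\<in>K. C i \<star> x i) \<in> Y" unfolding comb
    by (intro exI[of _ "\<lambda>k. \<Sum>j<degree h. monom (c (k, j)) j"])
qed

text \<open>The vector \<open>r^(N-1) \<star> y\<close> generates the smallest nonzero submodule of
  \<open>F[t] y\<close>. If \<open>g = r^k h\<close> with \<open>k < N\<close>, then
  \<open>r^(N-1-k)\<close> times an inverse of \<open>h\<close> modulo \<open>r\<close> carries
  \<open>g \<star> y\<close> to that vector, where \<open>\<phi>\<close> does not vanish.\<close>

lemma functional_detects:
  assumes r: "irreducible r" and N: "N \<ge> 1" and y: "r ^ N \<star> y = 0" "\<phi> (r ^ (N - 1) \<star> y) \<noteq> 0"
    and z: "\<And>c. \<phi> ((c * g) \<star> y) = 0"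
  shows "r ^ N dvd g"
proof (cases "g = 0")
  case False
  then obtain k h where g: "g = r ^ k * h" "\<not> r dvd h" using irreducible_decomp[OF _ r] by blast
  show ?thesis
  proof (cases "N \<le> k")
    case True
    then show ?thesis using g by (simp add: le_imp_power_dvd)
  next
    case kN: False
    obtain s t where st: "s * r + t * h = 1"
      using irreducible_comaximal[OF r g(2)] unfolding comaximal_def by blast
    define c where "c = r ^ (N - 1 - k) * t"
    have pw: "r ^ (N - 1 - k) * r ^ k = r ^ (N - 1)" "r ^ (N - 1) * r = r ^ N"
      using kN N by (simp_all flip: power_add power_Suc2)
    have "c * g = (r ^ (N - 1 - k) * r ^ k) * (t * h)" by (simp add: c_def g(1) algebra_simps)
    also have "t * h = 1 - s * r" using st by (metis add_diff_cancel_left')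
    also have "r ^ (N - 1 - k) * r ^ k * (1 - s * r) = r ^ (N - 1) - s * (r ^ (N - 1) * r)"
      unfolding pw(1) by (simp add: algebra_simps)
    finally have "(c * g) \<star> y = r ^ (N - 1) \<star> y - s \<star> (r ^ N \<star> y)"
      unfolding pw(2) by (simp add: act.scale_left_diff_distrib)
    then have "(c * g) \<star> y = r ^ (N - 1) \<star> y" using y(1) by simp
    then show ?thesis using z[of c] y(2) by simp
  qed
qed simp

end

section \<open>Modules over the quaternion algebra\<close>

text \<open>With \<open>t\<close> acting as \<open>v\<close>, these are the relations between
  \<open>u\<close> and \<open>B\<close> in the quaternion algebra. The map \<open>b_u'\<close> looks
  unsymmetric but only says that \<open>uB\<close> has trace \<open>l\<close>:
  \<open>uB + (m - B) (t - u) = l\<close>, where \<open>m - B\<close> and \<open>t - u\<close> are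
  the conjugates.\<close>

locale quat_module = quadratic_over scale Basis u v \<delta>
  for scale :: "'a::field \<Rightarrow> 'v::ab_group_add \<Rightarrow> 'v" and Basis u v \<delta> +
  fixes b :: "'v \<Rightarrow> 'v" and l m be :: 'a
  assumes linear_b: "Vector_Spaces.linear scale scale b"
    and b_v: "b (v x) = v (b x)"
    and b_b': "b (b x) = scale m (b x) - scale be x"
    and b_u': "b (u x) = scale l x - scale m (v x) + scale m (u x) + v (b x) - u (b x)"
    and be_nz: "be \<noteq> 0"
begin

sublocale b: Vector_Spaces.linear scale scale b by (rule linear_b)

abbreviation "T \<equiv> [:0, 1:] :: 'a poly"
abbreviation "dd \<equiv> [:\<delta>:]"
abbreviation "ll \<equiv> [:l:]"
abbreviation "mm \<equiv> [:m:]"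
abbreviation "bb \<equiv> [:be:]"
abbreviation "disc \<equiv> disc_poly \<delta> l m be"

lemma b_act: "b (g \<star> x) = g \<star> b x"
  by (rule act_commute[OF linear_b]) (simp add: b_v)

lemma b_b: "b (b x) = mm \<star> b x - bb \<star> x"
  by (simp add: b_b' act_const)

lemma b_u: "b (u x) = (ll - mm * T) \<star> x + mm \<star> u x + T \<star> b x - u (b x)"
  by (simp only: b_u' act_const act_X act.scale_left_diff_distrib act.scale_scale[symmetric])

definition quat_act :: "'a poly \<Rightarrow> 'a poly \<Rightarrow> 'a poly \<Rightarrow> 'a poly \<Rightarrow> 'v \<Rightarrow> 'v" where
  "quat_act a0 a1 a2 a3 x = a0 \<star> x + a1 \<star> u x + a2 \<star> b x + a3 \<star> u (b x)"

lemma quat_act_add: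
  "quat_act a0 a1 a2 a3 x + quat_act c0 c1 c2 c3 x = quat_act (a0 + c0) (a1 + c1) (a2 + c2) (a3 + c3) x"
  by (simp add: quat_act_def act.scale_left_distrib)

lemma act_quat_act: "c \<star> quat_act a0 a1 a2 a3 x = quat_act (c * a0) (c * a1) (c * a2) (c * a3) x"
  by (simp add: quat_act_def act.scale_right_distrib)

text \<open>Left multiplication by \<open>u\<close>, and next by \<open>B\<close>, in the basis
  \<open>1, u, B, uB\<close>. Together they reduce every identity in the algebra to a comparison of
  four polynomial coefficients.\<close>

lemma u_quat_act:
  "u (quat_act a0 a1 a2 a3 x) = quat_act (- (dd * a1)) (a0 + T * a1) (- (dd * a3)) (a2 + T * a3) x"
  unfolding quat_act_def u.add u_act u_u
  by (simp add: act.scale_left_distrib act.scale_right_diff_distrib act.scale_minus_left mult.commute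
      del: mult_pCons_left mult_pCons_right minus_pCons add_pCons diff_pCons)

lemma b_quat_act:
  "b (quat_act a0 a1 a2 a3 x) = quat_act (a1 * (ll - mm * T) - a2 * bb - a3 * bb * T)
     (a1 * mm + a3 * bb) (a0 + a1 * T + a2 * mm + a3 * ll) (- a1) x"
proof -
  have "b (u (b x)) = (ll - mm * T) \<star> b x + mm \<star> u (b x) + T \<star> (mm \<star> b x - bb \<star> x)
      - (mm \<star> u (b x) - bb \<star> u x)"
    unfolding b_u[of "b x"] b_b u.diff u_act ..
  also have "\<dots> = ll \<star> b x - (bb * T) \<star> x + bb \<star> u x"
    by (simp add: act.scale_left_diff_distrib act.scale_right_diff_distrib mult.commute
      del: mult_pCons_left mult_pCons_right minus_pCons add_pCons diff_pCons)
  finally have bub: "b (u (b x)) = ll \<star> b x - (bb * T) \<star> x + bb \<star> u x" .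
  show ?thesis
    unfolding quat_act_def b.add b_act b_u[of x] b_b bub
    by (simp add: act.scale_left_distrib act.scale_left_diff_distrib act.scale_right_distrib
        act.scale_right_diff_distrib act.scale_minus_left mult.assoc
        right_diff_distrib del: mult_pCons_left mult_pCons_right minus_pCons add_pCons diff_pCons)
qed

lemma quat_act_diff:
  "quat_act a0 a1 a2 a3 x - quat_act c0 c1 c2 c3 x = quat_act (a0 - c0) (a1 - c1) (a2 - c2) (a3 - c3) x"
  by (simp add: quat_act_def act.scale_left_diff_distrib)

lemma quat_act_1: "g \<star> x = quat_act g 0 0 0 x"
  by (simp add: quat_act_def)

lemma quat_act_cong:
  "a0 = c0 \<Longrightarrow> a1 = c1 \<Longrightarrow> a2 = c2 \<Longrightarrow> a3 = c3 \<Longrightarrow> quat_act a0 a1 a2 a3 x = quat_act c0 c1 c2 c3 x"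
  by simp

text \<open>The outer element is the conjugate of the inner one, namely its trace minus itself; the
  traces of \<open>u\<close>, \<open>B\<close>, \<open>uB\<close> are \<open>T\<close>,
  \<open>mm\<close>, \<open>ll\<close>.\<close>

lemma quat_act_conj:
  "quat_act (a0 + T * a1 + mm * a2 + ll * a3) (- a1) (- a2) (- a3) (quat_act a0 a1 a2 a3 x) =
     quat_norm T dd ll mm bb a0 a1 a2 a3 \<star> x"
  unfolding quat_act_def[of "a0 + T * a1 + mm * a2 + ll * a3" "- a1" "- a2" "- a3" "quat_act a0 a1 a2 a3 x"]
    u_quat_act b_quat_act act_quat_act quat_act_add quat_act_1[of "quat_norm _ _ _ _ _ _ _ _ _"]
  by (rule quat_act_cong; simp add: quat_norm_def quad_norm_def algebra_simps power2_eq_square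
      del: mult_pCons_left mult_pCons_right minus_pCons add_pCons diff_pCons)

lemma quat_act_comp:
  "\<exists>e0 e1 e2 e3. \<forall>x. quat_act c0 c1 c2 c3 (quat_act a0 a1 a2 a3 x) = quat_act e0 e1 e2 e3 x"
proof -
  have "quat_act c0 c1 c2 c3 (quat_act a0 a1 a2 a3 x) = c0 \<star> quat_act a0 a1 a2 a3 x
      + c1 \<star> u (quat_act a0 a1 a2 a3 x) + c2 \<star> b (quat_act a0 a1 a2 a3 x)
      + c3 \<star> u (b (quat_act a0 a1 a2 a3 x))" for x
    by (simp only: quat_act_def[of c0 c1 c2 c3])
  then show ?thesis unfolding u_quat_act b_quat_act act_quat_act quat_act_add by blast
qed

lemma quat_act_act: "quat_act a0 a1 a2 a3 (c \<star> x) = c \<star> quat_act a0 a1 a2 a3 x"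
  by (simp add: quat_act_def u_act b_act act.scale_right_distrib mult.commute)

lemma linear_quat_act: "Vector_Spaces.linear scale scale (quat_act a0 a1 a2 a3)"
  by unfold_locales (simp_all add: quat_act_def act.scale_right_distrib act_scale u.add u.scale
      b.add b.scale scale_right_distrib)

text \<open>\<open>conic_op x z\<close> is the action of \<open>B - x - zu\<close>, an element of norm \<open>conic x z\<close>.\<close>

definition conic_op :: "'a poly \<Rightarrow> 'a poly \<Rightarrow> 'v \<Rightarrow> 'v" where
  "conic_op x z = quat_act (- x) (- z) 1 0"

abbreviation "Q \<equiv> conic T dd ll mm bb"

lemma b_conic_op: "b s = conic_op x z s + x \<star> s + z \<star> u s"
  by (simp add: conic_op_def quat_act_def)

text \<open>For \<open>w = B - x - zu\<close>, this lemma and the next are the cases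
  \<open>y = 1\<close> and \<open>y = u\<close> of \<open>w y w = tr(w y) w - N(w) conj(y)\<close>.
  In the second case, \<open>u^2\<close> has trace \<open>T^2 - 2 dd\<close>.\<close>

lemma conic_op_conic_op:
  "conic_op x z (conic_op x z s) = (mm - 2 * x - T * z) \<star> conic_op x z s - Q x z \<star> s"
  unfolding conic_op_def quat_act_def[of "- x" "- z" 1 0 "quat_act (- x) (- z) 1 0 s"]
    u_quat_act b_quat_act act_quat_act quat_act_add quat_act_diff quat_act_1[of "Q x z"]
  by (rule quat_act_cong; simp add: conic_def quad_norm_def algebra_simps power2_eq_square
      del: mult_pCons_left mult_pCons_right minus_pCons add_pCons diff_pCons)

lemma conic_op_u_conic_op:
  "conic_op x z (u (conic_op x z s)) =
     (ll - x * T - z * (T ^ 2 - 2 * dd)) \<star> conic_op x z s - Q x z \<star> (T \<star> s - u s)"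
proof -
  have e: "T \<star> s - u s = quat_act T (- 1) 0 0 s" by (simp add: quat_act_def)
  show ?thesis
    unfolding e conic_op_def u_quat_act quat_act_def[of "- x" "- z" 1 0 "quat_act _ _ _ _ s"]
      u_quat_act b_quat_act act_quat_act quat_act_add quat_act_diff
    by (rule quat_act_cong; simp add: conic_def quad_norm_def algebra_simps power2_eq_square
        del: mult_pCons_left mult_pCons_right minus_pCons add_pCons diff_pCons)
qed

text \<open>If \<open>B = x + zu\<close> on \<open>y\<close> and \<open>uy\<close>, then \<open>A\<close> and \<open>B\<close> commute there.\<close>

lemma conic_op_kernel:
  assumes "conic_op x z y = 0" "conic_op x z (u y) = 0" "Q x z \<star> y = 0"
  shows "disc \<star> y = 0"
proof -
  let ?gx = "2 * x + T * z - mm" and ?gz = "T * x + 2 * dd * z + ll - T * mm"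
  have b_y: "b y = x \<star> y + z \<star> u y" using b_conic_op[of y x z] assms(1) by simp
  have b_uy: "b (u y) = x \<star> u y + z \<star> u (u y)" using b_conic_op[of "u y" x z] assms(2) by simp
  \<comment> \<open>Two evaluations of \<open>b (u y)\<close>: directly as \<open>x + zu\<close>
    applied to \<open>u y\<close>, and by the commutation relation from \<open>b y\<close>. Their
    difference is a relation between \<open>y\<close> and \<open>u y\<close> whose coefficients are
    the partial derivatives of the conic.\<close>
  have lin: "?gz \<star> y = ?gx \<star> u y"
  proof -
    have "quat_act (- (dd * z)) (x + T * z) 0 0 y = b (u y)"
      unfolding b_uy u_u by (simp add: quat_act_def act.scale_left_distrib act.scale_right_diff_distrib
          act.scale_minus_left mult.commute del: mult_pCons_left mult_pCons_right minus_pCons add_pCons diff_pCons)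
    also have "\<dots> = quat_act (ll - mm * T) mm 0 0 y + T \<star> quat_act x z 0 0 y - u (quat_act x z 0 0 y)"
      unfolding b_u b_y by (simp add: quat_act_def)
    also have "\<dots> = quat_act (ll - mm * T + T * x + dd * z) (mm + T * z - (x + T * z)) 0 0 y"
      unfolding u_quat_act act_quat_act quat_act_add quat_act_diff by simp
    finally have "quat_act (ll - mm * T + T * x + dd * z) (mm + T * z - (x + T * z)) 0 0 y
        - quat_act (- (dd * z)) (x + T * z) 0 0 y = 0" by simp
    moreover have "quat_act (ll - mm * T + T * x + dd * z) (mm + T * z - (x + T * z)) 0 0 y
        - quat_act (- (dd * z)) (x + T * z) 0 0 y = quat_act ?gz (- ?gx) 0 0 y"
      unfolding quat_act_diff
      by (rule quat_act_cong; simp add: algebra_simps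
          del: mult_pCons_left mult_pCons_right minus_pCons add_pCons diff_pCons)
    ultimately have "quat_act ?gz (- ?gx) 0 0 y = 0" by simp
    then show ?thesis
      by (simp only: quat_act_def act.scale_minus_left act.scale_zero_left add_0_right
          add_uminus_conv_diff right_minus_eq)
  qed
  have "(?gz ^ 2) \<star> y = (?gx ^ 2) \<star> u (u y)"
  proof -
    have "(?gz ^ 2) \<star> y = ?gz \<star> (?gx \<star> u y)" using lin by (simp add: power2_eq_square flip: act.scale_scale)
    also have "\<dots> = ?gx \<star> u (?gz \<star> y)" by (simp add: u_act mult.commute)
    also have "\<dots> = (?gx ^ 2) \<star> u (u y)" unfolding lin by (simp add: u_act power2_eq_square)
    finally show ?thesis .
  qed
  moreover have "(- T * ?gz * ?gx) \<star> y = - ((T * ?gx ^ 2) \<star> u y)"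
  proof -
    have "- T * f * h = - (T * h) * f" for f h
      by (simp add: mult_ac del: mult_pCons_left mult_pCons_right minus_pCons)
    then have "(- T * ?gz * ?gx) \<star> y = (- (T * ?gx)) \<star> (?gz \<star> y)"
      by (simp only: act.scale_scale)
    then show ?thesis unfolding lin
      by (simp add: act.scale_minus_left power2_eq_square mult.assoc del: mult_pCons_left mult_pCons_right minus_pCons add_pCons diff_pCons)
  qed
  ultimately have "quad_norm (- T) dd ?gz ?gx \<star> y =
      (?gx ^ 2) \<star> (T \<star> u y - dd \<star> y) - (T * ?gx ^ 2) \<star> u y + (dd * ?gx ^ 2) \<star> y"
    unfolding quad_norm_def u_u[symmetric] act.scale_left_distrib by simp
  also have "\<dots> = 0"
    by (simp add: act.scale_right_diff_distrib mult.commute del: mult_pCons_left mult_pCons_right minus_pCons add_pCons diff_pCons)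
  finally have "(quad_norm (- T) dd ?gz ?gx + (T ^ 2 - 4 * dd) * Q x z) \<star> y = 0"
    using assms(3) by (simp only: act.scale_left_distrib act.scale_scale[symmetric]) simp
  then show ?thesis unfolding disc_poly_def conic_disc_gradient[of T dd ll mm bb x z] .
qed

end

text \<open>The blocks of condition (iii) seen from \<open>v\<close>, with \<open>r^n\<close>
  standing for \<open>R_\<delta>(r^n)\<close>. The predicate \<open>good\<close> stays open because
  it is \<open>split_irr\<close> on the side of the algebra and \<open>has_type1\<close> in the
  theorem.\<close>

inductive block_multiset :: "('a::field poly \<Rightarrow> bool) \<Rightarrow> 'a poly multiset \<Rightarrow> bool" for good where
  empty: "block_multiset good {#}"
| single: "good r \<Longrightarrow> n \<ge> 1 \<Longrightarrow> block_multiset good F \<Longrightarrow> block_multiset good (add_mset (r ^ n) F)"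
| double: "irreducible r \<Longrightarrow> monic r \<Longrightarrow> n \<ge> 1 \<Longrightarrow> block_multiset good F \<Longrightarrow>
    block_multiset good (add_mset (r ^ n) (add_mset (r ^ n) F))"

section \<open>Splitting off a block or a double block of maximal order\<close>

context quat_module
begin

definition stable :: "'v set \<Rightarrow> bool" where
  "stable S \<longleftrightarrow> u_stable S \<and> b ` S \<subseteq> S"

lemma stable_quat_act:
  assumes "stable S" "x \<in> S"
  shows "quat_act a0 a1 a2 a3 x \<in> S"
proof -
  have S: "u_stable S" "subspace S" "\<And>y. y \<in> S \<Longrightarrow> u y \<in> S" "\<And>y. y \<in> S \<Longrightarrow> b y \<in> S"
    using assms(1) by (auto simp: stable_def u_stable_def)
  show ?thesis
    unfolding quat_act_def by (intro subspace_add[OF S(2)] u_stable_act[OF S(1)] S(3,4) assms(2))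
qed

text \<open>In the following context \<open>r\<^sup>Ng\<close> is the minimal polynomial of \<open>v\<close> on \<open>S\<close>, with \<open>r\<close> irreducible not dividing \<open>g\<close>.\<close>

context
  fixes S :: "'v set" and r g :: "'a poly" and N :: nat
  assumes S: "stable S" and r: "irreducible r" "monic r" and N: "N \<ge> 1"
    and g: "\<not> r dvd g" and kill: "\<And>s. s \<in> S \<Longrightarrow> (r ^ N * g) \<star> s = 0"
    and minimal: "\<exists>s\<in>S. (r ^ (N - 1) * g) \<star> s \<noteq> 0"
    and disc: "\<And>x. disc \<star> x = 0 \<Longrightarrow> x = 0"
begin

lemma uS: "u_stable S" and subS: "subspace S"
  using S by (simp_all add: stable_def u_stable_def)

lemma S_closed: "x \<in> S \<Longrightarrow> u x \<in> S" "x \<in> S \<Longrightarrow> b x \<in> S" "x \<in> S \<Longrightarrow> c \<star> x \<in> S"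
  using S uS u_stable_act[OF uS] by (auto simp: stable_def u_stable_def)

lemma power_split: "r ^ N = r * r ^ (N - 1)"
  using N by (cases N) auto

text \<open>By minimality \<open>r\<close> kills a nonzero vector of \<open>S\<close>, so an
  operator that factors through \<open>r\<close> is not injective.\<close>

lemma r_not_dvd_disc: "\<not> r dvd disc"
proof
  assume "r dvd disc"
  then obtain c where c: "disc = c * r" by (metis dvdE mult.commute)
  obtain s where s: "s \<in> S" "(r ^ (N - 1) * g) \<star> s \<noteq> 0" using minimal by blast
  have "disc \<star> ((r ^ (N - 1) * g) \<star> s) = c \<star> ((r ^ N * g) \<star> s)"
    by (simp add: c power_split mult.assoc)
  also have "\<dots> = 0" using kill[OF s(1)] by simp
  finally show False using disc s(2) by blast
qed

text \<open>Composition with the action of \<open>g\<close> makes the functional vanish on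
  \<open>r^N S\<close>, as \<open>r^N g\<close> kills \<open>S\<close>. Nothing is lost on
  \<open>y\<close>: \<open>g\<close> is invertible modulo \<open>r\<close>, hence does not kill
  \<open>r^(N-1) \<star> y\<close>.\<close>

lemma detecting_functional:
  assumes y: "r ^ N \<star> y = 0" "r ^ (N - 1) \<star> y \<noteq> 0"
  shows "\<exists>\<phi>. functional \<phi> \<and> (\<forall>s\<in>S. \<phi> (r ^ N \<star> s) = 0) \<and>
    (\<forall>h. (\<forall>c. \<phi> ((c * h) \<star> y) = 0) \<longrightarrow> r ^ N dvd h)"
proof -
  let ?e = "r ^ (N - 1) \<star> y"
  obtain s t where st: "s * r + t * g = 1"
    using irreducible_comaximal[OF r(1) g] unfolding comaximal_def by blast
  have "?e = (s * r + t * g) \<star> ?e" by (simp add: st)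
  also have "\<dots> = s \<star> (r ^ N \<star> y) + t \<star> (g \<star> ?e)"
    by (simp add: act.scale_left_distrib power_split mult.assoc distrib_right)
  finally have e: "?e = s \<star> (r ^ N \<star> y) + t \<star> (g \<star> ?e)" .
  have "g \<star> ?e \<noteq> 0"
  proof
    assume 0: "g \<star> ?e = 0"
    have "?e = 0" using e unfolding y(1) 0 act.scale_zero_right add_0 .
    then show False using y(2) by blast
  qed
  then obtain \<phi> where \<phi>: "functional \<phi>" "\<phi> (g \<star> ?e) \<noteq> 0" using functional_exists by blast
  let ?\<phi> = "\<lambda>s. \<phi> (g \<star> s)"
  have "functional ?\<phi>" using functional_comp[OF \<phi>(1) linear_act] .
  moreover have "?\<phi> (r ^ N \<star> s) = 0" if "s \<in> S" for s
    using kill[OF that] by (simp add: mult.commute functional_0[OF \<phi>(1)])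
  moreover have "r ^ N dvd h" if "\<forall>c. ?\<phi> ((c * h) \<star> y) = 0" for h
    using functional_detects[OF r(1) N y(1), of ?\<phi> h] \<phi>(2) that by blast
  ultimately show ?thesis by blast
qed

text \<open>With \<open>w = B - x - zu\<close> and \<open>W\<close> the algebra, \<open>Y\<close>
  consists of the \<open>s\<close> such that \<open>\<phi>\<close> vanishes on
  \<open>(w W) s\<close>. A right ideal gives a stable \<open>Y\<close>; modulo \<open>Q\<close>
  this one is spanned by \<open>w\<close> and \<open>w u\<close>, which leaves two functionals to
  pair with the generators \<open>y\<close> and \<open>u y\<close>, where \<open>y\<close> lies in
  the image of \<open>w\<close>.\<close>

lemma split_conic_point:
  assumes point: "r dvd Q x z"
  shows "\<exists>y Y. y \<in> S \<and> r ^ N \<star> y = 0 \<and> stable Y \<and> Y \<subseteq> S \<and>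
    dim S = 2 * degree (r ^ N) + dim Y \<and>
    (\<forall>S'. u_stable S' \<longrightarrow> y \<in> S' \<longrightarrow> Y \<subseteq> S' \<longrightarrow> S \<subseteq> S')"
proof -
  have rdisc: "\<not> r dvd conic_disc T dd ll mm bb" using r_not_dvd_disc by (simp add: disc_poly_def)
  obtain x z where Q: "r ^ N dvd Q x z" using conic_hensel[OF r(1) rdisc point] by blast
  have rQ: "r dvd Q x z" using Q unfolding power_split by (rule dvd_mult_left)
  let ?w = "conic_op x z"
  have wl: "Vector_Spaces.linear scale scale ?w" unfolding conic_op_def by (rule linear_quat_act)
  interpret w: Vector_Spaces.linear scale scale ?w by fact
  have w_act: "?w (c \<star> s) = c \<star> ?w s" for c s unfolding conic_op_def by (rule quat_act_act)
  have wS: "?w s \<in> S" if "s \<in> S" for s unfolding conic_op_def using stable_quat_act[OF S that] .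
  \<comment> \<open>Otherwise \<open>w\<close> would vanish on a nonzero vector and on its image
    under \<open>u\<close>, both killed by \<open>Q\<close>, and \<open>conic_op_kernel\<close>
    would contradict regularity.\<close>
  have "\<exists>s\<in>S. r ^ (N - 1) \<star> ?w (g \<star> s) \<noteq> 0"
  proof (rule ccontr)
    assume "\<not> ?thesis"
    then have 0: "?w ((r ^ (N - 1) * g) \<star> s) = 0" if "s \<in> S" for s
      using that by (simp add: w_act)
    obtain s where s: "s \<in> S" "(r ^ (N - 1) * g) \<star> s \<noteq> 0" using minimal by blast
    let ?y = "(r ^ (N - 1) * g) \<star> s"
    have "?w ?y = 0" "?w (u ?y) = 0" using 0[OF s(1)] 0[OF S_closed(1)[OF s(1)]] by (simp_all add: u_act)
    moreover have "Q x z \<star> ?y = 0"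
    proof -
      obtain c where c: "Q x z = c * r" using rQ by (metis dvdE mult.commute)
      have "Q x z \<star> ?y = c \<star> ((r ^ N * g) \<star> s)" by (simp add: c power_split mult.assoc)
      then show ?thesis using kill[OF s(1)] by simp
    qed
    ultimately have "disc \<star> ?y = 0" by (rule conic_op_kernel)
    then show False using disc s(2) by blast
  qed
  then obtain s0 where s0: "s0 \<in> S" "r ^ (N - 1) \<star> ?w (g \<star> s0) \<noteq> 0" by blast
  define y0 where "y0 = g \<star> s0"
  define y where "y = ?w y0"
  have y0: "y0 \<in> S" "r ^ N \<star> y0 = 0" using s0(1) S_closed kill by (simp_all add: y0_def)
  have Qy0: "(c * Q x z) \<star> y0 = 0" for c
  proof -
    obtain e where e: "Q x z = e * r ^ N" using Q by (metis dvdE mult.commute)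
    have "(c * Q x z) \<star> y0 = (c * e) \<star> (r ^ N \<star> y0)" by (simp add: e mult.assoc)
    then show ?thesis using y0(2) by simp
  qed
  have y: "y \<in> S" "r ^ N \<star> y = 0" "r ^ (N - 1) \<star> y \<noteq> 0"
    using y0 wS s0(2) w_act[of "r ^ N" y0] by (simp_all add: y_def y0_def w.zero)
  obtain \<phi> where \<phi>: "functional \<phi>" "\<And>s. s \<in> S \<Longrightarrow> \<phi> (r ^ N \<star> s) = 0"
    and detect: "\<And>h. (\<And>c. \<phi> ((c * h) \<star> y) = 0) \<Longrightarrow> r ^ N dvd h"
    using detecting_functional[OF y(2,3)] by blast
  have Q\<phi>: "\<phi> (Q x z \<star> s) = 0" if "s \<in> S" for s
  proof -
    obtain e where e: "Q x z = r ^ N * e" using Q by (elim dvdE)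
    have "Q x z \<star> s = r ^ N \<star> (e \<star> s)" by (simp add: e)
    then show ?thesis using \<phi>(2)[OF S_closed(3)[OF that]] by simp
  qed
  define t1 tu where "t1 = mm - 2 * x - T * z" and "tu = ll - x * T - z * (T ^ 2 - 2 * dd)"
  have wy: "?w y = t1 \<star> y" "?w (u y) = tu \<star> y"
  proof -
    show "?w y = t1 \<star> y" using conic_op_conic_op[of x z y0] Qy0[of 1] by (simp add: y_def t1_def)
    have "Q x z \<star> (T \<star> y0 - u y0) = T \<star> ((1 * Q x z) \<star> y0) - u ((1 * Q x z) \<star> y0)"
      by (simp add: act.scale_right_diff_distrib u_act mult.commute)
    then have "Q x z \<star> (T \<star> y0 - u y0) = 0" unfolding Qy0 by (simp add: u.zero)
    then show "?w (u y) = tu \<star> y" using conic_op_u_conic_op[of x z y0] by (simp add: y_def tu_def)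
  qed
  define \<psi> where "\<psi> k s = (if k then \<phi> (?w (u s)) else \<phi> (?w s))" for k s
  define gen where "gen k = (if k then u y else y)" for k
  have \<psi>: "functional (\<psi> k)" for k
    using functional_comp[OF \<phi>(1) wl] functional_comp[OF functional_comp[OF \<phi>(1) wl] linear_u]
    by (cases k) (simp_all add: \<psi>_def[abs_def])
  have hN: "monic (r ^ N)" using r(2) by (simp add: monic_power)
  have genS: "gen k \<in> S" for k using y(1) S_closed by (simp add: gen_def)
  have h\<psi>: "\<psi> k (r ^ N \<star> s) = 0" if "s \<in> S" for k s
    using that \<phi>(2) wS S_closed by (simp add: \<psi>_def u_act w_act)
  have comb: "(\<Sum>i\<in>UNIV. C i \<star> gen i) = C False \<star> y + C True \<star> u y" for C
    by (simp add: UNIV_bool gen_def add.commute)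
  \<comment> \<open>Up to sign this is the determinant of the pairing of \<open>\<psi>\<close> with
    \<open>gen\<close>, whose rows are \<open>(t1, tu)\<close> and
    \<open>(tu, T tu - dd t1)\<close>. The gradient identity equates it with the discriminant modulo
    \<open>Q\<close>.\<close>
  have gram: "\<not> r dvd quad_norm (- T) dd tu t1"
  proof
    assume "r dvd quad_norm (- T) dd tu t1"
    moreover have "conic_disc T dd ll mm bb =
        quad_norm (- T) dd tu t1 + (T ^ 2 - 4 * dd) * Q x z"
    proof -
      have e: "T * x + 2 * dd * z + ll - T * mm = tu - T * t1" "2 * x + T * z - mm = - t1"
        by (simp_all add: tu_def t1_def algebra_simps power2_eq_square
            del: mult_pCons_left mult_pCons_right minus_pCons add_pCons diff_pCons)
      have "quad_norm (- T) dd (tu - T * t1) (- t1) = quad_norm (- T) dd tu t1"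
        by (simp add: quad_norm_def algebra_simps power2_eq_square
            del: mult_pCons_left mult_pCons_right minus_pCons add_pCons diff_pCons)
      then show ?thesis using conic_disc_gradient[of T dd ll mm bb x z] unfolding e by simp
    qed
    ultimately have "r dvd conic_disc T dd ll mm bb" using dvd_add[OF _ dvd_mult[OF rQ]] by metis
    then show False using rdisc by blast
  qed
  have ind: "\<forall>k\<in>UNIV. r ^ N dvd C k"
    if z0: "\<And>k c. k \<in> UNIV \<Longrightarrow> \<psi> k (c \<star> (\<Sum>i\<in>UNIV. C i \<star> gen i)) = 0" for C
  proof -
    let ?c0 = "C False" and ?c1 = "C True"
    define g0 g1 where "g0 = ?c0 * t1 + ?c1 * tu" and "g1 = ?c0 * tu + ?c1 * (T * tu - dd * t1)"
    have "\<phi> ((c * g0) \<star> y) = 0" for c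
    proof -
      have "?w (c \<star> (?c0 \<star> y + ?c1 \<star> u y)) = (c * g0) \<star> y"
        unfolding w_act w.add wy g0_def by (simp add: distrib_left act.scale_left_distrib act.scale_right_distrib mult.assoc)
      then show ?thesis using z0[of False c] by (simp add: comb \<psi>_def)
    qed
    then have d0: "r ^ N dvd g0" by (rule detect)
    have "\<phi> ((c * g1) \<star> y) = 0" for c
    proof -
      have "u (c \<star> (?c0 \<star> y + ?c1 \<star> u y)) = c \<star> (?c0 \<star> u y + ?c1 \<star> (T \<star> u y - dd \<star> y))"
        unfolding u_act u.add u_u ..
      then have "?w (u (c \<star> (?c0 \<star> y + ?c1 \<star> u y))) =
          c \<star> (?c0 \<star> (tu \<star> y) + ?c1 \<star> (T \<star> (tu \<star> y) - dd \<star> (t1 \<star> y)))"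
        by (simp only: w_act w.add w.diff wy)
      also have "\<dots> = (c * g1) \<star> y"
        unfolding g1_def by (simp only: distrib_left right_diff_distrib act.scale_left_distrib
            act.scale_left_diff_distrib act.scale_right_distrib act.scale_right_diff_distrib act.scale_scale mult.assoc)
      finally show ?thesis using z0[of True c] by (simp add: comb \<psi>_def)
    qed
    then have d1: "r ^ N dvd g1" by (rule detect)
    let ?q = "quad_norm (- T) dd tu t1"
    have co: "comaximal (r ^ N) ?q"
      using irreducible_comaximal[OF r(1) gram] by (rule comaximal_power_left)
    \<comment> \<open>Cramer's rule for the two congruences \<open>g0\<close> and \<open>g1\<close>
      in the unknowns \<open>?c0\<close> and \<open>?c1\<close>.\<close>
    have "?q * ?c0 = tu * g1 - (T * tu - dd * t1) * g0"
      unfolding g0_def g1_def quad_norm_def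
      by (simp add: algebra_simps power2_eq_square
          del: mult_pCons_left mult_pCons_right minus_pCons add_pCons diff_pCons)
    then have "r ^ N dvd ?q * ?c0" using d0 d1 by (metis dvd_diff dvd_mult)
    moreover have "?q * ?c1 = tu * g0 - t1 * g1"
      unfolding g0_def g1_def quad_norm_def
      by (simp add: algebra_simps power2_eq_square
          del: mult_pCons_left mult_pCons_right minus_pCons add_pCons diff_pCons)
    then have "r ^ N dvd ?q * ?c1" using d0 d1 by (metis dvd_diff dvd_mult)
    ultimately have "r ^ N dvd ?c0" "r ^ N dvd ?c1" using comaximal_dvd_mult[OF co] by blast+
    then show ?thesis by (simp add: UNIV_bool)
  qed
  define Y where "Y = {s \<in> S. \<forall>k\<in>UNIV. \<forall>c. \<psi> k (c \<star> s) = 0}"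
  note split = module_split[of "UNIV :: bool set" S "r ^ N" \<psi> gen, OF _ uS hN \<psi> genS h\<psi> ind, folded Y_def, simplified]
  have memY: "s \<in> Y \<longleftrightarrow> s \<in> S \<and> (\<forall>c. \<phi> (?w (c \<star> s)) = 0) \<and> (\<forall>c. \<phi> (?w (c \<star> u s)) = 0)" for s
    by (auto simp: Y_def \<psi>_def UNIV_bool u_act)
  have uY: "u s \<in> Y" if s: "s \<in> Y" for s
  proof -
    have "\<phi> (?w (c \<star> u (u s))) = 0" for c
    proof -
      have "?w (c \<star> u (u s)) = ?w ((c * T) \<star> u s) - ?w ((c * dd) \<star> s)"
        unfolding u_u act.scale_right_diff_distrib act.scale_scale w.diff ..
      then show ?thesis using s by (simp only: memY functional_diff[OF \<phi>(1)]) simp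
    qed
    then show ?thesis using s S_closed by (simp add: memY)
  qed
  have sY: "subspace Y" using split(2) .
  \<comment> \<open>Since \<open>b = w + x + zu\<close>, stability under \<open>w\<close> is enough;
    there \<open>w w\<close> and \<open>w u w\<close> are multiples of \<open>w\<close> up to
    multiples of \<open>Q\<close>, on which \<open>\<phi>\<close> vanishes because
    \<open>r^N\<close> divides \<open>Q\<close>.\<close>
  have bY: "b s \<in> Y" if s: "s \<in> Y" for s
  proof -
    have sS: "s \<in> S" using s memY by blast
    have lin: "\<phi> (?w (c \<star> ?w s')) = 0" if s': "s' \<in> Y" for c s'
    proof -
      have "?w (c \<star> ?w s') = t1 \<star> ?w (c \<star> s') - Q x z \<star> (c \<star> s')"
        using conic_op_conic_op[of x z "c \<star> s'"] by (simp add: t1_def w_act)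
      moreover have "\<phi> (Q x z \<star> (c \<star> s')) = 0" using s' Q\<phi> S_closed memY by blast
      moreover have "\<phi> (t1 \<star> ?w (c \<star> s')) = 0" using s' memY w_act by (metis act.scale_scale)
      ultimately show ?thesis by (simp add: functional_diff[OF \<phi>(1)])
    qed
    have lin_u: "\<phi> (?w (c \<star> u (?w s'))) = 0" if s': "s' \<in> Y" for c s'
    proof -
      have "?w (c \<star> u (?w s')) = tu \<star> ?w (c \<star> s') - Q x z \<star> (T \<star> (c \<star> s') - u (c \<star> s'))"
        using conic_op_u_conic_op[of x z "c \<star> s'"] by (simp add: tu_def w_act u_act)
      moreover have "\<phi> (Q x z \<star> (T \<star> (c \<star> s') - u (c \<star> s'))) = 0"
        using s' memY by (intro Q\<phi> subspace_diff[OF subS] S_closed) auto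
      moreover have "\<phi> (tu \<star> ?w (c \<star> s')) = 0" using s' memY w_act by (metis act.scale_scale)
      ultimately show ?thesis by (simp add: functional_diff[OF \<phi>(1)])
    qed
    have rest: "x \<star> s + z \<star> u s \<in> Y"
    proof -
      have cl: "c \<star> s' \<in> Y" if "s' \<in> Y" for c s'
        using that S_closed by (simp add: memY u_act)
      show ?thesis using cl[OF s] cl[OF uY[OF s]] subspace_add[OF sY] by blast
    qed
    have e: "b s = ?w s + (x \<star> s + z \<star> u s)" using b_conic_op[of s x z] by (simp add: add.assoc)
    have "?w s \<in> Y" unfolding memY using lin[OF s] lin_u[OF s] wS[OF sS] by blast
    then show ?thesis unfolding e using rest subspace_add[OF sY] by blast
  qed
  have "stable Y" using uY bY sY by (auto simp: stable_def u_stable_def)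
  moreover have "Y \<subseteq> S" by (auto simp: memY)
  moreover have "dim S = 2 * degree (r ^ N) + dim Y" using split(1) by simp
  moreover have "S \<subseteq> S'" if S': "u_stable S'" "y \<in> S'" "Y \<subseteq> S'" for S'
  proof
    fix s assume "s \<in> S"
    then obtain C where "s - (\<Sum>i\<in>UNIV. C i \<star> gen i) \<in> Y" using split(3) by blast
    then have "s - (C False \<star> y + C True \<star> u y) \<in> S'" using S'(3) comb by auto
    moreover have "C False \<star> y + C True \<star> u y \<in> S'"
      using S' u_stable_act[OF S'(1)] by (auto simp: u_stable_def intro!: subspace_add)
    ultimately have "(s - (C False \<star> y + C True \<star> u y)) + (C False \<star> y + C True \<star> u y) \<in> S'"
      using S'(1) subspace_add unfolding u_stable_def by blast
    then show "s \<in> S'" by simp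
  qed
  ultimately show ?thesis using y by blast
qed

text \<open>Here \<open>Y\<close> is defined by the vanishing of \<open>\<phi>\<close> on the images
  of \<open>s\<close> under the whole algebra, so its stability is immediate. The pairing is
  nondegenerate because an element with some coordinate prime to \<open>r\<close> has norm prime to
  \<open>r\<close>, and its conjugate brings it back to that norm.\<close>

lemma split_anisotropic:
  assumes aniso: "\<And>a0 a1 a2 a3. r dvd quat_norm T dd ll mm bb a0 a1 a2 a3 \<Longrightarrow>
    r dvd a0 \<and> r dvd a1 \<and> r dvd a2 \<and> r dvd a3"
  shows "\<exists>y Y. y \<in> S \<and> r ^ N \<star> y = 0 \<and> stable Y \<and> Y \<subseteq> S \<and>
    dim S = 4 * degree (r ^ N) + dim Y \<and>
    (\<forall>S'. u_stable S' \<longrightarrow> y \<in> S' \<longrightarrow> b y \<in> S' \<longrightarrow> Y \<subseteq> S' \<longrightarrow> S \<subseteq> S')"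
proof -
  obtain s0 where s0: "s0 \<in> S" "(r ^ (N - 1) * g) \<star> s0 \<noteq> 0" using minimal by blast
  define y where "y = g \<star> s0"
  have y: "y \<in> S" "r ^ N \<star> y = 0" "r ^ (N - 1) \<star> y \<noteq> 0"
    using s0 S_closed kill[OF s0(1)] by (simp_all add: y_def)
  obtain \<phi> where \<phi>: "functional \<phi>" "\<And>s. s \<in> S \<Longrightarrow> \<phi> (r ^ N \<star> s) = 0"
    and detect: "\<And>h. (\<And>c. \<phi> ((c * h) \<star> y) = 0) \<Longrightarrow> r ^ N dvd h"
    using detecting_functional[OF y(2,3)] by blast
  let ?K = "{..<4::nat}"
  have K4: "?K = {0, 1, 2, 3}" by auto
  define E where "E k s = (if k = 0 then s else if k = 1 then u s else if k = 2 then b s else u (b s))"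
    for k :: nat and s
  define \<psi> where "\<psi> k s = \<phi> (E k s)" for k s
  define gen where "gen k = E k y" for k
  have E_act: "E k (c \<star> s) = c \<star> E k s" for k c s by (simp add: E_def u_act b_act)
  have E_lin: "Vector_Spaces.linear scale scale (E k)" for k
    by unfold_locales (simp_all add: E_def u.add u.scale b.add b.scale)
  have E_S: "E k s \<in> S" if "s \<in> S" for k s using that S_closed by (simp add: E_def)
  have \<psi>: "functional (\<psi> k)" for k
    using functional_comp[OF \<phi>(1) E_lin] by (simp add: \<psi>_def[abs_def])
  have hN: "monic (r ^ N)" using r(2) by (simp add: monic_power)
  have genS: "gen k \<in> S" for k using y(1) E_S by (simp add: gen_def)
  have h\<psi>: "\<psi> k (r ^ N \<star> s) = 0" if "s \<in> S" for k s
    using that \<phi>(2) E_S by (simp add: \<psi>_def E_act)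
  have comb: "(\<Sum>i\<in>?K. C i \<star> E i s) = quat_act (C 0) (C 1) (C 2) (C 3) s" for C s
    by (simp add: K4 E_def quat_act_def add.assoc)
  define Y where "Y = {s \<in> S. \<forall>k\<in>?K. \<forall>c. \<psi> k (c \<star> s) = 0}"
  have memY: "s \<in> Y \<longleftrightarrow> s \<in> S \<and> (\<forall>a0 a1 a2 a3. \<phi> (quat_act a0 a1 a2 a3 s) = 0)" for s
  proof
    assume s: "s \<in> Y"
    have "\<phi> (c \<star> E k s) = 0" if "k \<in> ?K" for c k
      using s that by (simp add: Y_def \<psi>_def E_act)
    then have "\<phi> (a0 \<star> E 0 s) = 0" "\<phi> (a1 \<star> E 1 s) = 0" "\<phi> (a2 \<star> E 2 s) = 0" "\<phi> (a3 \<star> E 3 s) = 0"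
      for a0 a1 a2 a3 by simp_all
    then show "s \<in> S \<and> (\<forall>a0 a1 a2 a3. \<phi> (quat_act a0 a1 a2 a3 s) = 0)"
      using s by (simp add: Y_def quat_act_def E_def functional_add[OF \<phi>(1)])
  next
    assume s: "s \<in> S \<and> (\<forall>a0 a1 a2 a3. \<phi> (quat_act a0 a1 a2 a3 s) = 0)"
    have "c \<star> E k s = quat_act (if k = 0 then c else 0) (if k = 1 then c else 0) (if k = 2 then c else 0)
        (if k = 3 then c else 0) s" if "k \<in> ?K" for c k
      using that unfolding K4 by (auto simp: E_def quat_act_def)
    then show "s \<in> Y" using s by (simp add: Y_def \<psi>_def E_act)
  qed
  have ind: "\<forall>k\<in>?K. r ^ N dvd C k"
    if z0: "\<And>k c. k \<in> ?K \<Longrightarrow> \<psi> k (c \<star> (\<Sum>i\<in>?K. C i \<star> gen i)) = 0" for C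
  proof (rule ccontr)
    assume not: "\<not> (\<forall>k\<in>?K. r ^ N dvd C k)"
    \<comment> \<open>The largest common power of \<open>r\<close> in the coefficients, capped below
      \<open>N\<close> so that the maximum exists even when all coefficients vanish.\<close>
    define k where "k = (GREATEST k. k < N \<and> (\<forall>i\<in>?K. r ^ k dvd C i))"
    have ex: "0 < N \<and> (\<forall>i\<in>?K. r ^ 0 dvd C i)" using N by simp
    have k: "k < N" "\<forall>i\<in>?K. r ^ k dvd C i"
      using GreatestI_nat[of "\<lambda>k. k < N \<and> (\<forall>i\<in>?K. r ^ k dvd C i)" 0 N] ex unfolding k_def by auto
    have max: "\<not> (\<forall>i\<in>?K. r ^ Suc k dvd C i)"
    proof
      assume a: "\<forall>i\<in>?K. r ^ Suc k dvd C i"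
      then have "Suc k < N" using k(1) not by (metis Suc_lessI)
      then have "Suc k \<le> k"
        unfolding k_def using a
        by (intro Greatest_le_nat[of "\<lambda>k. k < N \<and> (\<forall>i\<in>?K. r ^ k dvd C i)" _ N]) (auto simp: k_def)
      then show False by simp
    qed
    obtain D where D: "\<And>i. i \<in> ?K \<Longrightarrow> C i = r ^ k * D i" using k(2) unfolding dvd_def by metis
    have nd: "\<not> (r dvd D 0 \<and> r dvd D 1 \<and> r dvd D 2 \<and> r dvd D 3)"
    proof
      assume "r dvd D 0 \<and> r dvd D 1 \<and> r dvd D 2 \<and> r dvd D 3"
      then have "r ^ Suc k dvd C i" if "i \<in> ?K" for i
        using D[OF that] that unfolding K4 by (auto simp: mult.commute intro: mult_dvd_mono)
      then show False using max by blast
    qed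
    let ?n = "quat_norm T dd ll mm bb (D 0) (D 1) (D 2) (D 3)"
    have rn: "\<not> r dvd ?n" using aniso nd by blast
    have inY: "(\<Sum>i\<in>?K. C i \<star> gen i) \<in> Y"
    proof -
      have "(\<Sum>i\<in>?K. C i \<star> gen i) \<in> S" by (intro subspace_sum[OF subS] S_closed genS)
      then show ?thesis using z0 by (simp add: Y_def)
    qed
    have Cq: "(\<Sum>i\<in>?K. C i \<star> gen i) = r ^ k \<star> quat_act (D 0) (D 1) (D 2) (D 3) y"
      unfolding gen_def comb act_quat_act using D by simp
    \<comment> \<open>Applying the conjugate of \<open>D\<close> replaces \<open>D y\<close> by its
      norm times \<open>y\<close>; \<open>Y\<close> absorbs this, and so \<open>\<phi>\<close>
      detects that \<open>r^N\<close> divides \<open>r^k * ?n\<close>.\<close>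
    have "\<phi> ((c * (r ^ k * ?n)) \<star> y) = 0" for c
    proof -
      have "c \<star> quat_act (D 0 + T * D 1 + mm * D 2 + ll * D 3) (- D 1) (- D 2) (- D 3)
          (r ^ k \<star> quat_act (D 0) (D 1) (D 2) (D 3) y) = (c * (r ^ k * ?n)) \<star> y"
        unfolding quat_act_act quat_act_conj by (simp add: mult.assoc)
      then show ?thesis
        using inY unfolding Cq memY by (simp only: act_quat_act[of c]) metis
    qed
    then have "r ^ N dvd r ^ k * ?n" by (rule detect)
    moreover have "comaximal (r ^ N) ?n"
      using irreducible_comaximal[OF r(1) rn] by (rule comaximal_power_left)
    ultimately have "r ^ N dvd r ^ k" using comaximal_dvd_mult by (metis mult.commute)
    moreover have "r \<noteq> 0" "\<not> r dvd 1" using r(1) by (auto simp: irreducible_def)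
    ultimately have "N \<le> k" by (simp add: dvd_power_iff)
    then show False using k(1) by simp
  qed
  note split = module_split[of ?K S "r ^ N" \<psi> gen, OF _ uS hN \<psi> genS h\<psi> ind, folded Y_def]
  have sY: "subspace Y" using split(2) by simp
  have closed: "quat_act c0 c1 c2 c3 s \<in> Y" if s: "s \<in> Y" for c0 c1 c2 c3 s
  proof -
    have "\<phi> (quat_act a0 a1 a2 a3 (quat_act c0 c1 c2 c3 s)) = 0" for a0 a1 a2 a3
      using quat_act_comp[of a0 a1 a2 a3 c0 c1 c2 c3] s by (metis memY)
    then show ?thesis using s stable_quat_act[OF S] by (simp add: memY)
  qed
  have "u s \<in> Y" "b s \<in> Y" if "s \<in> Y" for s
    using closed[OF that, of 0 1 0 0] closed[OF that, of 0 0 1 0] by (simp_all add: quat_act_def)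
  then have "stable Y" using sY by (auto simp: stable_def u_stable_def)
  moreover have "Y \<subseteq> S" by (auto simp: memY)
  moreover have "dim S = 4 * degree (r ^ N) + dim Y" using split(1) by simp
  moreover have "S \<subseteq> S'" if S': "u_stable S'" "y \<in> S'" "b y \<in> S'" "Y \<subseteq> S'" for S'
  proof
    fix s assume "s \<in> S"
    then obtain C where C: "s - (\<Sum>i\<in>?K. C i \<star> gen i) \<in> Y" using split(3) by auto
    have sub: "subspace S'" using S'(1) by (simp add: u_stable_def)
    have "gen i \<in> S'" for i using S' by (auto simp: gen_def E_def u_stable_def)
    then have "(\<Sum>i\<in>?K. C i \<star> gen i) \<in> S'" by (intro subspace_sum[OF sub] u_stable_act[OF S'(1)])
    then have "(s - (\<Sum>i\<in>?K. C i \<star> gen i)) + (\<Sum>i\<in>?K. C i \<star> gen i) \<in> S'"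
      using C S'(4) subspace_add[OF sub] by blast
    then show "s \<in> S'" by simp
  qed
  ultimately show ?thesis using y by blast
qed

end

definition split_irr :: "'a poly \<Rightarrow> bool" where
  "split_irr r \<longleftrightarrow> irreducible r \<and> monic r \<and> \<not> r dvd disc \<and> (\<exists>x z. r dvd Q x z)"

lemma block_decomposition:
  assumes disc: "\<And>x. disc \<star> x = 0 \<Longrightarrow> x = 0" and "stable S"
  shows "\<exists>F. block_multiset split_irr F \<and> cyclic_decomp F S"
  using assms(2)
proof (induction "dim S" arbitrary: S rule: less_induct)
  case less
  have sS: "subspace S" using less.prems by (simp add: stable_def u_stable_def)
  show ?case
  proof (cases "dim S = 0")
    case True
    then have "S \<subseteq> {0}" by simp
    then have "cyclic_gens [] S"
      using True by (auto simp: cyclic_gens_def u_stable_def subspace_0)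
    then have "cyclic_decomp {#} S" unfolding cyclic_decomp_def by (intro exI[of _ "[]"]) simp
    then show ?thesis using block_multiset.empty by blast
  next
    case False
    \<comment> \<open>The minimal polynomial of \<open>v\<close> on \<open>S\<close>, obtained as a
      nonzero annihilator of least degree.\<close>
    let ?P = "\<lambda>g. g \<noteq> 0 \<and> (\<forall>s\<in>S. g \<star> s = 0)"
    obtain h where h: "h \<noteq> 0" "\<forall>x. h \<star> x = 0"
      using poly_endo_annihilates[OF linear_v] unfolding act_def by blast
    then have "?P h" by simp
    from ex_has_least_nat[of ?P, OF this, of degree] obtain f
      where f: "f \<noteq> 0" "\<And>s. s \<in> S \<Longrightarrow> f \<star> s = 0"
      and f_min: "\<And>g. ?P g \<Longrightarrow> degree f \<le> degree g"
      by auto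
    have "degree f > 0"
    proof (rule ccontr)
      assume "\<not> degree f > 0"
      then obtain c where c: "f = [:c:]" by (metis degree_eq_zeroE gr0I)
      then have "S \<subseteq> {0}" using f by (auto simp: act_const)
      then show False using False by simp
    qed
    then obtain r where r: "irreducible r" "monic r" "r dvd f"
      using exists_monic_irreducible_dvd by blast
    obtain N g where g: "f = r ^ N * g" "\<not> r dvd g" using irreducible_decomp[OF f(1) r(1)] by blast
    have N: "N \<ge> 1" using r(3) g by (cases N) auto
    then have pw: "r ^ N = r * r ^ (N - 1)" by (cases N) auto
    have rd: "r \<noteq> 0" "degree r > 0"
      using r(1) is_unit_iff_degree[of r] irreducible_not_unit by auto
    have minimal: "\<exists>s\<in>S. (r ^ (N - 1) * g) \<star> s \<noteq> 0"
    proof (rule ccontr)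
      assume no: "\<not> ?thesis"
      have f': "f = r * (r ^ (N - 1) * g)" using g(1) pw by (simp add: mult.assoc)
      then have nz: "r ^ (N - 1) * g \<noteq> 0" using f(1) by auto
      then have "degree f \<le> degree (r ^ (N - 1) * g)" using no f_min by blast
      then show False using rd nz unfolding f' by (simp add: degree_mult_eq)
    qed
    have kill: "\<And>s. s \<in> S \<Longrightarrow> (r ^ N * g) \<star> s = 0" using f(2) g(1) by simp
    note ctx = less.prems r(1,2) N g(2) kill minimal disc
    have mN: "monic (r ^ N)" using r(2) by (simp add: monic_power)
    have dN: "degree (r ^ N) > 0" using rd N by (simp add: degree_power_eq)
    show ?thesis
    proof (cases "\<exists>x z. r dvd Q x z")
      case True
      then obtain x z where xz: "r dvd Q x z" by blast
      obtain y Y where y: "y \<in> S" "r ^ N \<star> y = 0" "stable Y" "Y \<subseteq> S"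
        "dim S = 2 * degree (r ^ N) + dim Y"
        "\<And>S'. u_stable S' \<Longrightarrow> y \<in> S' \<Longrightarrow> Y \<subseteq> S' \<Longrightarrow> S \<subseteq> S'"
        using split_conic_point[OF ctx xz] by blast
      have "dim Y < dim S" using y(5) dN by simp
      from less.hyps[OF this y(3)] obtain F l where
        F: "block_multiset split_irr F" "mset (map fst l) = F" "cyclic_gens l Y"
        unfolding cyclic_decomp_def by blast
      have "cyclic_gens ((r ^ N, y) # l) S"
        using F(3) y mN unfolding cyclic_gens_def by auto
      then have "cyclic_decomp (add_mset (r ^ N) F) S"
        using F(2) unfolding cyclic_decomp_def by (intro exI[of _ "(r ^ N, y) # l"]) simp
      moreover have "split_irr r"
        using r xz r_not_dvd_disc[OF ctx] by (auto simp: split_irr_def)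
      ultimately show ?thesis using block_multiset.single[OF _ N F(1)] by blast
    next
      case no_point: False
      have rdisc: "\<not> r dvd conic_disc T dd ll mm bb"
        using r_not_dvd_disc[OF ctx] by (simp add: disc_poly_def)
      have aniso: "r dvd a0 \<and> r dvd a1 \<and> r dvd a2 \<and> r dvd a3"
        if "r dvd quat_norm T dd ll mm bb a0 a1 a2 a3" for a0 a1 a2 a3
        using conic_point_of_isotropic[OF r(1) rdisc that] no_point by blast
      obtain y Y where y: "y \<in> S" "r ^ N \<star> y = 0" "stable Y" "Y \<subseteq> S"
        "dim S = 4 * degree (r ^ N) + dim Y"
        "\<And>S'. u_stable S' \<Longrightarrow> y \<in> S' \<Longrightarrow> b y \<in> S' \<Longrightarrow> Y \<subseteq> S' \<Longrightarrow> S \<subseteq> S'"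
        using split_anisotropic[OF ctx aniso] by blast
      have "dim Y < dim S" using y(5) dN by simp
      from less.hyps[OF this y(3)] obtain F l where
        F: "block_multiset split_irr F" "mset (map fst l) = F" "cyclic_gens l Y"
        unfolding cyclic_decomp_def by blast
      \<comment> \<open>For \<open>u\<close> and \<open>v\<close> alone, the submodule generated by
        \<open>y\<close> over the algebra is a double block, with generators \<open>y\<close> and
        \<open>b y\<close> of the same order \<open>r^N\<close>.\<close>
      have "b y \<in> S" using less.prems y(1) by (auto simp: stable_def)
      moreover have "r ^ N \<star> b y = 0" using y(2) b_act[of "r ^ N" y] by (simp add: b.zero)
      ultimately have "cyclic_gens ((r ^ N, y) # (r ^ N, b y) # l) S"
        using F(3) y mN unfolding cyclic_gens_def by auto
      then have "cyclic_decomp (add_mset (r ^ N) (add_mset (r ^ N) F)) S"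
        using F(2) unfolding cyclic_decomp_def
        by (intro exI[of _ "(r ^ N, y) # (r ^ N, b y) # l"]) simp
      then show ?thesis using block_multiset.double[OF r(1,2) N F(1)] by blast
    qed
  qed
qed

end

section \<open>Quotients and modules over the quaternion algebra\<close>

lemma (in vector_space) poly_endo_quadratic:
  assumes "Vector_Spaces.linear scale scale f"
  shows "poly_endo scale [:c, - e, 1:] f x = f (f x) - (scale e (f x) - scale c x)"
proof -
  interpret f: Vector_Spaces.linear scale scale f by fact
  show ?thesis by (simp add: poly_endo_pCons[OF assms] f.add f.diff f.scale f.neg f.zero algebra_simps)
qed

text \<open>The witness is \<open>a = u b\<close>: in the algebra this is \<open>A\<close>, of trace
  \<open>l\<close> and norm \<open>be * \<delta>\<close>, whence \<open>p(a) = 0\<close>.\<close>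

lemma (in quat_module) is_quotient:
  assumes p: "p = [:be * \<delta>, - l, 1:]" and q: "q = [:be, - m, 1:]" and bij_u: "bij u"
  shows "is_quotient scale p q u"
proof -
  \<comment> \<open>The inverse of \<open>b\<close> is \<open>be^-1 (m - b)\<close>, read off
    \<open>q(b) = 0\<close>.\<close>
  have b_inv: "b (scale (inverse be) (scale m x - b x)) = x" "scale (inverse be) (scale m (b x) - b (b x)) = x" for x
    using be_nz by (simp_all add: b.scale b.diff b_b')
  have bij_b: "bij b"
  proof (rule bijI)
    show "inj b" by (rule inj_on_inverseI) (rule b_inv(2))
    show "surj b" by (rule surjI) (rule b_inv(1))
  qed
  let ?a = "u \<circ> b"
  have lin_a: "Vector_Spaces.linear scale scale ?a"
    using linear_b linear_u by (rule Vector_Spaces.linear_compose)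
  have "?a (?a x) = scale l (?a x) - scale (be * \<delta>) x" for x
  proof -
    have "?a (?a x) = u (scale l (b x) - scale m (v (b x)) + scale m (u (b x)) + v (b (b x)) - u (b (b x)))"
      by (simp add: b_u')
    also have "\<dots> = scale l (u (b x)) - scale m (u (v (b x)) - u (u (b x))) + (u (v (b (b x))) - u (u (b (b x))))"
      by (simp add: u.add u.diff u.scale scale_right_diff_distrib algebra_simps)
    also have "\<dots> = scale l (u (b x)) - scale (be * \<delta>) x"
      by (simp add: u_v b_b' scale_right_diff_distrib mult.commute)
    finally show ?thesis by simp
  qed
  then have pa: "poly_endo scale p ?a = (\<lambda>_. 0)"
    by (simp add: fun_eq_iff p poly_endo_quadratic[OF lin_a] del: o_apply)
  have qb: "poly_endo scale q b = (\<lambda>_. 0)"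
    by (simp add: fun_eq_iff q poly_endo_quadratic[OF linear_b] b_b')
  have "u = ?a \<circ> inv_into UNIV b"
    using bij_b by (simp add: fun_eq_iff bij_is_surj surj_f_inv_f)
  then show ?thesis
    unfolding is_quotient_def is_automorphism_def
    using lin_a linear_b bij_b bij_u pa qb bij_comp by blast
qed

text \<open>Put \<open>a = u b\<close>. Cancelling one \<open>u\<close> in \<open>p(a) = 0\<close>
  gives \<open>b u b\<close>; substituting the inverse of \<open>b\<close> gives \<open>b u\<close>,
  and then substituting the inverse of \<open>u\<close> gives \<open>b u^-1\<close>. Adding the last
  two formulas shows that \<open>b\<close> commutes with \<open>v\<close>.\<close>

lemma (in finite_dimensional_vector_space) quotient_quat_module:
  assumes p: "p = [:be * \<delta>, - l, 1:]" and q: "q = [:be, - m, 1:]" and nz: "be \<noteq> 0" "\<delta> \<noteq> 0"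
    and u: "is_quotient scale p q u"
  shows "\<exists>b. quat_module scale Basis u (\<lambda>x. u x + scale \<delta> (inv_into UNIV u x)) \<delta> b l m be"
proof -
  obtain a b where ab: "Vector_Spaces.linear scale scale a" "bij a" "Vector_Spaces.linear scale scale b"
    "bij b" "poly_endo scale p a = (\<lambda>_. 0)" "poly_endo scale q b = (\<lambda>_. 0)" "u = a \<circ> inv_into UNIV b"
    using u unfolding is_quotient_def is_automorphism_def by blast
  interpret a: Vector_Spaces.linear scale scale a by fact
  interpret b: Vector_Spaces.linear scale scale b by fact
  let ?w = "inv_into UNIV u"
  have lin_inv: "Vector_Spaces.linear scale scale (inv_into UNIV f)"
    if "Vector_Spaces.linear scale scale f" "bij f" for f
  proof -
    interpret f: Vector_Spaces.linear scale scale f by fact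
    have sf: "f (inv_into UNIV f x) = x" for x using that(2) by (simp add: bij_is_surj surj_f_inv_f)
    have eq: "inv_into UNIV f y = x" if "f x = y" for x y
      using that \<open>bij f\<close> by (metis bij_is_inj inv_f_f)
    show ?thesis
      by unfold_locales (auto intro!: eq simp: f.add f.scale sf)
  qed
  have lin_u: "Vector_Spaces.linear scale scale u"
    unfolding ab(7) using lin_inv[OF ab(3,4)] ab(1) by (rule Vector_Spaces.linear_compose)
  have bij_u: "bij u" unfolding ab(7) using ab(2,4) by (simp add: bij_comp bij_imp_bij_inv)
  interpret u: Vector_Spaces.linear scale scale u by fact
  interpret w: Vector_Spaces.linear scale scale ?w using lin_inv[OF lin_u bij_u] .
  have uw: "u (?w x) = x" and wu: "?w (u x) = x" for x
    using bij_u by (simp_all add: bij_is_surj surj_f_inv_f bij_is_inj inv_f_f)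
  have a_ub: "a x = u (b x)" for x using ab(4,7) by (simp add: bij_is_inj inv_f_f)
  have "poly_endo scale p a x = 0" "poly_endo scale q b x = 0" for x using ab(5,6) by simp_all
  then have pa: "a (a x) = scale l (a x) - scale (be * \<delta>) x" and qb: "b (b x) = scale m (b x) - scale be x" for x
    unfolding p q poly_endo_quadratic[OF ab(1)] poly_endo_quadratic[OF ab(3)] by simp_all
  have bub: "b (u (b x)) = scale l (b x) - scale (be * \<delta>) (?w x)" for x
  proof -
    have "?w (a (a x)) = ?w (scale l (a x) - scale (be * \<delta>) x)" by (simp only: pa)
    then show ?thesis by (simp add: a_ub wu w.diff w.scale)
  qed
  have bu: "b (u x) = scale l x - scale (m * \<delta>) (?w x) + scale \<delta> (?w (b x))" for x
  proof -
    let ?y = "scale (inverse be) (scale m x - b x)"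
    have y: "b ?y = x" using nz by (simp add: b.scale b.diff qb)
    have "b (u x) = scale l x - scale (be * \<delta>) (?w ?y)" using bub[of ?y] unfolding y .
    also have "scale (be * \<delta>) (?w ?y) = scale \<delta> (scale m (?w x) - ?w (b x))"
      using nz by (simp add: w.scale w.diff)
    finally show ?thesis by (simp add: scale_right_diff_distrib mult.commute)
  qed
  have bw: "scale \<delta> (b (?w x)) = u (b x) - scale l x + scale (m * \<delta>) (?w x)" for x
  proof -
    have "u (b x) = u (b (u (?w x)))" by (simp add: uw)
    also have "\<dots> = scale l x - scale (m * \<delta>) (?w x) + scale \<delta> (b (?w x))"
      unfolding bu[of "?w x"] by (simp add: u.add u.diff u.scale uw)
    finally show ?thesis by simp
  qed
  have "quat_module scale Basis u (\<lambda>x. u x + scale \<delta> (?w x)) \<delta> b l m be"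
  proof unfold_locales
    show "inj u" using bij_u by (rule bij_is_inj)
    show "u (u x + scale \<delta> (?w x)) = u (u x) + scale \<delta> x" for x by (simp add: u.add u.scale uw)
    show "b (u x + scale \<delta> (?w x)) = u (b x) + scale \<delta> (?w (b x))" for x
      by (simp add: b.add b.scale bu bw)
    show "b (u x) = scale l x - scale m (u x + scale \<delta> (?w x)) + scale m (u x) +
        (u (b x) + scale \<delta> (?w (b x))) - u (b x)" for x
      by (simp add: bu scale_right_distrib)
  qed (use nz qb in \<open>simp_all add: u.add u.scale w.add w.scale b.add b.scale scale_right_distrib algebra_simps\<close>)
  then show ?thesis by blast
qed

section \<open>Linear maps prescribed on cyclic generators\<close>

context quadratic_over
begin

text \<open>The index \<open>(i, k, j)\<close> below stands for \<open>v^j x_i\<close> or, if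
  \<open>k\<close> holds, for \<open>v^j u x_i\<close>, with \<open>j\<close> below the degree of
  the annihilator of \<open>x_i\<close>.\<close>

definition gen :: "('a poly \<times> 'v) list \<Rightarrow> nat \<Rightarrow> bool \<Rightarrow> 'v" where
  "gen gs i k = (if k then u (snd (gs ! i)) else snd (gs ! i))"

definition gen_index :: "('a poly \<times> 'v) list \<Rightarrow> (nat \<times> bool \<times> nat) set" where
  "gen_index gs = (SIGMA i:{..<length gs}. UNIV \<times> {..<degree (fst (gs ! i))})"

definition gen_vec :: "('a poly \<times> 'v) list \<Rightarrow> nat \<times> bool \<times> nat \<Rightarrow> 'v" where
  "gen_vec gs = (\<lambda>(i, k, j). [:0, 1:] ^ j \<star> gen gs i k)"

context
  fixes gs :: "('a poly \<times> 'v) list"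
  assumes gs: "\<forall>(f, x) \<in> set gs. monic f \<and> f \<star> x = 0"
begin

lemma finite_gen_index: "finite (gen_index gs)"
  unfolding gen_index_def by (intro finite_SigmaI) auto

lemma card_gen_index: "card (gen_index gs) = (\<Sum>(f, x)\<leftarrow>gs. 2 * degree f)"
  by (simp add: gen_index_def card_SigmaI card_cartesian_product sum_list_sum_nth case_prod_unfold
      lessThan_atLeast0)

lemma gen_annihilated:
  assumes "i < length gs"
  shows "fst (gs ! i) \<noteq> 0" "fst (gs ! i) \<star> gen gs i k = 0"
  using gs nth_mem[OF assms] u_act[of "fst (gs ! i)" "snd (gs ! i)"]
  by (auto simp: gen_def case_prod_unfold u.zero)

lemma act_mod:
  assumes "f \<star> z = 0"
  shows "(c mod f) \<star> z = c \<star> z"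
proof -
  have "c \<star> z = (c div f) \<star> (f \<star> z) + (c mod f) \<star> z"
    by (simp flip: act.scale_left_distrib)
  then show ?thesis using assms by simp
qed

lemma act_gen:
  assumes "i < length gs"
  shows "c \<star> gen gs i k = (\<Sum>j<degree (fst (gs ! i)).
    scale (poly.coeff (c mod fst (gs ! i)) j) (gen_vec gs (i, k, j)))"
proof -
  let ?f = "fst (gs ! i)"
  have "(c mod ?f) \<star> gen gs i k = (\<Sum>j<degree ?f. scale (poly.coeff (c mod ?f) j) (gen_vec gs (i, k, j)))"
  proof (cases "c mod ?f = 0")
    case False
    then have "degree (c mod ?f) < degree ?f" using degree_mod_less[OF gen_annihilated(1)[OF assms]] by blast
    from act_expand[OF this] show ?thesis by (simp add: gen_vec_def)
  qed simp
  then show ?thesis using act_mod[OF gen_annihilated(2)[OF assms]] by simp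
qed

lemma act_gen_span:
  assumes i: "i < length gs"
  shows "c \<star> gen gs i k \<in> span (gen_vec gs ` gen_index gs)"
  unfolding act_gen[OF i]
  by (intro span_sum span_scale span_base imageI) (use i in \<open>auto simp: gen_index_def\<close>)

lemma gen_vecE:
  assumes "y \<in> gen_vec gs ` gen_index gs"
  obtains i k j where "i < length gs" "y = [:0, 1:] ^ j \<star> gen gs i k"
  using assms by (auto simp: gen_vec_def gen_index_def)

lemma u_stable_gen_span: "u_stable (span (gen_vec gs ` gen_index gs))"
proof -
  have "u y \<in> span (gen_vec gs ` gen_index gs)" if "y \<in> span (gen_vec gs ` gen_index gs)" for y
    using that
  proof (induction rule: span_induct_alt)
    case (step c y z)
    obtain i k j where ikj: "i < length gs" "y = [:0, 1:] ^ j \<star> gen gs i k"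
      using step(1) by (rule gen_vecE)
    have "u y \<in> span (gen_vec gs ` gen_index gs)"
    proof (cases k)
      case True
      then have "u y = ([:0, 1:] ^ j * [:0, 1:]) \<star> gen gs i True - ([:0, 1:] ^ j * [:\<delta>:]) \<star> gen gs i False"
        unfolding ikj(2) u_act gen_def
        by (simp only: if_True if_False u_u act.scale_right_diff_distrib act.scale_scale)
      then show ?thesis using act_gen_span[OF ikj(1)] by (auto intro!: span_diff)
    next
      case False
      then have "u y = [:0, 1:] ^ j \<star> gen gs i True" by (simp add: ikj(2) u_act gen_def)
      then show ?thesis using act_gen_span[OF ikj(1)] by simp
    qed
    then show ?case using step by (simp add: u.add u.scale span_add span_scale)
  qed (simp add: u.zero span_zero)
  then show ?thesis by (auto simp: u_stable_def)
qed

lemma gens_in_gen_span: "snd ` set gs \<subseteq> span (gen_vec gs ` gen_index gs)"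
proof
  fix z assume "z \<in> snd ` set gs"
  then obtain i where "i < length gs" "z = snd (gs ! i)" by (auto simp: in_set_conv_nth)
  then show "z \<in> span (gen_vec gs ` gen_index gs)" using act_gen_span[of i 1 False] by (simp add: gen_def)
qed

lemma u_stable_gens_dim:
  "\<exists>S. u_stable S \<and> snd ` set gs \<subseteq> S \<and> dim S \<le> (\<Sum>(f, x)\<leftarrow>gs. 2 * degree f)"
proof -
  have "dim (span (gen_vec gs ` gen_index gs)) \<le> card (gen_vec gs ` gen_index gs)"
    using finite_gen_index by (intro dim_le_card) auto
  also have "\<dots> \<le> (\<Sum>(f, x)\<leftarrow>gs. 2 * degree f)"
    using card_image_le[OF finite_gen_index] card_gen_index by simp
  finally show ?thesis using u_stable_gen_span gens_in_gen_span by blast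
qed

end

text \<open>The count of dimensions makes the vectors \<open>gen_vec\<close> a basis, so a linear
  \<open>b\<close> with the prescribed values exists. It commutes with \<open>v\<close> because each
  annihilator also kills the target, so that only residues modulo the annihilator matter.\<close>

lemma cyclic_gens_linear_extension:
  assumes gens: "cyclic_gens (map (\<lambda>(f, x, y, y'). (f, x)) w) UNIV"
    and tgt: "\<forall>(f, x, y, y') \<in> set w. f \<star> y = 0 \<and> f \<star> y' = 0"
  shows "\<exists>b. Vector_Spaces.linear scale scale b \<and> (\<forall>x. b (v x) = v (b x)) \<and>
    (\<forall>(f, x, y, y') \<in> set w. b x = y \<and> b (u x) = y')"
proof -
  interpret pr: vector_space_pair scale scale ..
  define gs where "gs = map (\<lambda>(f, x, y, y'). (f, x)) w"
  have gs: "\<forall>(f, x) \<in> set gs. monic f \<and> f \<star> x = 0" and cyc: "cyclic_gens gs UNIV"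
    using gens by (auto simp: cyclic_gens_def gs_def)
  have len: "length gs = length w" and nth: "gs ! i = (fst (w ! i), fst (snd (w ! i)))" if "i < length w" for i
    using that by (simp_all add: gs_def case_prod_unfold)
  define H where "H i k = (if k then snd (snd (snd (w ! i))) else fst (snd (snd (w ! i))))" for i k
  have fH: "fst (gs ! i) \<star> H i k = 0" if "i < length gs" for i k
    using that tgt nth_mem[of i w] by (auto simp: gs_def H_def case_prod_unfold)
  let ?I = "gen_index gs" and ?e = "gen_vec gs"
  have span: "UNIV \<subseteq> span (?e ` ?I)"
    using cyc u_stable_gen_span[OF gs] gens_in_gen_span[OF gs] unfolding cyclic_gens_def by blast
  have card_I: "card ?I = dim UNIV" using cyc card_gen_index[OF gs] by (simp add: cyclic_gens_def)
  note fin = finite_gen_index[OF gs]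
  have ind: "independent (?e ` ?I)"
    using card_le_dim_spanning[of "?e ` ?I" UNIV] span fin card_image_le[OF fin, of ?e] card_I by simp
  then have "card (?e ` ?I) = dim UNIV" using dim_unique[of "?e ` ?I" UNIV] span by auto
  then have inj: "inj_on ?e ?I" using card_I fin by (intro eq_card_imp_inj_on) simp_all
  define F where "F z = (case inv_into ?I ?e z of (i, k, j) \<Rightarrow> [:0, 1:] ^ j \<star> H i k)" for z
  obtain b where b: "Vector_Spaces.linear scale scale b" "\<forall>z\<in>?e ` ?I. b z = F z"
    using pr.linear_independent_extend[OF ind, of F] by blast
  interpret b: Vector_Spaces.linear scale scale b by (rule b(1))
  have b_e: "b (?e (i, k, j)) = [:0, 1:] ^ j \<star> H i k" if "i < length gs" "j < degree (fst (gs ! i))" for i j k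
  proof -
    have "(i, k, j) \<in> ?I" using that by (auto simp: gen_index_def)
    then show ?thesis using b(2) by (simp add: F_def inv_into_f_f[OF inj])
  qed
  have b_G: "b (c \<star> gen gs i k) = c \<star> H i k" if i: "i < length gs" for c i k
  proof -
    let ?f = "fst (gs ! i)"
    have "b (c \<star> gen gs i k) = (\<Sum>j<degree ?f. scale (poly.coeff (c mod ?f) j) ([:0, 1:] ^ j \<star> H i k))"
      using i by (simp add: act_gen[OF gs i] b.sum b.scale b_e)
    also have "\<dots> = (c mod ?f) \<star> H i k"
    proof (cases "c mod ?f = 0")
      case False
      then have "degree (c mod ?f) < degree ?f"
        using degree_mod_less[OF gen_annihilated(1)[OF gs i]] by blast
      from act_expand[OF this] show ?thesis by simp
    qed simp
    also have "\<dots> = c \<star> H i k" by (rule act_mod[OF gs fH[OF i]])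
    finally show ?thesis .
  qed
  have "b (v y) = v (b y)" for y
  proof -
    have "y \<in> span (?e ` ?I)" using span by blast
    then show ?thesis
    proof (induction rule: span_induct_alt)
      case (step c y z)
      obtain i k j where ikj: "i < length gs" "y = [:0, 1:] ^ j \<star> gen gs i k"
        using step(1) by (rule gen_vecE[OF gs])
      have "b (v y) = b (([:0, 1:] * [:0, 1:] ^ j) \<star> gen gs i k)"
        by (simp only: ikj(2) act.scale_scale[symmetric] act_X)
      also have "\<dots> = ([:0, 1:] * [:0, 1:] ^ j) \<star> H i k" by (rule b_G[OF ikj(1)])
      also have "\<dots> = v (b y)"
        by (simp only: ikj(2) b_G[OF ikj(1)] act.scale_scale[symmetric] act_X)
      finally show ?case using step by (simp add: v.add v.scale b.add b.scale)
    qed (simp add: v.zero b.zero)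
  qed
  moreover have "b x = y \<and> b (u x) = y'" if mem: "(f, x, y, y') \<in> set w" for f x y y'
  proof -
    obtain i where i: "i < length w" "w ! i = (f, x, y, y')" using mem unfolding in_set_conv_nth by blast
    then show ?thesis using b_G[of i 1 False] b_G[of i 1 True] len[OF i(1)] nth[OF i(1)]
      by (simp add: gen_def H_def)
  qed
  ultimately show ?thesis using b(1) by blast
qed

section \<open>Reconstruction of \<open>b\<close> from a decomposition into blocks\<close>

context
  fixes l m be :: 'a
begin

text \<open>The value that \<open>b (u x)\<close> must take when \<open>b x = y\<close>.\<close>

definition twist :: "'v \<Rightarrow> 'v \<Rightarrow> 'v" where
  "twist x y = ([:l:] - [:m:] * [:0, 1:]) \<star> x + [:m:] \<star> u x + [:0, 1:] \<star> y - u y"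

text \<open>The relation \<open>q(b) = 0\<close> at the generators. It is quantified over all maps
  with the prescribed values so that it can be verified block by block before a single
  \<open>b\<close> is constructed.\<close>

definition compatible :: "('a poly \<times> 'v \<times> 'v) list \<Rightarrow> bool" where
  "compatible w \<longleftrightarrow> (\<forall>b. Vector_Spaces.linear scale scale b \<longrightarrow> (\<forall>x. b (v x) = v (b x)) \<longrightarrow>
     (\<forall>(f, x, y) \<in> set w. b x = y \<and> b (u x) = twist x y) \<longrightarrow>
     (\<forall>(f, x, y) \<in> set w. b y = [:m:] \<star> y - [:be:] \<star> x))"

text \<open>For each of the two relations on \<open>b\<close>, the set of vectors where it holds is
  stable under \<open>u\<close> and contains the generators, hence is everything. The commutation
  relation comes first, since it enters the stability for the quadratic one.\<close>

lemma compatible_quat_module: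
  assumes "be \<noteq> 0" and gens: "cyclic_gens (map (\<lambda>(f, x, y). (f, x)) w) UNIV"
    and tgt: "\<forall>(f, x, y) \<in> set w. f \<star> y = 0" and comp: "compatible w"
  shows "\<exists>b. quat_module scale Basis u v \<delta> b l m be"
proof -
  let ?w = "map (\<lambda>(f, x, y). (f, x, y, twist x y)) w"
  have g': "cyclic_gens (map (\<lambda>(f, x, y, y'). (f, x)) ?w) UNIV"
    using gens by (simp add: comp_def case_prod_unfold)
  have "f \<star> twist x y = 0" if "(f, x, y) \<in> set w" for f x y
  proof -
    have fx: "f \<star> x = 0" "f \<star> y = 0" using that gens tgt by (auto simp: cyclic_gens_def)
    have z: "f \<star> (c \<star> s) = 0" "f \<star> u s = 0" if "f \<star> s = 0" for c s
      using that u_act[of f s] act.scale_left_commute[of f c s] by (simp_all add: u.zero)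
    have "f \<star> twist x y = f \<star> (([:l:] - [:m:] * [:0, 1:]) \<star> x) + f \<star> ([:m:] \<star> u x)
        + f \<star> ([:0, 1:] \<star> y) - f \<star> u y"
      unfolding twist_def by (simp only: act.scale_right_distrib act.scale_right_diff_distrib)
    then show ?thesis
      unfolding z(1)[OF fx(1)] z(1)[OF z(2)[OF fx(1)]] z(1)[OF fx(2)] z(2)[OF fx(2)] by simp
  qed
  then have t': "\<forall>(f, x, y, y') \<in> set ?w. f \<star> y = 0 \<and> f \<star> y' = 0" using tgt by auto
  obtain b where b: "Vector_Spaces.linear scale scale b" "\<forall>x. b (v x) = v (b x)"
    "\<forall>(f, x, y, y') \<in> set ?w. b x = y \<and> b (u x) = y'"
    using cyclic_gens_linear_extension[OF g' t'] by blast
  interpret b: Vector_Spaces.linear scale scale b by (rule b(1))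
  have bx: "b x = y" "b (u x) = twist x y" if "(f, x, y) \<in> set w" for f x y
    using b(3) that by auto
  have byy: "b y = [:m:] \<star> y - [:be:] \<star> x" if "(f, x, y) \<in> set w" for f x y
    using comp b(1,2) bx that unfolding compatible_def by blast
  have b_act: "b (g \<star> x) = g \<star> b x" for g x using act_commute[OF b(1)] b(2) by blast
  have S_all: "S = UNIV" if "u_stable S" "\<And>f x y. (f, x, y) \<in> set w \<Longrightarrow> x \<in> S" for S
  proof -
    have "snd ` set (map (\<lambda>(f, x, y). (f, x)) w) \<subseteq> S" using that(2) by auto
    then show ?thesis using gens that(1) unfolding cyclic_gens_def by blast
  qed
  have twist_add: "twist (x + x') (y + y') = twist x y + twist x' y'"
    and twist_scale: "twist (scale c x) (scale c y) = scale c (twist x y)" for x x' y y' c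
    unfolding twist_def
    by (simp_all add: act.scale_right_distrib act_scale u.add u.scale scale_right_distrib scale_right_diff_distrib
        del: mult_pCons_left mult_pCons_right)
  let ?S = "{s. b (u s) = twist s (b s)}"
  have sS: "subspace ?S"
  proof (rule subspaceI)
    have "twist 0 0 = 0" by (simp add: twist_def u.zero)
    then show "0 \<in> ?S" by (simp add: u.zero b.zero)
  qed (simp_all add: u.add u.scale b.add b.scale twist_add twist_scale)
  have "b (u (u s)) = twist (u s) (b (u s))" if s: "b (u s) = twist s (b s)" for s
  proof -
    have "b (u (u s)) = [:0, 1:] \<star> b (u s) - [:\<delta>:] \<star> b s"
      by (simp only: u_u b.diff b_act)
    moreover have "u (b (u s)) = ([:l:] - [:m:] * [:0, 1:]) \<star> u s + [:m:] \<star> u (u s) + [:\<delta>:] \<star> b s"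
      unfolding s twist_def u.add u.diff u_act u_u[of "b s"] by simp
    ultimately show ?thesis unfolding twist_def by simp
  qed
  then have "u_stable ?S" using sS by (auto simp: u_stable_def)
  then have "?S = UNIV" using bx by (intro S_all) auto
  then have b_u: "b (u s) = twist s (b s)" for s by blast
  let ?S' = "{s. b (b s) = [:m:] \<star> b s - [:be:] \<star> s}"
  have sS': "subspace ?S'"
    by (rule subspaceI) (simp_all add: b.zero b.add b.scale act.scale_right_distrib act_scale scale_right_diff_distrib)
  have "b (b (u s)) = [:m:] \<star> b (u s) - [:be:] \<star> u s" if s: "b (b s) = [:m:] \<star> b s - [:be:] \<star> s" for s
  proof -
    have "b (b (u s)) = ([:l:] - [:m:] * [:0, 1:]) \<star> b s + [:m:] \<star> b (u s) + [:0, 1:] \<star> b (b s) - b (u (b s))"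
      unfolding b_u[of s] twist_def b.add b.diff b_act ..
    also have "\<dots> = [:m:] \<star> b (u s) - [:m:] \<star> u (b s) + u (b (b s))"
      unfolding b_u[of "b s"] twist_def by simp
    also have "\<dots> = [:m:] \<star> b (u s) - [:be:] \<star> u s"
      unfolding s u.diff u_act by simp
    finally show ?thesis .
  qed
  then have "u_stable ?S'" using sS' by (auto simp: u_stable_def)
  then have "?S' = UNIV" using bx(1) byy by (intro S_all) auto
  then have b_b: "b (b s) = [:m:] \<star> b s - [:be:] \<star> s" for s by blast
  have "quat_module scale Basis u v \<delta> b l m be"
  proof unfold_locales
    show "b (u x) = scale l x - scale m (v x) + scale m (u x) + v (b x) - u (b x)" for x
      unfolding b_u twist_def
      by (simp only: act.scale_left_diff_distrib act.scale_scale[symmetric] act_const act_X)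
  qed (use b(2) b_b \<open>be \<noteq> 0\<close> in \<open>simp_all add: act_const b.add b.scale\<close>)
  then show ?thesis by blast
qed

lemma block_multiset_compatible:
  assumes "block_multiset good F"
    and good: "\<And>r. good r \<Longrightarrow> irreducible r \<and> \<not> r dvd disc_poly \<delta> l m be \<and>
      (\<exists>x z. r dvd conic [:0, 1:] [:\<delta>:] [:l:] [:m:] [:be:] x z)"
    and "mset (map fst gs) = F" "\<forall>(f, x) \<in> set gs. f \<star> x = 0"
  shows "\<exists>w. mset (map (\<lambda>(f, x, y). (f, x)) w) = mset gs \<and>
    (\<forall>(f, x, y) \<in> set w. f \<star> y = 0) \<and> compatible w"
  using assms(1,3,4)
proof (induction F arbitrary: gs)
  case empty
  then have "gs = []" by simp
  then show ?case by (intro exI[of _ "[]"]) (simp add: compatible_def)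
next
  case (single r n F)
  obtain fs where fs: "F = mset fs" by (metis ex_mset)
  have "mset (map fst gs) = mset (r ^ n # fs)" using single.prems(1) fs by simp
  from mset_map_eq_mset[OF this] obtain gs'
    where "mset gs' = mset gs \<and> map fst gs' = r ^ n # fs" ..
  then have gs': "mset gs' = mset gs" "map fst gs' = r ^ n # fs" by simp_all
  from gs'(2) obtain x gs1 where gs1: "gs' = (r ^ n, x) # gs1" "map fst gs1 = fs" by (cases gs') auto
  have set: "set gs = set gs'" using gs'(1) mset_eq_setD by metis
  have ann: "r ^ n \<star> x = 0" "\<forall>(f, x) \<in> set gs1. f \<star> x = 0" using single.prems(2) gs1 set by auto
  obtain w where w: "mset (map (\<lambda>(f, x, y). (f, x)) w) = mset gs1" "\<forall>(f, x, y) \<in> set w. f \<star> y = 0" "compatible w"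
    using single.IH[of gs1] gs1(2) fs ann(2) by auto
  obtain x0 z0 where "r ^ n dvd conic [:0, 1:] [:\<delta>:] [:l:] [:m:] [:be:] x0 z0"
    using conic_hensel good[OF single.hyps(1)] unfolding disc_poly_def by metis
  then have Q: "conic [:0, 1:] [:\<delta>:] [:l:] [:m:] [:be:] x0 z0 \<star> x = 0"
    using ann(1) by (metis act.scale_scale act.scale_zero_right dvdE mult.commute)
  let ?y = "x0 \<star> x + z0 \<star> u x"
  have "r ^ n \<star> ?y = 0"
  proof -
    have "r ^ n \<star> ?y = x0 \<star> (r ^ n \<star> x) + z0 \<star> u (r ^ n \<star> x)"
      by (simp add: act.scale_right_distrib u_act mult.commute)
    then show ?thesis unfolding ann(1) by (simp add: u.zero)
  qed
  moreover have "compatible ((r ^ n, x, ?y) # w)"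
    unfolding compatible_def
  proof (intro allI impI)
    fix b assume b: "Vector_Spaces.linear scale scale b" "\<forall>x. b (v x) = v (b x)"
      "\<forall>(f, x, y) \<in> set ((r ^ n, x, ?y) # w). b x = y \<and> b (u x) = twist x y"
    interpret b: Vector_Spaces.linear scale scale b by (rule b(1))
    have b_act: "b (g \<star> x) = g \<star> b x" for g x using act_commute[OF b(1)] b(2) by blast
    have "b x = ?y" "b (u x) = twist x ?y" using b(3) by auto
    then have "b ?y = x0 \<star> ?y + z0 \<star> twist x ?y" by (simp only: b.add b_act)
    \<comment> \<open>The conic arises here: its value at \<open>(x0, z0)\<close> is the obstruction
      to \<open>q(b) x = 0\<close>.\<close>
    also have "\<dots> = [:m:] \<star> ?y - [:be:] \<star> x + conic [:0, 1:] [:\<delta>:] [:l:] [:m:] [:be:] x0 z0 \<star> x"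
      unfolding twist_def u.add u_act u_u conic_def quad_norm_def
      by (simp add: algebra_simps power2_eq_square del: mult_pCons_left mult_pCons_right minus_pCons add_pCons diff_pCons)
    finally have "b ?y = [:m:] \<star> ?y - [:be:] \<star> x" unfolding Q by simp
    moreover have "\<forall>(f, x, y) \<in> set w. b y = [:m:] \<star> y - [:be:] \<star> x"
      using w(3) b unfolding compatible_def by simp
    ultimately show "\<forall>(f, x, y) \<in> set ((r ^ n, x, ?y) # w). b y = [:m:] \<star> y - [:be:] \<star> x" by simp
  qed
  ultimately show ?case using w(1,2) gs'(1) gs1(1) by (intro exI[of _ "(r ^ n, x, ?y) # w"]) simp
next
  case (double r n F)
  obtain fs where fs: "F = mset fs" by (metis ex_mset)
  have "mset (map fst gs) = mset (r ^ n # r ^ n # fs)" using double.prems(1) fs by simp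
  from mset_map_eq_mset[OF this] obtain gs'
    where "mset gs' = mset gs \<and> map fst gs' = r ^ n # r ^ n # fs" ..
  then have gs': "mset gs' = mset gs" "map fst gs' = r ^ n # r ^ n # fs" by simp_all
  from gs'(2) obtain x x' gs1 where gs1: "gs' = (r ^ n, x) # (r ^ n, x') # gs1" "map fst gs1 = fs"
    by (cases gs'; cases "tl gs'") auto
  have set: "set gs = set gs'" using gs'(1) mset_eq_setD by metis
  have ann: "r ^ n \<star> x = 0" "r ^ n \<star> x' = 0" "\<forall>(f, x) \<in> set gs1. f \<star> x = 0"
    using double.prems(2) gs1 set by auto
  obtain w where w: "mset (map (\<lambda>(f, x, y). (f, x)) w) = mset gs1" "\<forall>(f, x, y) \<in> set w. f \<star> y = 0" "compatible w"
    using double.IH[of gs1] gs1(2) fs ann(3) by auto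
  let ?y = "[:m:] \<star> x' - [:be:] \<star> x"
  let ?w = "(r ^ n, x, x') # (r ^ n, x', ?y) # w"
  have "r ^ n \<star> ?y = 0"
  proof -
    have "r ^ n \<star> ?y = [:m:] \<star> (r ^ n \<star> x') - [:be:] \<star> (r ^ n \<star> x)"
      by (simp add: act.scale_right_diff_distrib mult.commute del: mult_pCons_left mult_pCons_right)
    then show ?thesis unfolding ann by simp
  qed
  moreover have "compatible ?w"
    unfolding compatible_def
  proof (intro allI impI)
    fix b assume b: "Vector_Spaces.linear scale scale b" "\<forall>x. b (v x) = v (b x)"
      "\<forall>(f, x, y) \<in> set ?w. b x = y \<and> b (u x) = twist x y"
    interpret b: Vector_Spaces.linear scale scale b by (rule b(1))
    have b_act: "b (g \<star> x) = g \<star> b x" for g x using act_commute[OF b(1)] b(2) by blast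
    have "b x = x'" "b x' = ?y" using b(3) by auto
    then have "b ?y = [:m:] \<star> ?y - [:be:] \<star> x'" by (simp only: b.diff b_act)
    moreover have "\<forall>(f, x, y) \<in> set w. b y = [:m:] \<star> y - [:be:] \<star> x"
      using w(3) b unfolding compatible_def by simp
    ultimately show "\<forall>(f, x, y) \<in> set ?w. b y = [:m:] \<star> y - [:be:] \<star> x"
      using \<open>b x' = ?y\<close> by simp
  qed
  ultimately show ?case using w(1,2) gs'(1) gs1(1) ann by (intro exI[of _ ?w]) simp
qed

end

end

section \<open>Elementary divisors and invariant factors\<close>

text \<open>Substitution of \<open>t + \<delta> / t\<close> is a ring homomorphism into the field of
  fractions, and the degrees in the prefactors add up for nonzero polynomials.\<close>

lemma R_poly_mult:
  fixes f g :: "'a::field poly"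
  assumes "f \<noteq> 0" "g \<noteq> 0"
  shows "R_poly \<delta> (f * g) = R_poly \<delta> f * R_poly \<delta> g"
proof -
  define w :: "'a poly fract" where "w = to_fract [:0, 1:] + to_fract [:\<delta>:] * inverse (to_fract [:0, 1:])"
  define E where "E h = poly (map_poly (\<lambda>c. to_fract [:c:]) h) w" for h :: "'a poly"
  have E0: "E 0 = 0" by (simp add: E_def)
  have Ep: "E (pCons c h) = to_fract [:c:] + w * E h" for c h
    by (simp add: E_def Polynomial.map_poly_pCons)
  have Ea: "E (h + k) = E h + E k" for h k
  proof (induction h k rule: poly_induct2)
    case (pCons c h d k)
    have "to_fract [:c + d:] = to_fract [:c:] + to_fract [:d:]" by (simp flip: to_fract_add)
    then show ?case using pCons by (simp add: Ep algebra_simps)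
  qed (simp add: E0)
  have Es: "E (smult c h) = to_fract [:c:] * E h" for c h
  proof (induction h)
    case (pCons d h)
    have "to_fract [:c * d:] = to_fract [:c:] * to_fract [:d:]" by (simp flip: to_fract_mult)
    then show ?case using pCons by (simp add: Ep algebra_simps)
  qed (simp add: E0)
  have Em: "E (h * k) = E h * E k" for h k
  proof (induction h)
    case (pCons d h)
    then show ?case by (simp add: Ep Ea Es algebra_simps)
  qed (simp add: E0)
  have "to_fract (R_poly \<delta> h) = to_fract [:0, 1:] ^ degree h * E h" for h
    unfolding E_def w_def by (rule to_fract_R_poly)
  then have "to_fract (R_poly \<delta> (f * g)) = to_fract (R_poly \<delta> f * R_poly \<delta> g)"
    using assms by (simp add: Em degree_mult_eq power_add)
  then show ?thesis unfolding to_fract_eq_iff .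
qed

lemma R_poly_dvd:
  fixes f g :: "'a::field poly"
  assumes "f dvd g" "g \<noteq> 0"
  shows "R_poly \<delta> f dvd R_poly \<delta> g"
  using assms by (elim dvdE) (simp add: R_poly_mult)

lemma R_poly_1 [simp]: "R_poly \<delta> 1 = 1"
  by (simp add: R_poly_def)

lemma block_multiset_add:
  "block_multiset good F \<Longrightarrow> block_multiset good G \<Longrightarrow> block_multiset good (F + G)"
  by (induction rule: block_multiset.induct) (auto intro: block_multiset.intros)

lemma block_multiset_sum:
  "(\<And>i. i \<in> A \<Longrightarrow> block_multiset good (F i)) \<Longrightarrow> block_multiset good (\<Sum>i\<in>A. F i)"
  by (induction A rule: infinite_finite_induct) (auto intro: block_multiset_add block_multiset.empty)

lemma block_multiset_monic:
  assumes "block_multiset good F" "\<And>r. good r \<Longrightarrow> monic r" "f \<in># F"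
  shows "monic f"
  using assms by (induction rule: block_multiset.induct) (auto simp: monic_power)

lemma sum_consecutive_pairs:
  fixes g :: "nat \<Rightarrow> 'b::comm_monoid_add"
  shows "(\<Sum>i\<in>{1..2 * N}. g i) = (\<Sum>n\<in>{1..N}. g (2 * n - 1) + g (2 * n))"
  by (induction N) (simp_all add: add.assoc)

lemma sorted_even_counts:
  fixes xs :: "nat list"
  assumes "sorted_wrt (\<ge>) xs" "\<And>n. even (count_list xs n)"
  shows "even (length xs) \<and> (\<forall>k. 2 * k + 1 < length xs \<longrightarrow> xs ! (2 * k) = xs ! (2 * k + 1))"
  using assms
proof (induction "length xs" arbitrary: xs rule: less_induct)
  case less
  show ?case
  proof (cases xs)
    case (Cons a ys)
    have "count_list ys a \<noteq> 0"
    proof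
      assume "count_list ys a = 0"
      then have "count_list xs a = 1" using Cons by simp
      then show False using less.prems(2)[of a] by simp
    qed
    then have a: "a \<in> set ys" by (metis count_list_0_iff)
    then obtain b zs where ys: "ys = b # zs" by (cases ys) auto
    have "b = a" using less.prems(1) a Cons ys by (auto intro: antisym)
    have "even (count_list zs n)" for n
      using less.prems(2)[of n] unfolding Cons ys \<open>b = a\<close> by (simp split: if_splits)
    then have IH: "even (length zs) \<and> (\<forall>k. 2 * k + 1 < length zs \<longrightarrow> zs ! (2 * k) = zs ! (2 * k + 1))"
      using less.hyps[of zs] less.prems(1) Cons ys by simp
    have "xs ! (2 * k) = xs ! (2 * k + 1)" if "2 * k + 1 < length xs" for k
      using IH that unfolding Cons ys \<open>b = a\<close> by (cases k) auto
    then show ?thesis using IH Cons ys by simp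
  qed simp
qed

lemma sum_image_mset_insert:
  fixes E :: "'b \<Rightarrow> 'c multiset"
  assumes "finite A" "\<forall>s. s \<notin> A \<longrightarrow> E s = {#}"
  shows "(\<Sum>s\<in>insert r A. image_mset (h s) ((E(r := G + E r)) s)) =
    image_mset (h r) G + (\<Sum>s\<in>A. image_mset (h s) (E s))"
proof -
  have "(\<Sum>s\<in>A. image_mset (h s) (E s)) = (\<Sum>s\<in>insert r A. image_mset (h s) (E s))"
    using assms by (intro sum.mono_neutral_left) auto
  then show ?thesis using assms(1) by (simp add: sum.insert_remove add.assoc)
qed

text \<open>\<open>E r\<close> collects the exponents of the blocks of \<open>r\<close>. A double
  block preserves every parity, and a single block changes one only at a \<open>good\<close>
  irreducible.\<close>

lemma block_multiset_exponents:
  assumes "block_multiset good F" "\<And>r. good r \<Longrightarrow> irreducible r \<and> monic r"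
  shows "\<exists>A E. finite A \<and> (\<forall>r\<in>A. irreducible r \<and> monic r) \<and> (\<forall>r. r \<notin> A \<longrightarrow> E r = {#}) \<and>
    F = (\<Sum>r\<in>A. image_mset (\<lambda>n. r ^ n) (E r)) \<and>
    (\<forall>r n. \<not> good r \<longrightarrow> even (count (E r) n))"
  using assms(1)
proof (induction rule: block_multiset.induct)
  case empty
  show ?case by (intro exI[of _ "{}"] exI[of _ "\<lambda>_. {#}"]) simp
next
  case (single r n F)
  then obtain A E where AE: "finite A" "\<forall>r\<in>A. irreducible r \<and> monic r" "\<forall>r. r \<notin> A \<longrightarrow> E r = {#}"
    "F = (\<Sum>r\<in>A. image_mset (\<lambda>n. r ^ n) (E r))" "\<forall>r n. \<not> good r \<longrightarrow> even (count (E r) n)" by blast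
  let ?E = "E(r := {#n#} + E r)"
  have "add_mset (r ^ n) F = (\<Sum>s\<in>insert r A. image_mset (\<lambda>n. s ^ n) (?E s))"
    using sum_image_mset_insert[OF AE(1,3), of "\<lambda>s n. s ^ n" r "{#n#}"] AE(4) by simp
  moreover have "\<forall>s k. \<not> good s \<longrightarrow> even (count (?E s) k)" using AE(5) single.hyps(1) by auto
  ultimately show ?case using AE(1-3) assms(2)[OF single.hyps(1)]
    by (intro exI[of _ "insert r A"] exI[of _ ?E]) auto
next
  case (double r n F)
  then obtain A E where AE: "finite A" "\<forall>r\<in>A. irreducible r \<and> monic r" "\<forall>r. r \<notin> A \<longrightarrow> E r = {#}"
    "F = (\<Sum>r\<in>A. image_mset (\<lambda>n. r ^ n) (E r))" "\<forall>r n. \<not> good r \<longrightarrow> even (count (E r) n)" by blast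
  let ?E = "E(r := {#n, n#} + E r)"
  have "add_mset (r ^ n) (add_mset (r ^ n) F) = (\<Sum>s\<in>insert r A. image_mset (\<lambda>n. s ^ n) (?E s))"
    using sum_image_mset_insert[OF AE(1,3), of "\<lambda>s n. s ^ n" r "{#n, n#}"] AE(4) by simp
  moreover have "\<forall>s k. \<not> good s \<longrightarrow> even (count (?E s) k)" using AE(5) by auto
  ultimately show ?case using AE(1-3) double.hyps(1,2)
    by (intro exI[of _ "insert r A"] exI[of _ ?E]) auto
qed

lemma filter_mset_sum: "filter_mset Q (\<Sum>i\<in>I. h i) = (\<Sum>i\<in>I. filter_mset Q (h i))"
  by (induction I rule: infinite_finite_induct) simp_all

lemma image_mset_mset_set_sum:
  "finite A \<Longrightarrow> image_mset h (mset_set A) = (\<Sum>a\<in>A. {#h a#})"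
  by (induction A rule: finite_induct) simp_all

section \<open>Regrouping invariant factors and prime-power blocks\<close>

context quadratic_over
begin

lemma cyclic_decomp_remove_ones:
  assumes "u_stable T"
  shows "cyclic_decomp F T \<longleftrightarrow> cyclic_decomp (filter_mset (\<lambda>f. f \<noteq> 1) F) T"
proof -
  have "cyclic_decomp (F + G) T \<longleftrightarrow> cyclic_decomp (filter_mset (\<lambda>f. f \<noteq> 1) F + G) T" for G
  proof (induction F arbitrary: G)
    case (add f F)
    show ?case
    proof (cases "f = 1")
      case True
      then show ?thesis using add.IH[of G] cyclic_decomp_one[OF assms] by simp
    next
      case False
      then show ?thesis using add.IH[of "add_mset f G"] by simp
    qed
  qed simp
  from this[of "{#}"] show ?thesis by simp
qed

lemma cyclic_decomp_factor:
  assumes "u_stable T" "finite A" "\<forall>r\<in>A. irreducible r \<and> monic r" "finite J"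
    and P: "\<And>i. i \<in> J \<Longrightarrow> P i = (\<Prod>r\<in>A. r ^ e r i)"
  shows "cyclic_decomp (\<Sum>i\<in>J. {#P i#}) T \<longleftrightarrow> cyclic_decomp (\<Sum>r\<in>A. \<Sum>i\<in>J. {#r ^ e r i#}) T"
proof -
  have "cyclic_decomp ((\<Sum>i\<in>J. {#P i#}) + G) T \<longleftrightarrow>
      cyclic_decomp ((\<Sum>i\<in>J. \<Sum>r\<in>A. {#r ^ e r i#}) + G) T" for G
    using assms(4) P
  proof (induction J arbitrary: G rule: finite_induct)
    case (insert i J)
    have "cyclic_decomp ((\<Sum>i\<in>insert i J. {#P i#}) + G) T \<longleftrightarrow>
        cyclic_decomp ((\<Sum>i\<in>J. {#P i#}) + add_mset (P i) G) T"
      using insert.hyps by simp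
    also have "\<dots> \<longleftrightarrow> cyclic_decomp ((\<Sum>i\<in>J. \<Sum>r\<in>A. {#r ^ e r i#}) + add_mset (P i) G) T"
      by (rule insert.IH) (use insert.prems in auto)
    also have "\<dots> \<longleftrightarrow> cyclic_decomp (add_mset (\<Prod>r\<in>A. r ^ e r i) ((\<Sum>i\<in>J. \<Sum>r\<in>A. {#r ^ e r i#}) + G)) T"
      using insert.prems[of i] by simp
    also have "\<dots> \<longleftrightarrow> cyclic_decomp ((\<Sum>r\<in>A. {#r ^ e r i#}) + ((\<Sum>i\<in>J. \<Sum>r\<in>A. {#r ^ e r i#}) + G)) T"
      unfolding image_mset_mset_set_sum[OF assms(2), symmetric]
      by (rule cyclic_decomp_prod) (use assms(1-3) in \<open>auto simp: monic_power intro!: monic_irreducible_comaximal\<close>)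
    also have "\<dots> \<longleftrightarrow> cyclic_decomp ((\<Sum>i\<in>insert i J. \<Sum>r\<in>A. {#r ^ e r i#}) + G) T"
      using insert.hyps by (simp add: add.assoc)
    finally show ?case .
  qed simp
  from this[of "{#}"] show ?thesis by (simp add: sum.swap[of _ J A])
qed

text \<open>If \<open>x\<close> were 0, the other generators would generate everything, but their
  stable span has too small a dimension.\<close>

lemma cyclic_gens_nonzero:
  assumes "cyclic_gens ((f, x) # gs) T" "degree f > 0"
  shows "x \<noteq> 0"
proof
  assume "x = 0"
  obtain S where S: "u_stable S" "snd ` set gs \<subseteq> S" "dim S \<le> (\<Sum>(f, x)\<leftarrow>gs. 2 * degree f)"
    using u_stable_gens_dim[of gs] assms(1) by (auto simp: cyclic_gens_def)
  have "snd ` set ((f, x) # gs) \<subseteq> S" using S(1,2) \<open>x = 0\<close> by (auto simp: u_stable_def subspace_0)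
  then have "T \<subseteq> S" using assms(1) S(1) by (simp only: cyclic_gens_def)
  then have "dim T \<le> dim S" by (rule dim_subset)
  then show False using S(3) assms by (simp add: cyclic_gens_def)
qed

text \<open>Excludes the irreducible divisors of the discriminant, which have neither type: such an
  \<open>r\<close> would act injectively, so the generator of a block \<open>r^n\<close> would be
  0.\<close>

lemma cyclic_decomp_regular:
  assumes F: "cyclic_decomp F T" "r ^ n \<in># F" and r: "irreducible r" "n \<ge> 1"
    and d: "\<And>x. d \<star> x = 0 \<Longrightarrow> x = 0"
  shows "\<not> r dvd d"
proof
  assume "r dvd d"
  then have inj: "x = 0" if "r \<star> x = 0" for x
    using d that by (metis act.scale_scale act.scale_zero_right dvdE mult.commute)
  obtain G where G: "F = add_mset (r ^ n) G" using F(2) by (metis multi_member_split)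
  obtain fs where fs: "G = mset fs" by (metis ex_mset)
  have "cyclic_decomp (mset (r ^ n # fs)) T" using F(1) G fs by simp
  then obtain xs where xs: "length xs = length (r ^ n # fs)" "cyclic_gens (zip (r ^ n # fs) xs) T"
    by (rule cyclic_gens_sorted)
  then obtain x ys where x: "xs = x # ys" by (cases xs) auto
  have gens: "cyclic_gens ((r ^ n, x) # zip fs ys) T" using xs x by simp
  then have "r ^ n \<star> x = 0" by (simp add: cyclic_gens_def)
  then have "x = 0"
  proof (induction n)
    case (Suc n)
    then have "r \<star> (r ^ n \<star> x) = 0" by simp
    then show ?case using Suc.IH inj by blast
  qed simp
  moreover have "r \<noteq> 0" "\<not> r dvd 1" using r(1) by (auto simp: irreducible_def)
  then have "degree (r ^ n) > 0" using r(2) is_unit_iff_degree[of r] by (simp add: degree_power_eq)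
  ultimately show False using cyclic_gens_nonzero[OF gens] by simp
qed

text \<open>Each \<open>P i\<close> splits into prime powers. At an irreducible that is not
  \<open>good\<close>, the exponents of \<open>P (2n-1)\<close> and \<open>P (2n)\<close> agree and
  form a double block; \<open>d\<close> will be the discriminant.\<close>

lemma invariant_factors_imp_blocks:
  fixes P :: "nat \<Rightarrow> 'a poly"
  assumes d: "\<And>x. d \<star> x = 0 \<Longrightarrow> x = 0"
    and P: "\<And>i. i \<ge> 1 \<Longrightarrow> monic (P i)" "\<And>i. i > N \<Longrightarrow> P i = 1"
    and decomp: "cyclic_decomp (\<Sum>i\<in>{1..N}. {#P i#}) UNIV"
    and val: "\<And>r n. irreducible r \<Longrightarrow> monic r \<Longrightarrow> \<not> r dvd d \<Longrightarrow> \<not> good r \<Longrightarrow> n \<ge> 1 \<Longrightarrow>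
      poly_valuation r (P (2 * n - 1)) = poly_valuation r (P (2 * n))"
  shows "\<exists>F. block_multiset good F \<and> cyclic_decomp F UNIV"
proof -
  \<comment> \<open>Indices run to \<open>2 * N\<close> so that they fall into complete pairs
    \<open>(2n-1, 2n)\<close>; the added polynomials are 1.\<close>
  let ?J = "{1..2 * N}"
  define e where "e r i = poly_valuation r (P i)" for r i
  have "\<forall>i\<in>?J. \<exists>A c. finite A \<and> (\<forall>s\<in>A. irreducible s \<and> monic s) \<and> P i = (\<Prod>s\<in>A. s ^ c s)"
    using monic_factorization[OF P(1)] by auto
  then obtain B c where B: "\<And>i. i \<in> ?J \<Longrightarrow> finite (B i)"
    "\<And>i s. i \<in> ?J \<Longrightarrow> s \<in> B i \<Longrightarrow> irreducible s \<and> monic s"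
    "\<And>i. i \<in> ?J \<Longrightarrow> P i = (\<Prod>s\<in>B i. s ^ c i s)" by metis
  define A where "A = (\<Union>i\<in>?J. B i)"
  have A: "finite A" "\<forall>s\<in>A. irreducible s \<and> monic s" using B(1,2) by (auto simp: A_def)
  have PA: "P i = (\<Prod>r\<in>A. r ^ e r i)" if i: "i \<in> ?J" for i
    unfolding e_def
  proof (rule monic_factorization_valuation[OF _ A])
    show "monic (P i)" using P(1) i by simp
    fix s assume s: "irreducible s" "monic s" "s dvd P i"
    then have "s \<in> B i" using monic_irreducible_prod_not_dvd[of "B i" s "c i"] B i by auto
    then show "s \<in> A" using i by (auto simp: A_def)
  qed
  have "(\<Sum>i\<in>?J. filter_mset (\<lambda>f. f \<noteq> 1) {#P i#}) = (\<Sum>i\<in>{1..N}. filter_mset (\<lambda>f. f \<noteq> 1) {#P i#})"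
    using P(2) by (intro sum.mono_neutral_right) auto
  then have "cyclic_decomp (\<Sum>i\<in>?J. {#P i#}) UNIV"
    using decomp cyclic_decomp_remove_ones[of UNIV "\<Sum>i\<in>?J. {#P i#}"]
      cyclic_decomp_remove_ones[of UNIV "\<Sum>i\<in>{1..N}. {#P i#}"]
    by (simp only: filter_mset_sum u_stable_UNIV)
  then have dec: "cyclic_decomp (\<Sum>r\<in>A. \<Sum>i\<in>?J. {#r ^ e r i#}) UNIV"
    using cyclic_decomp_factor[OF u_stable_UNIV A, of ?J P e] PA by simp
  let ?F = "\<Sum>r\<in>A. \<Sum>i\<in>?J. filter_mset (\<lambda>f. f \<noteq> 1) {#r ^ e r i#}"
  have decF: "cyclic_decomp ?F UNIV"
    using iffD1[OF cyclic_decomp_remove_ones[OF u_stable_UNIV] dec] by (simp only: filter_mset_sum)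
  have block: "block_multiset good (\<Sum>i\<in>?J. filter_mset (\<lambda>f. f \<noteq> 1) {#r ^ e r i#})" if r: "r \<in> A" for r
  proof -
    have irr: "irreducible r" "monic r" using A(2) r by auto
    have filt: "filter_mset (\<lambda>f. f \<noteq> 1) {#r ^ k#} = (if k = 0 then {#} else {#r ^ k#})" for k
    proof -
      have "r ^ k \<noteq> 1" if "k \<noteq> 0"
        using that irr(1) irreducible_not_unit by (metis dvd_power gr0I)
      then show ?thesis by auto
    qed
    \<comment> \<open>The hypothesis on valuations says nothing about divisors of \<open>d\<close>;
      at these all exponents turn out to be 0.\<close>
    have reg: "\<not> r dvd d" if "i \<in> ?J" "e r i \<noteq> 0" for i
    proof -
      have "r ^ e r i \<in># (\<Sum>r\<in>A. \<Sum>i\<in>?J. {#r ^ e r i#})"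
        using r that(1) A(1) by (auto simp: in_Union_mset_iff intro!: bexI[of _ r] bexI[of _ i] simp: set_mset_sum)
      from cyclic_decomp_regular[OF dec this irr(1) _ d] that(2) show ?thesis by simp
    qed
    show ?thesis
    proof (cases "good r")
      case True
      show ?thesis
        unfolding filt
        by (intro block_multiset_sum) (auto intro!: block_multiset.intros True)
    next
      case False
      show ?thesis
        unfolding sum_consecutive_pairs filt
      proof (intro block_multiset_sum)
        fix n assume n: "n \<in> {1..N}"
        have "e r (2 * n - 1) = e r (2 * n)"
        proof (cases "r dvd d")
          case True
          have "2 * n - 1 \<in> ?J" "2 * n \<in> ?J" using n by auto
          then have "e r (2 * n - 1) = 0" "e r (2 * n) = 0" using reg True by blast+
          then show ?thesis by simp
        next
          case nd: False
          then show ?thesis unfolding e_def using val[OF irr nd False] n by simp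
        qed
        then show "block_multiset good ((if e r (2 * n - 1) = 0 then {#} else {#r ^ e r (2 * n - 1)#}) +
            (if e r (2 * n) = 0 then {#} else {#r ^ e r (2 * n)#}))"
          using block_multiset.double[OF irr _ block_multiset.empty, of "e r (2 * n)" good]
          by (auto simp: add_mset_commute intro: block_multiset.empty)
      qed
    qed
  qed
  have "block_multiset good ?F" by (intro block_multiset_sum block)
  then show ?thesis using decF by blast
qed

text \<open>The \<open>i\<close>-th factor takes the \<open>i\<close>-th largest exponent at every
  irreducible simultaneously, which gives the divisibility chain. Where all multiplicities are even,
  equal exponents fall into consecutive places.\<close>

lemma blocks_imp_invariant_factors:
  assumes "block_multiset good F" and good: "\<And>r. good r \<Longrightarrow> irreducible r \<and> monic r"
    and decomp: "cyclic_decomp F UNIV"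
  shows "\<exists>P N. (\<forall>i\<ge>1. monic (P i)) \<and> (\<forall>i\<ge>1. P (Suc i) dvd P i) \<and> (\<forall>i>N. P i = 1) \<and>
    cyclic_decomp (\<Sum>i\<in>{1..N}. {#P i#}) UNIV \<and>
    (\<forall>r. irreducible r \<longrightarrow> monic r \<longrightarrow> \<not> good r \<longrightarrow>
      (\<forall>n\<ge>1. poly_valuation r (P (2 * n - 1)) = poly_valuation r (P (2 * n))))"
proof -
  obtain A E where A: "finite A" "\<forall>r\<in>A. irreducible r \<and> monic r"
    and F: "F = (\<Sum>r\<in>A. image_mset (\<lambda>n. r ^ n) (E r))"
    and even: "\<And>r n. \<not> good r \<Longrightarrow> even (count (E r) n)"
    using block_multiset_exponents[OF assms(1) good] by blast
  define L where "L r = rev (sorted_list_of_multiset (E r))" for r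
  have mset_L: "mset (L r) = E r" and sorted_L: "sorted_wrt (\<ge>) (L r)" for r
    by (simp_all add: L_def sorted_wrt_rev)
  \<comment> \<open>Factors are counted from 1 and list entries from 0, hence \<open>i - 1\<close>;
    exponents past the end of the list are 0.\<close>
  define e where "e r i = (if i - 1 < length (L r) then L r ! (i - 1) else 0)" for r i
  define N where "N = (\<Sum>r\<in>A. length (L r))"
  have N: "length (L r) \<le> N" if "r \<in> A" for r
    unfolding N_def using that A(1) by (intro member_le_sum) auto
  define P where "P i = (\<Prod>r\<in>A. r ^ e r i)" for i
  have "\<forall>i\<ge>1. monic (P i)" using A(2) by (auto simp: P_def intro!: monic_prod monic_power)
  moreover have "\<forall>i\<ge>1. P (Suc i) dvd P i"
  proof (intro allI impI)
    fix i :: nat assume i: "i \<ge> 1"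
    have "e r (Suc i) \<le> e r i" for r
      using i sorted_wrt_nth_less[OF sorted_L[of r], of "i - 1" i] by (auto simp: e_def)
    then show "P (Suc i) dvd P i"
      unfolding P_def by (intro prod_dvd_prod le_imp_power_dvd)
  qed
  moreover have "\<forall>i>N. P i = 1"
    using N by (fastforce simp: P_def e_def intro: prod.neutral)
  moreover have "cyclic_decomp (\<Sum>i\<in>{1..N}. {#P i#}) UNIV"
  proof -
    have e_list: "(\<Sum>i\<in>{1..N}. {#r ^ e r i#}) =
        image_mset (\<lambda>n. r ^ n) (E r) + replicate_mset (N - length (L r)) 1" if r: "r \<in> A" for r
    proof -
      have m: "map (e r) [1..<Suc N] = L r @ replicate (N - length (L r)) 0"
        using N[OF r] by (intro nth_equalityI) (auto simp: e_def nth_append simp del: upt_Suc)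
      have "(\<Sum>i\<in>{1..N}. {#r ^ e r i#}) = mset (map (\<lambda>i. r ^ e r i) [1..<Suc N])"
        by (simp add: image_mset_mset_set_sum[symmetric] atLeastLessThanSuc_atLeastAtMost
            del: upt_Suc)
      also have "\<dots> = image_mset (\<lambda>n. r ^ n) (mset (map (e r) [1..<Suc N]))"
        by (simp add: image_mset.compositionality comp_def del: upt_Suc)
      also have "\<dots> = image_mset (\<lambda>n. r ^ n) (E r) + replicate_mset (N - length (L r)) 1"
        unfolding m by (simp add: mset_L)
      finally show ?thesis .
    qed
    have "(\<Sum>r\<in>A. \<Sum>i\<in>{1..N}. {#r ^ e r i#}) =
        F + (\<Sum>r\<in>A. replicate_mset (N - length (L r)) 1)"
      unfolding F sum.distrib[symmetric] by (intro sum.cong refl) (rule e_list)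
    moreover have "filter_mset (\<lambda>f. f \<noteq> 1) (\<Sum>r\<in>A. replicate_mset (N - length (L r)) (1 :: 'a poly)) = {#}"
    proof -
      have "filter_mset (\<lambda>f. f \<noteq> 1) (replicate_mset n (1 :: 'a poly)) = {#}" for n
        by (induction n) simp_all
      then show ?thesis unfolding filter_mset_sum by (simp only: sum.neutral_const)
    qed
    ultimately have "filter_mset (\<lambda>f. f \<noteq> 1) (\<Sum>r\<in>A. \<Sum>i\<in>{1..N}. {#r ^ e r i#}) = filter_mset (\<lambda>f. f \<noteq> 1) F"
      by simp
    then have "cyclic_decomp (\<Sum>r\<in>A. \<Sum>i\<in>{1..N}. {#r ^ e r i#}) UNIV"
      using decomp cyclic_decomp_remove_ones[OF u_stable_UNIV, of F]
        cyclic_decomp_remove_ones[OF u_stable_UNIV, of "\<Sum>r\<in>A. \<Sum>i\<in>{1..N}. {#r ^ e r i#}"] by simp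
    then show ?thesis
      using cyclic_decomp_factor[OF u_stable_UNIV A, of "{1..N}" P e] by (simp add: P_def)
  qed
  moreover have "poly_valuation r (P (2 * n - 1)) = poly_valuation r (P (2 * n))"
    if r: "irreducible r" "monic r" "\<not> good r" and n: "n \<ge> 1" for r n
  proof -
    have "even (count_list (L r) k)" for k
      using even[OF r(3), of k] by (simp add: count_mset[symmetric] mset_L)
    then have ev: "even (length (L r))" "\<And>k. 2 * k + 1 < length (L r) \<Longrightarrow> L r ! (2 * k) = L r ! (2 * k + 1)"
      using sorted_even_counts[OF sorted_L[of r]] by auto
    obtain k where k: "n = Suc k" using n by (cases n) auto
    \<comment> \<open>These are the list positions \<open>2k\<close> and \<open>2k + 1\<close>. As
      the length is even, they lie both inside the list or both beyond it.\<close>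
    have "e r (2 * n - 1) = e r (2 * n)"
      using ev(1) ev(2)[of k] by (auto simp: e_def k elim!: evenE)
    then show ?thesis unfolding P_def poly_valuation_prod[OF A r(1,2)] by simp
  qed
  ultimately show ?thesis by blast
qed

end

section \<open>Blocks as matrices, and types expressed by the conic\<close>

definition block_matrix :: "('a::field poly \<Rightarrow> bool) \<Rightarrow> 'a \<Rightarrow> 'a mat \<Rightarrow> bool" where
  "block_matrix good \<delta> M \<longleftrightarrow>
     (\<exists>r n. good r \<and> n \<ge> 1 \<and> M = companion_mat (R_poly \<delta> (r ^ n))) \<or>
     (\<exists>r n. irreducible r \<and> monic r \<and> n \<ge> 1 \<and>
        M = diag_block_mat [companion_mat (R_poly \<delta> (r ^ n)), companion_mat (R_poly \<delta> (r ^ n))])"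

lemma diag_block_mat_cong_Cons:
  "diag_block_mat Ms = diag_block_mat Ls \<Longrightarrow> diag_block_mat (M # Ms) = diag_block_mat (M # Ls)"
  by simp

lemma diag_block_mat_Cons_diag:
  assumes "diag_block_mat Ms = diag_block_mat Ls"
  shows "diag_block_mat (diag_block_mat Ks # Ms) = diag_block_mat (Ks @ Ls)"
  using assms by (simp add: diag_block_mat_append Let_def)

text \<open>A double block is one entry of \<open>Ms\<close> but two entries of \<open>fs\<close>:
  flattening the nested block-diagonal matrices leaves the large matrix unchanged.\<close>

lemma block_matrices_imp_block_multiset:
  assumes "\<forall>M\<in>set Ms. block_matrix good \<delta> M"
  shows "\<exists>fs. block_multiset good (mset fs) \<and>
    diag_block_mat Ms = diag_block_mat (map (\<lambda>f. companion_mat (R_poly \<delta> f)) fs)"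
  using assms
proof (induction Ms)
  case Nil
  then show ?case by (intro exI[of _ "[]"]) (simp add: block_multiset.empty)
next
  case (Cons M Ms)
  then obtain fs where fs: "block_multiset good (mset fs)"
    "diag_block_mat Ms = diag_block_mat (map (\<lambda>f. companion_mat (R_poly \<delta> f)) fs)" by auto
  have "block_matrix good \<delta> M" using Cons.prems by simp
  then consider r n where "good r" "n \<ge> 1" "M = companion_mat (R_poly \<delta> (r ^ n))"
    | r n where "irreducible r" "monic r" "n \<ge> 1"
        "M = diag_block_mat [companion_mat (R_poly \<delta> (r ^ n)), companion_mat (R_poly \<delta> (r ^ n))]"
    unfolding block_matrix_def by blast
  then show ?case
  proof cases
    case 1
    then show ?thesis
      using block_multiset.single[OF 1(1,2) fs(1)] diag_block_mat_cong_Cons[OF fs(2), of M]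
      by (intro exI[of _ "r ^ n # fs"]) simp
  next
    case 2
    then show ?thesis
      using block_multiset.double[OF 2(1-3) fs(1)]
        diag_block_mat_Cons_diag[OF fs(2), of "[companion_mat (R_poly \<delta> (r ^ n)), companion_mat (R_poly \<delta> (r ^ n))]"]
      by (intro exI[of _ "r ^ n # r ^ n # fs"]) (simp del: diag_block_mat.simps)
  qed
qed

lemma block_multiset_imp_block_matrices:
  assumes "block_multiset good F"
  shows "\<exists>fs Ms. mset fs = F \<and> (\<forall>M\<in>set Ms. block_matrix good \<delta> M) \<and>
    diag_block_mat Ms = diag_block_mat (map (\<lambda>f. companion_mat (R_poly \<delta> f)) fs)"
  using assms
proof (induction rule: block_multiset.induct)
  case empty
  show ?case by (intro exI[of _ "[]"]) simp
next
  case (single r n F)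
  then obtain fs Ms where fs: "mset fs = F" "\<forall>M\<in>set Ms. block_matrix good \<delta> M"
    "diag_block_mat Ms = diag_block_mat (map (\<lambda>f. companion_mat (R_poly \<delta> f)) fs)" by blast
  let ?M = "companion_mat (R_poly \<delta> (r ^ n))"
  have "block_matrix good \<delta> ?M" using single.hyps by (auto simp: block_matrix_def)
  then show ?case
    using fs(1,2) diag_block_mat_cong_Cons[OF fs(3), of ?M]
    by (intro exI[of _ "r ^ n # fs"] exI[of _ "?M # Ms"]) (simp del: diag_block_mat.simps)
next
  case (double r n F)
  then obtain fs Ms where fs: "mset fs = F" "\<forall>M\<in>set Ms. block_matrix good \<delta> M"
    "diag_block_mat Ms = diag_block_mat (map (\<lambda>f. companion_mat (R_poly \<delta> f)) fs)" by blast
  let ?M = "diag_block_mat [companion_mat (R_poly \<delta> (r ^ n)), companion_mat (R_poly \<delta> (r ^ n))]"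
  have "block_matrix good \<delta> ?M" using double.hyps unfolding block_matrix_def by blast
  then show ?case
    using fs(1,2) diag_block_mat_Cons_diag[OF fs(3), of "[companion_mat (R_poly \<delta> (r ^ n)), companion_mat (R_poly \<delta> (r ^ n))]"]
    by (intro exI[of _ "r ^ n # r ^ n # fs"] exI[of _ "?M # Ms"]) (simp del: diag_block_mat.simps)
qed

text \<open>For \<open>r\<close> prime to the discriminant, isotropy of the norm and solvability of
  the conic modulo \<open>r\<close> agree: a point \<open>(x, z)\<close> is the isotropic vector of
  \<open>B - x - zu\<close>, with coordinates \<open>(- x, - z, 1, 0)\<close>.\<close>

lemma has_type_iff:
  fixes p q r :: "'a::field poly"
  assumes p: "p = [:be * d, - l, 1:]" and q: "q = [:be, - m, 1:]" and nz: "be \<noteq> 0" "d \<noteq> 0"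
  shows "has_type1 p q r \<longleftrightarrow> irreducible r \<and> monic r \<and> \<not> r dvd disc_poly d l m be \<and>
      (\<exists>x z. r dvd conic [:0, 1:] [:d:] [:l:] [:m:] [:be:] x z)"
    and "has_type2 p q r \<longleftrightarrow> irreducible r \<and> monic r \<and> \<not> r dvd disc_poly d l m be \<and>
      \<not> (\<exists>x z. r dvd conic [:0, 1:] [:d:] [:l:] [:m:] [:be:] x z)"
proof -
  have d: "poly p 0 * inverse (poly q 0) = d" using nz by (simp add: p q)
  have iso: "norm_isotropic p q r \<longleftrightarrow> (\<exists>x z. r dvd conic [:0, 1:] [:d:] [:l:] [:m:] [:be:] x z)"
    if r: "irreducible r" "\<not> r dvd disc_poly d l m be"
  proof
    assume "norm_isotropic p q r"
    then obtain a b c e where "\<not> (r dvd a \<and> r dvd b \<and> r dvd c \<and> r dvd e)"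
      "r dvd quat_norm [:0, 1:] [:d:] [:l:] [:m:] [:be:] a b c e"
      unfolding norm_isotropic_iff[OF p q nz(1)] by blast
    then show "\<exists>x z. r dvd conic [:0, 1:] [:d:] [:l:] [:m:] [:be:] x z"
      using conic_point_of_isotropic[OF r(1), of "[:0, 1:]" "[:d:]" "[:l:]" "[:m:]" "[:be:]"] r(2)
      unfolding disc_poly_def by blast
  next
    assume "\<exists>x z. r dvd conic [:0, 1:] [:d:] [:l:] [:m:] [:be:] x z"
    then obtain x z where xz: "r dvd conic [:0, 1:] [:d:] [:l:] [:m:] [:be:] x z" by blast
    have "quat_norm [:0, 1:] [:d:] [:l:] [:m:] [:be:] (- x) (- z) 1 0 = conic [:0, 1:] [:d:] [:l:] [:m:] [:be:] x z"
      unfolding quat_norm_def conic_def quad_norm_def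
      by (simp add: algebra_simps power2_eq_square
          del: mult_pCons_left mult_pCons_right minus_pCons add_pCons diff_pCons)
    moreover have "\<not> r dvd 1" using r(1) irreducible_not_unit by blast
    ultimately show "norm_isotropic p q r"
      unfolding norm_isotropic_iff[OF p q nz(1)] using xz by metis
  qed
  show "has_type1 p q r \<longleftrightarrow> irreducible r \<and> monic r \<and> \<not> r dvd disc_poly d l m be \<and>
      (\<exists>x z. r dvd conic [:0, 1:] [:d:] [:l:] [:m:] [:be:] x z)"
    unfolding has_type1_def d using iso Root_R_poly_disjoint_iff[OF p q nz, of r] by blast
  show "has_type2 p q r \<longleftrightarrow> irreducible r \<and> monic r \<and> \<not> r dvd disc_poly d l m be \<and>
      \<not> (\<exists>x z. r dvd conic [:0, 1:] [:d:] [:l:] [:m:] [:be:] x z)"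
    unfolding has_type2_def d using iso Root_R_poly_disjoint_iff[OF p q nz, of r] by blast
qed

lemma monic_degree_2_eq:
  fixes p :: "'a::comm_ring_1 poly"
  assumes "monic p" "degree p = 2"
  shows "p = [:poly.coeff p 0, poly.coeff p 1, 1:]"
proof (rule poly_eqI)
  fix n :: nat
  consider "n = 0" | "n = 1" | "n = 2" | "n > 2" by linarith
  then show "poly.coeff p n = poly.coeff [:poly.coeff p 0, poly.coeff p 1, 1:] n"
    using assms by cases (auto simp: coeff_eq_0 numeral_2_eq_2)
qed

lemma mset_map_upt_sum: "mset (map P [1..<Suc N]) = (\<Sum>i\<in>{1..N}. {#P i#})"
  by (simp add: image_mset_mset_set_sum atLeastLessThanSuc_atLeastAtMost del: upt_Suc)

theorem theorem4p9:
  fixes scale :: "'a::field \<Rightarrow> 'v::ab_group_add \<Rightarrow> 'v"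
    and p q :: "'a poly" and u :: "'v \<Rightarrow> 'v" and \<delta> :: 'a
  assumes fin_dim: "finite_dimensional_vector_space scale Basis"
    and endo: "Vector_Spaces.linear scale scale u"
    and p: "monic p" "degree p = 2"
    and q: "monic q" "degree q = 2"
    and nz: "poly p 0 * poly q 0 \<noteq> 0"
    and reg: "q_regular scale p q u"
    and \<delta>: "\<delta> = poly p 0 * inverse (poly q 0)"
  shows
    "(is_quotient scale p q u \<longleftrightarrow>
       (\<exists>P. (\<forall>i\<ge>1. monic (P i)) \<and>
            invariant_factors scale u (\<lambda>i. R_poly \<delta> (P i)) \<and>
            (\<forall>r. has_type2 p q r \<longrightarrow>
               (\<forall>n\<ge>1. poly_valuation r (P (2 * n - 1)) = poly_valuation r (P (2 * n))))))
     \<and>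
     (is_quotient scale p q u \<longleftrightarrow>
       (\<exists>Ms bs.
          (\<forall>M \<in> set Ms.
             (\<exists>r n. has_type1 p q r \<and> n \<ge> 1 \<and>
                M = companion_mat (R_poly \<delta> (r ^ n))) \<or>
             (\<exists>r n. irreducible r \<and> monic r \<and> n \<ge> 1 \<and>
                M = diag_block_mat [companion_mat (R_poly \<delta> (r ^ n)),
                                    companion_mat (R_poly \<delta> (r ^ n))])) \<and>
          represented_in scale u bs (diag_block_mat Ms)))"
  (is "(?quot \<longleftrightarrow> ?inv) \<and> (?quot \<longleftrightarrow> ?mat)")
proof -
  interpret V: finite_dimensional_vector_space scale Basis by (rule fin_dim)
  interpret u: Vector_Spaces.linear scale scale u by (rule endo)
  define l m be where "l = - poly.coeff p 1" and "m = - poly.coeff q 1" and "be = poly.coeff q 0"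
  have nz': "poly.coeff p 0 \<noteq> 0" "be \<noteq> 0" using nz by (auto simp: be_def poly_0_coeff_0)
  have d: "poly.coeff p 0 = be * \<delta>" using nz' by (simp add: \<delta> be_def poly_0_coeff_0)
  then have dnz: "\<delta> \<noteq> 0" using nz' by auto
  have p': "p = [:be * \<delta>, - l, 1:]" using monic_degree_2_eq[OF p] by (simp add: l_def flip: d)
  have q': "q = [:be, - m, 1:]" using monic_degree_2_eq[OF q] by (simp add: m_def be_def)
  note type1 = has_type_iff(1)[OF p' q' nz'(2) dnz] and type2 = has_type_iff(2)[OF p' q' nz'(2) dnz]
  have type1_irr: "irreducible r \<and> monic r" if "has_type1 p q r" for r using that type1 by blast
  let ?rep = "\<lambda>fs. \<exists>bs. represented_in scale u bs (diag_block_mat (map (\<lambda>f. companion_mat (R_poly \<delta> f)) fs))"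
  let ?good = "has_type1 p q"
  have monic: "\<forall>f\<in>set fs. monic f" if "block_multiset ?good (mset fs)" for fs
    using block_multiset_monic[OF that] type1_irr by simp
  have mat_rep: "\<exists>fs. block_multiset ?good (mset fs) \<and> ?rep fs" if m: ?mat
  proof -
    obtain Ms bs where "\<forall>M\<in>set Ms. block_matrix ?good \<delta> M" "represented_in scale u bs (diag_block_mat Ms)"
      using m unfolding block_matrix_def by blast
    then show ?thesis using block_matrices_imp_block_multiset by metis
  qed
  have inv_rep: "\<exists>N. (\<forall>i>N. P i = 1) \<and> ?rep (map P [1..<Suc N])"
    if P: "\<forall>i\<ge>1. monic (P i)" "invariant_factors scale u (\<lambda>i. R_poly \<delta> (P i))" for P
  proof -
    obtain N where N: "\<forall>i>N. R_poly \<delta> (P i) = 1"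
      "\<exists>bs. represented_in scale u bs (diag_block_mat (map (\<lambda>i. companion_mat (R_poly \<delta> (P i))) [1..<Suc N]))"
      using P(2) unfolding invariant_factors_def by blast
    have "P i = 1" if i: "i > N" for i
    proof -
      have m: "monic (P i)" using P(1) i by simp
      have "degree (R_poly \<delta> (P i)) = 0" using N(1) i by simp
      then have "degree (P i) = 0" using R_poly_monic(1)[OF m, of \<delta>] by simp
      then show ?thesis using monic_degree_0[OF m] by blast
    qed
    then show ?thesis using N(2) by (intro exI[of _ N]) (simp add: comp_def del: upt_Suc)
  qed
  \<comment> \<open>Without an inverse of \<open>u\<close> there is no \<open>v\<close>. In that
    case all three conditions fail: (i) makes \<open>u\<close> bijective, and the nonzero constant
    terms of the polynomials \<open>R_\<delta>(f)\<close> make it surjective in (ii) and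
    (iii).\<close>
  show ?thesis
  proof (cases "surj u")
    case False
    have "\<not> ?quot"
    proof
      assume ?quot
      then obtain b where "quat_module scale Basis u (\<lambda>x. u x + scale \<delta> (inv_into UNIV u x)) \<delta> b l m be"
        using V.quotient_quat_module[OF p' q' nz'(2) dnz] by blast
      then have "inj u" by (intro quadratic_over.inj_u quat_module.axioms(1))
      then show False using V.linear_inj_imp_surj[OF endo] False by blast
    qed
    moreover have "\<not> ?inv"
    proof
      assume ?inv
      then obtain P where P: "\<forall>i\<ge>1. monic (P i)" "invariant_factors scale u (\<lambda>i. R_poly \<delta> (P i))" by blast
      then obtain N where "?rep (map P [1..<Suc N])" using inv_rep by blast
      moreover have "\<forall>f\<in>set (map P [1..<Suc N]). monic f" using P(1) by auto
      ultimately show False using V.represented_in_R_poly_surj[OF endo dnz] False by blast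
    qed
    moreover have "\<not> ?mat"
      using mat_rep monic V.represented_in_R_poly_surj[OF endo dnz] False by blast
    ultimately show ?thesis by blast
  next
    case True
    then have inj: "inj u" using V.linear_surj_imp_inj[OF endo] by blast
    then have bij: "bij u" using True by (simp add: bij_def)
    let ?v = "\<lambda>x. u x + scale \<delta> (inv_into UNIV u x)"
    have uw: "u (inv_into UNIV u x) = x" for x using True by (rule surj_f_inv_f)
    have w: "inv_into UNIV u y = x" if "u x = y" for x y using inj that by auto
    interpret quadratic_over scale Basis u ?v \<delta>
    proof unfold_locales
      have "inv_into UNIV u (x + y) = inv_into UNIV u x + inv_into UNIV u y"
        "inv_into UNIV u (scale c x) = scale c (inv_into UNIV u x)" for x y c
        by (rule w, simp add: u.add u.scale uw)+
      then show "u (x + y) + scale \<delta> (inv_into UNIV u (x + y)) =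
          u x + scale \<delta> (inv_into UNIV u x) + (u y + scale \<delta> (inv_into UNIV u y))"
        "u (scale c x) + scale \<delta> (inv_into UNIV u (scale c x)) =
          scale c (u x + scale \<delta> (inv_into UNIV u x))" for x y c
        by (simp_all add: u.add u.scale V.scale_right_distrib mult.commute)
    qed (use inj dnz in \<open>simp_all add: u.add u.scale uw\<close>)
    \<comment> \<open>The common ground of the three conditions; each is compared with it and no two
      decompositions are ever compared with each other.\<close>
    let ?cyc = "\<exists>F. block_multiset ?good F \<and> cyclic_decomp F UNIV"
    have disc: "x = 0" if "act (disc_poly \<delta> l m be) x = 0" for x
      using q_regular_disc_injective[OF p' q' nz'(2) reg that] .
    have "?quot \<longleftrightarrow> ?cyc"
    proof
      assume ?quot
      then obtain b where b: "quat_module scale Basis u ?v \<delta> b l m be"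
        using V.quotient_quat_module[OF p' q' nz'(2) dnz] by blast
      interpret quat: quat_module scale Basis u ?v \<delta> b l m be by (rule b)
      \<comment> \<open>The blocks produced by the algebra are single exactly at irreducibles with a
        point on the conic, which is Type 1 by \<open>has_type_iff\<close>.\<close>
      have "quat.split_irr = ?good" by (simp add: fun_eq_iff quat.split_irr_def type1)
      moreover have "quat.stable UNIV" by (simp add: quat.stable_def)
      ultimately show ?cyc using quat.block_decomposition[OF disc, of UNIV] by simp
    next
      assume ?cyc
      then obtain F gs where F: "block_multiset ?good F" "mset (map fst gs) = F" "cyclic_gens gs UNIV"
        unfolding cyclic_decomp_def by blast
      have good: "irreducible r \<and> \<not> r dvd disc_poly \<delta> l m be \<and>
          (\<exists>x z. r dvd conic [:0, 1:] [:\<delta>:] [:l:] [:m:] [:be:] x z)" if "?good r" for r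
        using that type1 by blast
      have "\<forall>(f, x) \<in> set gs. act f x = 0" using F(3) by (auto simp: cyclic_gens_def)
      then obtain w where w: "mset (map (\<lambda>(f, x, y). (f, x)) w) = mset gs"
        "\<forall>(f, x, y) \<in> set w. act f y = 0" "compatible l m be w"
        using block_multiset_compatible[OF F(1) good F(2)] by blast
      have "cyclic_gens (map (\<lambda>(f, x, y). (f, x)) w) UNIV" using cyclic_gens_mset[OF w(1)] F(3) by blast
      then obtain b where "quat_module scale Basis u ?v \<delta> b l m be"
        using compatible_quat_module[OF nz'(2) _ w(2,3)] by blast
      then show ?quot using quat_module.is_quotient[OF _ p' q' bij] by blast
    qed
    moreover have "?mat \<longleftrightarrow> ?cyc"
    proof
      assume ?mat
      then show ?cyc using mat_rep monic represented_in_iff_cyclic_decomp by blast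
    next
      assume ?cyc
      then obtain F where F: "block_multiset ?good F" "cyclic_decomp F UNIV" by blast
      obtain fs Ms where fs: "mset fs = F" "\<forall>M\<in>set Ms. block_matrix ?good \<delta> M"
        "diag_block_mat Ms = diag_block_mat (map (\<lambda>f. companion_mat (R_poly \<delta> f)) fs)"
        using block_multiset_imp_block_matrices[OF F(1)] by blast
      have "?rep fs" using represented_in_iff_cyclic_decomp[of fs] monic[of fs] F fs(1) by blast
      then have "\<exists>bs. represented_in scale u bs (diag_block_mat Ms)" unfolding fs(3) .
      then show ?mat using fs(2) unfolding block_matrix_def by blast
    qed
    moreover have "?inv \<longleftrightarrow> ?cyc"
    proof
      assume ?inv
      then obtain P where P: "\<forall>i\<ge>1. monic (P i)" "invariant_factors scale u (\<lambda>i. R_poly \<delta> (P i))"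
        "\<forall>r. has_type2 p q r \<longrightarrow> (\<forall>n\<ge>1. poly_valuation r (P (2 * n - 1)) = poly_valuation r (P (2 * n)))"
        by blast
      obtain N where N: "\<forall>i>N. P i = 1" "?rep (map P [1..<Suc N])" using inv_rep[OF P(1,2)] by blast
      have "\<forall>f\<in>set (map P [1..<Suc N]). monic f" using P(1) by auto
      then have "cyclic_decomp (\<Sum>i\<in>{1..N}. {#P i#}) UNIV"
        using N(2) represented_in_iff_cyclic_decomp unfolding mset_map_upt_sum[symmetric] by blast
      note dec = this
      \<comment> \<open>The two types exhaust the irreducibles prime to the discriminant.\<close>
      have ty2: "has_type2 p q r" if "irreducible r" "monic r" "\<not> r dvd disc_poly \<delta> l m be" "\<not> ?good r" for r
        using that unfolding type1[of r] type2[of r] by blast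
      show ?cyc
      proof (rule invariant_factors_imp_blocks[OF disc])
        show "monic (P i)" if "i \<ge> 1" for i using P(1) that by blast
        show "P i = 1" if "i > N" for i using N(1) that by blast
        show "poly_valuation r (P (2 * n - 1)) = poly_valuation r (P (2 * n))"
          if "irreducible r" "monic r" "\<not> r dvd disc_poly \<delta> l m be" "\<not> ?good r" "n \<ge> 1" for r n
          using P(3) ty2[OF that(1-4)] that(5) by blast
      qed (simp_all only: dec)
    next
      assume ?cyc
      then obtain F where F: "block_multiset ?good F" "cyclic_decomp F UNIV" by blast
      obtain P N where P: "\<forall>i\<ge>1. monic (P i)" "\<forall>i\<ge>1. P (Suc i) dvd P i" "\<forall>i>N. P i = 1"
        "cyclic_decomp (\<Sum>i\<in>{1..N}. {#P i#}) UNIV"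
        "\<forall>r. irreducible r \<longrightarrow> monic r \<longrightarrow> \<not> ?good r \<longrightarrow>
          (\<forall>n\<ge>1. poly_valuation r (P (2 * n - 1)) = poly_valuation r (P (2 * n)))"
        using blocks_imp_invariant_factors[OF F(1) type1_irr F(2)] by blast
      have "\<forall>f\<in>set (map P [1..<Suc N]). monic f" using P(1) by auto
      then have "?rep (map P [1..<Suc N])"
        using P(4) represented_in_iff_cyclic_decomp unfolding mset_map_upt_sum[symmetric] by blast
      then have "\<exists>bs. represented_in scale u bs (diag_block_mat (map (\<lambda>i. companion_mat (R_poly \<delta> (P i))) [1..<Suc N]))"
        by (simp add: comp_def del: upt_Suc)
      moreover have "R_poly \<delta> (P (Suc i)) dvd R_poly \<delta> (P i)" if i: "i \<ge> 1" for i
      proof (rule R_poly_dvd)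
        show "P (Suc i) dvd P i" using P(2) i by blast
        show "P i \<noteq> 0" using P(1) i by (metis coeff_0 zero_neq_one)
      qed
      moreover have "monic (R_poly \<delta> (P i))" if "i \<ge> 1" for i
        using P(1) that by (intro R_poly_monic(2)) blast
      moreover have "\<forall>i>N. R_poly \<delta> (P i) = 1" using P(3) by simp
      ultimately have "invariant_factors scale u (\<lambda>i. R_poly \<delta> (P i))"
        unfolding invariant_factors_def by blast
      moreover have "\<not> ?good r" "irreducible r" "monic r" if "has_type2 p q r" for r
        using that unfolding type1[of r] type2[of r] by blast+
      ultimately show ?inv using P(1,5) by blast
    qed
    ultimately show ?thesis by blast
  qed
qed

end
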